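(* Let $n\ge 2$, let $\Omega\subset\mathbb{R}^n$ be a convex domain with $0\in\Omega$, and let $h\in C^\infty(\Omega)$ with $h>0$. Let $F_h(x):=\frac{1}{h(x)}(1,x)\in\mathbb{R}^{n+1}$ for $x\in\Omega$, and set $$f_h:=(n-1)\log h,\qquad \overline f_h:=f_h\circ F_h^{-1},\qquad \overline g_h:=(F_h)_*\delta ,$$ regarded as a function and a Riemannian metric on $F_h(\Omega)$. Let $\kappa\in\mathbb{R}$ and assume $$\mathrm{Ric}^1_{\overline g_h,\overline f_h}\ \ge\ (n-1)\,\kappa\,\mathrm{e}^{-\frac{4\overline f_h}{n-1}}\,\overline g_h .$$ Assume moreover that for every $0<r<R<\tau_\kappa$, $$\frac{\mathfrak m_{\frac{n+1}{n-1}\overline f_h,\overline g_h}\big(C_{\overline g_h,\overline f_h,R}(F_h(0))\big)}{\mathfrak m_{\frac{n+1}{n-1}\overline f_h,\overline g_h}\big(C_{\overline g_h,\overline f_h,r}(F_h(0))\big)}=\frac{v(n,\kappa,R)}{v(n,\kappa,r)} .$$ Then $F_h(\Omega)$ is a rotationally symmetric hyperquadric. In particular, setting $\widetilde\kappa:=h(0)^{-4}\kappa$, $$h(x)=h(0)\sqrt{1+\widetilde\kappa|x|^2}\quad\text{for } x\in\Omega,\qquad \Omega=\Omega(\widetilde\kappa).$$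
   Context: $\delta$ is the Euclidean metric on $\mathbb{R}^n$ (restricted to $\Omega$). $F_h$ is an embedding, and $(F_h)_*\delta$ is the metric on $F_h(\Omega)$ making $F_h:(\Omega,\delta)\to F_h(\Omega)$ an isometry. For an $n$-dimensional Riemannian manifold $(M,g)$ and $f\in C^\infty(M)$: $\mathrm{Ric}^1_{g,f}:=\mathrm{Ric}_g+\mathrm{Hess}_g f+\frac{\mathrm{d}f\otimes \mathrm{d}f}{n-1}$, and $\mathfrak m_{f,g}:=\mathrm{e}^{-f}v_g$ with $v_g$ the Riemannian volume measure (so $\mathfrak m_{\frac{n+1}{n-1}f,g}=\mathrm{e}^{-\frac{n+1}{n-1}f}v_g$). $(M,g)$ need not be complete. For $p\in M$ and a unit vector $\theta\in U_pM\subset T_pM$, let $\gamma_{p,\theta}:[0,\rho_p(\theta))\to M$ be the maximal unit-speed geodesic with $\gamma_{p,\theta}(0)=p$, $\gamma_{p,\theta}'(0)=\theta$; set $\tau_p(\theta):=\sup\{t\in[0,\rho_p(\theta)) : d_g(p,\gamma_{p,\theta}(t))=t\}$, $s_{f,p,\theta}(t):=\int_0^t \mathrm{e}^{-\frac{2f(\gamma_{p,\theta}(\xi))}{n-1}}\,\mathrm{d}\xi$ for $t\in[0,\tau_p(\theta))$, and for $r\ge 0$ $$C_{g,f,r}(p):=\{\gamma_{p,\theta}(t) : \theta\in U_pM,\ 0\le t<\tau_p(\theta),\ s_{f,p,\theta}(t)<r\}.$$ $\mathrm{sn}_\kappa(s)=\frac{1}{\sqrt\kappa}\sin(\sqrt\kappa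 s)$ if $\kappa>0$, $s$ if $\kappa=0$, $\frac1{\sqrt{-\kappa}}\sinh(\sqrt{-\kappa}s)$ if $\kappa<0$. $C_\kappa:=\pi/\sqrt\kappa$ if $\kappa>0$ and $+\infty$ if $\kappa\le 0$. $\overline{\mathrm{sn}}_\kappa(s)=\mathrm{sn}_\kappa(s)$ for $0\le s<C_\kappa$ and $0$ for $s\ge C_\kappa$. $v(n,\kappa,r):=\omega_{n-1}\int_0^r\overline{\mathrm{sn}}_\kappa(\xi)^{n-1}\,\mathrm{d}\xi$, where $\omega_{n-1}$ is the volume of the standard unit sphere $\mathbb{S}^{n-1}$. $\tau_\kappa:=\frac{\pi}{2\sqrt\kappa}$ if $\kappa>0$ and $+\infty$ if $\kappa\le0$. $\Omega(\kappa):=\mathbb{R}^n$ if $\kappa\ge 0$ and $\Omega(\kappa):=\{x\in\mathbb{R}^n:|x|<1/\sqrt{-\kappa}\}$ if $\kappa<0$. The rotationally symmetric hyperquadric meant here is a set of the form $\{(y_0,y)\in\mathbb{R}\times\mathbb{R}^n : y_0>0,\ c^2y_0^2+\frac{\kappa}{c^2}|y|^2=1\}$ with $c>0$ (for $\kappa>0$ the upper half of an ellipsoid of revolution, for $\kappa<0$ the upper sheet of a two-sheeted hyperboloid of revolution, for $\kappa=0$ a degenerate case). *)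

theory Defs
  imports "HOL-Analysis.Analysis"
begin

section \<open>Smooth functions\<close>

text \<open>Intended for open \<open>S\<close>.\<close>

primrec Ck_on :: "nat \<Rightarrow> 'a::real_normed_vector set \<Rightarrow> ('a \<Rightarrow> 'b::real_normed_vector) \<Rightarrow> bool" where
  "Ck_on 0 S f \<longleftrightarrow> continuous_on S f"
| "Ck_on (Suc k) S f \<longleftrightarrow> (\<forall>x\<in>S. f differentiable (at x)) \<and>
     (\<forall>v. Ck_on k S (\<lambda>x. frechet_derivative f (at x) v))"

definition smooth_on :: "'a::real_normed_vector set \<Rightarrow> ('a \<Rightarrow> 'b::real_normed_vector) \<Rightarrow> bool" where
  "smooth_on S f \<longleftrightarrow> (\<forall>k. Ck_on k S f)"

definition partial_deriv :: "'n::finite \<Rightarrow> (real^'n \<Rightarrow> 'b::real_normed_vector) \<Rightarrow> real^'n \<Rightarrow> 'b" where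
  "partial_deriv i f x = frechet_derivative f (at x) (axis i 1)"

section \<open>Riemannian geometry of a globally parametrised submanifold\<close>

text \<open>
  The manifold is \<open>M = \<phi> ` U\<close>, where \<open>U\<close> is an open subset of \<open>real^'n\<close> and \<open>\<phi>\<close> is a smooth
  embedding of \<open>U\<close> into a Euclidean space. Tangent vectors of \<open>M\<close> are vectors of the ambient
  space, and a Riemannian metric \<open>g y u v\<close> on \<open>M\<close> takes a point \<open>y\<close> of \<open>M\<close> and two vectors
  tangent to \<open>M\<close> at \<open>y\<close>. Curvature, Hessian, geodesic equation and volume are given by their
  classical expressions in the global chart inverse to \<open>\<phi>\<close>; as these expressions are
  tensorial, they do not depend on the parametrisation of \<open>M\<close>.
\<close>

type_synonym 'b metric_tensor = "'b \<Rightarrow> 'b \<Rightarrow> 'b \<Rightarrow> real"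

definition chart :: "(real^'n::finite \<Rightarrow> 'b::euclidean_space) \<Rightarrow> (real^'n) set \<Rightarrow> 'b \<Rightarrow> real^'n" where
  "chart \<phi> U = the_inv_into U \<phi>"

definition tangent_space ::
  "(real^'n::finite \<Rightarrow> 'b::euclidean_space) \<Rightarrow> (real^'n) set \<Rightarrow> 'b \<Rightarrow> 'b set" where
  "tangent_space \<phi> U y = range (frechet_derivative \<phi> (at (chart \<phi> U y)))"

definition chart_vec ::
  "(real^'n::finite \<Rightarrow> 'b::euclidean_space) \<Rightarrow> (real^'n) set \<Rightarrow> 'b \<Rightarrow> 'b \<Rightarrow> real^'n" where
  "chart_vec \<phi> U y u = inv (frechet_derivative \<phi> (at (chart \<phi> U y))) u"

definition pushforward_metric ::
  "(real^'n::finite \<Rightarrow> 'b::euclidean_space) \<Rightarrow> (real^'n) set \<Rightarrow> (real^'n) metric_tensor \<Rightarrow> 'b metric_tensor" where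
  "pushforward_metric \<phi> U g0 y u v = g0 (chart \<phi> U y) (chart_vec \<phi> U y u) (chart_vec \<phi> U y v)"

definition euclidean_metric :: "'a::euclidean_space metric_tensor" where
  "euclidean_metric x u v = u \<bullet> v"

definition metric_matrix ::
  "(real^'n::finite \<Rightarrow> 'b::euclidean_space) \<Rightarrow> 'b metric_tensor \<Rightarrow> real^'n \<Rightarrow> real^'n^'n" where
  "metric_matrix \<phi> g x = (\<chi> i j. g (\<phi> x) (partial_deriv i \<phi> x) (partial_deriv j \<phi> x))"

text \<open>\<open>christoffel \<phi> g k i j\<close> has \<open>k\<close> as its upper index.\<close>

definition christoffel ::
  "(real^'n::finite \<Rightarrow> 'b::euclidean_space) \<Rightarrow> 'b metric_tensor \<Rightarrow> 'n \<Rightarrow> 'n \<Rightarrow> 'n \<Rightarrow> real^'n \<Rightarrow> real" where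
  "christoffel \<phi> g k i j x =
     (\<Sum>l\<in>UNIV. matrix_inv (metric_matrix \<phi> g x) $ k $ l *
        (partial_deriv i (\<lambda>z. metric_matrix \<phi> g z $ j $ l) x
         + partial_deriv j (\<lambda>z. metric_matrix \<phi> g z $ i $ l) x
         - partial_deriv l (\<lambda>z. metric_matrix \<phi> g z $ i $ j) x)) / 2"

text \<open>The sign is such that round spheres have positive Ricci curvature.\<close>

definition ricci_coeff ::
  "(real^'n::finite \<Rightarrow> 'b::euclidean_space) \<Rightarrow> 'b metric_tensor \<Rightarrow> 'n \<Rightarrow> 'n \<Rightarrow> real^'n \<Rightarrow> real" where
  "ricci_coeff \<phi> g i j x =
     (\<Sum>k\<in>UNIV. partial_deriv k (christoffel \<phi> g k i j) x - partial_deriv j (christoffel \<phi> g k i k) x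
        + (\<Sum>l\<in>UNIV. christoffel \<phi> g k k l x * christoffel \<phi> g l i j x
                      - christoffel \<phi> g k j l x * christoffel \<phi> g l i k x))"

definition Ric ::
  "(real^'n::finite \<Rightarrow> 'b::euclidean_space) \<Rightarrow> (real^'n) set \<Rightarrow> 'b metric_tensor \<Rightarrow> 'b metric_tensor" where
  "Ric \<phi> U g y u v =
     (\<Sum>i\<in>UNIV. \<Sum>j\<in>UNIV. ricci_coeff \<phi> g i j (chart \<phi> U y) * chart_vec \<phi> U y u $ i * chart_vec \<phi> U y v $ j)"

definition hess_coeff ::
  "(real^'n::finite \<Rightarrow> 'b::euclidean_space) \<Rightarrow> 'b metric_tensor \<Rightarrow> ('b \<Rightarrow> real) \<Rightarrow> 'n \<Rightarrow> 'n \<Rightarrow> real^'n \<Rightarrow> real" where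
  "hess_coeff \<phi> g f i j x =
     partial_deriv i (partial_deriv j (f \<circ> \<phi>)) x
     - (\<Sum>k\<in>UNIV. christoffel \<phi> g k i j x * partial_deriv k (f \<circ> \<phi>) x)"

definition Hess ::
  "(real^'n::finite \<Rightarrow> 'b::euclidean_space) \<Rightarrow> (real^'n) set \<Rightarrow> 'b metric_tensor \<Rightarrow> ('b \<Rightarrow> real) \<Rightarrow> 'b metric_tensor" where
  "Hess \<phi> U g f y u v =
     (\<Sum>i\<in>UNIV. \<Sum>j\<in>UNIV. hess_coeff \<phi> g f i j (chart \<phi> U y) * chart_vec \<phi> U y u $ i * chart_vec \<phi> U y v $ j)"

definition differential ::
  "(real^'n::finite \<Rightarrow> 'b::euclidean_space) \<Rightarrow> (real^'n) set \<Rightarrow> ('b \<Rightarrow> real) \<Rightarrow> 'b \<Rightarrow> 'b \<Rightarrow> real" where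
  "differential \<phi> U f y u = frechet_derivative (f \<circ> \<phi>) (at (chart \<phi> U y)) (chart_vec \<phi> U y u)"

definition Ric1 ::
  "(real^'n::finite \<Rightarrow> 'b::euclidean_space) \<Rightarrow> (real^'n) set \<Rightarrow> 'b metric_tensor \<Rightarrow> ('b \<Rightarrow> real) \<Rightarrow> 'b metric_tensor" where
  "Ric1 \<phi> U g f y u v =
     Ric \<phi> U g y u v + Hess \<phi> U g f y u v
     + differential \<phi> U f y u * differential \<phi> U f y v / (real CARD('n) - 1)"

definition riemannian_volume ::
  "(real^'n::finite \<Rightarrow> 'b::euclidean_space) \<Rightarrow> (real^'n) set \<Rightarrow> 'b metric_tensor \<Rightarrow> 'b measure" where
  "riemannian_volume \<phi> U g =
     distr (density (restrict_space lborel U) (\<lambda>x. ennreal (sqrt (det (metric_matrix \<phi> g x)))))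
       (restrict_space borel (\<phi> ` U)) \<phi>"

definition weighted_volume ::
  "(real^'n::finite \<Rightarrow> 'b::euclidean_space) \<Rightarrow> (real^'n) set \<Rightarrow> ('b \<Rightarrow> real) \<Rightarrow> 'b metric_tensor \<Rightarrow> 'b measure" where
  "weighted_volume \<phi> U f g = density (riemannian_volume \<phi> U g) (\<lambda>y. ennreal (exp (- f y)))"

text \<open>
  \<open>valid_path\<close> admits curves whose derivative blows up at a break point, so the length may be
  infinite. It is therefore a nonnegative Lebesgue integral, whereas \<open>integral\<close> would return 0
  in that case.
\<close>

definition curve_length :: "'b::euclidean_space metric_tensor \<Rightarrow> (real \<Rightarrow> 'b) \<Rightarrow> ennreal" where
  "curve_length g c =
     (\<integral>\<^sup>+t\<in>{0..1}. ennreal (sqrt (g (c t) (vector_derivative c (at t)) (vector_derivative c (at t)))) \<partial>lborel)"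

definition riemannian_dist :: "'b::euclidean_space set \<Rightarrow> 'b metric_tensor \<Rightarrow> 'b \<Rightarrow> 'b \<Rightarrow> ennreal" where
  "riemannian_dist M g p q =
     (INF c\<in>{c. valid_path c \<and> path_image c \<subseteq> M \<and> pathstart c = p \<and> pathfinish c = q}. curve_length g c)"

definition unit_tangent_space ::
  "(real^'n::finite \<Rightarrow> 'b::euclidean_space) \<Rightarrow> (real^'n) set \<Rightarrow> 'b metric_tensor \<Rightarrow> 'b \<Rightarrow> 'b set" where
  "unit_tangent_space \<phi> U g p = {\<theta> \<in> tangent_space \<phi> U p. g p \<theta> \<theta> = 1}"

definition is_geodesic ::
  "(real^'n::finite \<Rightarrow> 'b::euclidean_space) \<Rightarrow> (real^'n) set \<Rightarrow> 'b metric_tensor \<Rightarrow> 'b \<Rightarrow> 'b \<Rightarrow> real \<Rightarrow> (real \<Rightarrow> 'b) \<Rightarrow> bool" where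
  "is_geodesic \<phi> U g p \<theta> T \<gamma> \<longleftrightarrow>
     0 < T \<and> \<gamma> ` {0..<T} \<subseteq> \<phi> ` U \<and> \<gamma> 0 = p \<and>
     (\<gamma> has_vector_derivative \<theta>) (at 0 within {0..<T}) \<and>
     (\<exists>c'. \<forall>t\<in>{0..<T}.
        ((chart \<phi> U \<circ> \<gamma>) has_vector_derivative c' t) (at t within {0..<T}) \<and>
        (c' has_vector_derivative
           (\<chi> k. - (\<Sum>i\<in>UNIV. \<Sum>j\<in>UNIV. christoffel \<phi> g k i j (chart \<phi> U (\<gamma> t)) * c' t $ i * c' t $ j)))
          (at t within {0..<T}))"

text \<open>
  Two geodesics with the same initial data agree where both are defined, so the maximal geodesic is
  the common extension of all of them; it is meaningful for \<open>0 \<le> t < geodesic_end \<phi> U g p \<theta>\<close>.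
\<close>

definition geodesic_end ::
  "(real^'n::finite \<Rightarrow> 'b::euclidean_space) \<Rightarrow> (real^'n) set \<Rightarrow> 'b metric_tensor \<Rightarrow> 'b \<Rightarrow> 'b \<Rightarrow> ereal" where
  "geodesic_end \<phi> U g p \<theta> = Sup {ereal T |T. \<exists>\<gamma>. is_geodesic \<phi> U g p \<theta> T \<gamma>}"

definition max_geodesic ::
  "(real^'n::finite \<Rightarrow> 'b::euclidean_space) \<Rightarrow> (real^'n) set \<Rightarrow> 'b metric_tensor \<Rightarrow> 'b \<Rightarrow> 'b \<Rightarrow> real \<Rightarrow> 'b" where
  "max_geodesic \<phi> U g p \<theta> t = (THE y. \<exists>T \<gamma>. is_geodesic \<phi> U g p \<theta> T \<gamma> \<and> t < T \<and> y = \<gamma> t)"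

definition cut_time ::
  "(real^'n::finite \<Rightarrow> 'b::euclidean_space) \<Rightarrow> (real^'n) set \<Rightarrow> 'b metric_tensor \<Rightarrow> 'b \<Rightarrow> 'b \<Rightarrow> ereal" where
  "cut_time \<phi> U g p \<theta> =
     Sup {ereal t |t. 0 \<le> t \<and> ereal t < geodesic_end \<phi> U g p \<theta> \<and>
            riemannian_dist (\<phi> ` U) g p (max_geodesic \<phi> U g p \<theta> t) = ennreal t}"

definition reparam ::
  "(real^'n::finite \<Rightarrow> 'b::euclidean_space) \<Rightarrow> (real^'n) set \<Rightarrow> 'b metric_tensor \<Rightarrow> ('b \<Rightarrow> real) \<Rightarrow> 'b \<Rightarrow> 'b \<Rightarrow> real \<Rightarrow> real" where
  "reparam \<phi> U g f p \<theta> t =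
     integral {0..t} (\<lambda>\<xi>. exp (- (2 * f (max_geodesic \<phi> U g p \<theta> \<xi>) / (real CARD('n) - 1))))"

definition weighted_ball ::
  "(real^'n::finite \<Rightarrow> 'b::euclidean_space) \<Rightarrow> (real^'n) set \<Rightarrow> 'b metric_tensor \<Rightarrow> ('b \<Rightarrow> real) \<Rightarrow> real \<Rightarrow> 'b \<Rightarrow> 'b set" where
  "weighted_ball \<phi> U g f r p =
     {max_geodesic \<phi> U g p \<theta> t |\<theta> t. \<theta> \<in> unit_tangent_space \<phi> U g p \<and> 0 \<le> t \<and>
        ereal t < cut_time \<phi> U g p \<theta> \<and> reparam \<phi> U g f p \<theta> t < r}"

section \<open>Model volumes and domains\<close>

definition sn :: "real \<Rightarrow> real \<Rightarrow> real" where
  "sn \<kappa> s = (if \<kappa> > 0 then sin (sqrt \<kappa> * s) / sqrt \<kappa>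
             else if \<kappa> = 0 then s
             else sinh (sqrt (- \<kappa>) * s) / sqrt (- \<kappa>))"

definition sn_zero :: "real \<Rightarrow> ereal" where
  "sn_zero \<kappa> = (if \<kappa> > 0 then ereal (pi / sqrt \<kappa>) else \<infinity>)"

definition sn_bar :: "real \<Rightarrow> real \<Rightarrow> real" where
  "sn_bar \<kappa> s = (if ereal s < sn_zero \<kappa> then sn \<kappa> s else 0)"

text \<open>The unit sphere in dimension \<open>n\<close> has \<open>(n - 1)\<close>-volume \<open>n\<close> times the volume of the unit ball.\<close>

definition unit_sphere_vol :: "nat \<Rightarrow> real" where
  "unit_sphere_vol n = real n * unit_ball_vol (real n)"

definition model_volume :: "nat \<Rightarrow> real \<Rightarrow> real \<Rightarrow> real" where
  "model_volume n \<kappa> r = unit_sphere_vol n * integral {0..r} (\<lambda>\<xi>. sn_bar \<kappa> \<xi> ^ (n - 1))"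

definition tau :: "real \<Rightarrow> ereal" where
  "tau \<kappa> = (if \<kappa> > 0 then ereal (pi / (2 * sqrt \<kappa>)) else \<infinity>)"

definition model_domain :: "real \<Rightarrow> (real^'n::finite) set" where
  "model_domain \<kappa> = (if \<kappa> \<ge> 0 then UNIV else {x. norm x < 1 / sqrt (- \<kappa>)})"

definition rot_sym_hyperquadric :: "real \<Rightarrow> (real \<times> (real^'n::finite)) set \<Rightarrow> bool" where
  "rot_sym_hyperquadric \<kappa> S \<longleftrightarrow>
     (\<exists>c>0. S = {(y0, y). y0 > 0 \<and> c\<^sup>2 * y0\<^sup>2 + \<kappa> / c\<^sup>2 * (norm y)\<^sup>2 = 1})"

section \<open>The hypersurface of a positive function\<close>

definition F_map :: "(real^'n::finite \<Rightarrow> real) \<Rightarrow> real^'n \<Rightarrow> real \<times> (real^'n)" where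
  "F_map h x = (1 / h x) *\<^sub>R (1, x)"

definition f_fun :: "(real^'n::finite \<Rightarrow> real) \<Rightarrow> real^'n \<Rightarrow> real" where
  "f_fun h x = (real CARD('n) - 1) * ln (h x)"

definition f_bar :: "(real^'n::finite) set \<Rightarrow> (real^'n \<Rightarrow> real) \<Rightarrow> real \<times> (real^'n) \<Rightarrow> real" where
  "f_bar \<Omega> h = f_fun h \<circ> the_inv_into \<Omega> (F_map h)"

definition g_bar :: "(real^'n::finite) set \<Rightarrow> (real^'n \<Rightarrow> real) \<Rightarrow> (real \<times> (real^'n)) metric_tensor" where
  "g_bar \<Omega> h = pushforward_metric (F_map h) \<Omega> euclidean_metric"

end

theory Submission
  imports Defs
begin

text \<open>
  In the chart \<open>F_map h\<close> the metric is flat, so the Ricci bound says \<open>D\<^sup>2h(v,v) \<ge> \<kappa> |v|\<^sup>2 / h\<^sup>3\<close>, the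
  geodesics from the base point are the rays \<open>t v\<close>, minimising up to the boundary of \<open>\<Omega>\<close>, and the
  weighted volume has density \<open>h\<^bsup>-(n+1)\<^esup>\<close>. Along a ray put \<open>H t = h (t v)\<close>. In the parameter
  \<open>s = \<integral> H\<^bsup>-2\<^esup>\<close> the function \<open>\<phi> = t / H\<close> satisfies \<open>\<phi>'' \<le> -\<kappa> \<phi>\<close>, so \<open>\<phi> / sn\<^sub>\<kappa>\<close> is nonincreasing and the
  volume growth along the ray is bounded by the model's (Bishop--Gromov). Equality of the total
  volume ratios forces equality along almost every ray: \<open>s\<close> reaches every value below \<open>\<tau>\<^sub>\<kappa>\<close> and
  \<open>H'' = \<kappa> / H\<^sup>3\<close>, hence \<open>H\<^sup>2 = (H 0 + H' 0 t)\<^sup>2 + \<kappa> t\<^sup>2 / (H 0)\<^sup>2\<close>. The gradient of \<open>h\<close> at \<open>0\<close>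
  vanishes: for \<open>\<kappa> \<noteq> 0\<close> by the Hessian bound in directions orthogonal to it, for \<open>\<kappa> = 0\<close> because \<open>s\<close>
  would stay bounded. The rigid rays are dense and fill the model domain, which \<open>\<Omega>\<close>, being convex and
  open, therefore contains.
\<close>

section \<open>Comparison along a single ray\<close>

text \<open>Since \<open>d/ds = H^2 d/dt\<close>, the function \<open>t / H\<close> has first
  derivative \<open>H - t H'\<close> and second derivative \<open>- t H^2 H''\<close> in
  \<open>s\<close>, so the Hessian bound turns into the Jacobi inequality. The weighted volume
  element \<open>t^(n-1) H^(-(n+1)) dt\<close> equals \<open>(t / H)^(n-1) ds\<close>; this is why
  the weight carries the exponent \<open>n + 1\<close>. The manifold may be incomplete: a ray can
  leave \<open>\<Omega>\<close> before \<open>s\<close> reaches \<open>tau \<kappa>\<close>. This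
  does no harm to the inequality, because the missing piece only lowers the volume of the larger
  ball; in the equality case it is excluded, because the ray's volume would stop growing while the
  model's does not. The slope at \<open>0\<close> is still free in the formula for
  \<open>H^2\<close>, and two arguments are needed to remove it. If \<open>\<kappa> = 0\<close>, an
  affine \<open>h\<close> meets the Hessian bound with equality; if \<open>\<kappa> < 0\<close>, a
  small slope leaves \<open>s\<close> unbounded. The constant \<open>tau \<kappa>\<close> is, for
  \<open>\<kappa> > 0\<close>, the total \<open>s\<close>-length of an infinite model ray.\<close>

definition cs :: "real \<Rightarrow> real \<Rightarrow> real" where
  "cs \<kappa> s = (if \<kappa> > 0 then cos (sqrt \<kappa> * s) else if \<kappa> = 0 then 1 else cosh (sqrt (- \<kappa>) * s))"

lemma sn_0 [simp]: "sn \<kappa> 0 = 0" and cs_0 [simp]: "cs \<kappa> 0 = 1"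
  by (auto simp: sn_def cs_def)

lemma DERIV_sn: "(sn \<kappa> has_real_derivative cs \<kappa> s) (at s)"
proof -
  have trig: "((\<lambda>s. sin (c * s) / c) has_real_derivative cos (c * s)) (at s)"
      "((\<lambda>s. sinh (c * s) / c) has_real_derivative cosh (c * s)) (at s)" if "c > 0" for c :: real
    using that by (auto intro!: derivative_eq_intros)
  consider "\<kappa> > 0" | "\<kappa> = 0" | "\<kappa> < 0" by linarith
  then show ?thesis
    using trig[of "sqrt \<kappa>"] trig[of "sqrt (-\<kappa>)"]
    by cases (auto simp: sn_def[abs_def] cs_def)
qed

lemma DERIV_cs: "(cs \<kappa> has_real_derivative - \<kappa> * sn \<kappa> s) (at s)"
proof -
  have trig: "((\<lambda>s. cos (c * s)) has_real_derivative - (c\<^sup>2 * (sin (c * s) / c))) (at s)"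
      "((\<lambda>s. cosh (c * s)) has_real_derivative c\<^sup>2 * (sinh (c * s) / c)) (at s)" if "c > 0" for c :: real
    using that by (auto simp: power2_eq_square intro!: derivative_eq_intros)
  consider "\<kappa> > 0" | "\<kappa> = 0" | "\<kappa> < 0" by linarith
  then show ?thesis
    using trig[of "sqrt \<kappa>"] trig[of "sqrt (-\<kappa>)"]
    by cases (auto simp: sn_def cs_def[abs_def])
qed

lemma tau_pos: obtains r where "0 < r" "ereal r < tau \<kappa>"
proof (cases "\<kappa> > 0")
  case True
  then have "0 < pi / (4 * sqrt \<kappa>)" "pi / (4 * sqrt \<kappa>) < pi / (2 * sqrt \<kappa>)"
    by (auto simp: field_simps)
  then show ?thesis using True that[of "pi / (4 * sqrt \<kappa>)"] by (auto simp: tau_def)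
qed (use that[of 1] in \<open>auto simp: tau_def\<close>)

lemma sn_pos:
  assumes "0 < s" "ereal s < tau \<kappa>"
  shows "0 < sn \<kappa> s"
proof -
  consider "\<kappa> > 0" | "\<kappa> = 0" | "\<kappa> < 0" by linarith
  then show ?thesis
  proof cases
    case 1
    then have "s < pi / (2 * sqrt \<kappa>)" using assms by (simp add: tau_def)
    then have "sqrt \<kappa> * s < pi / 2" using 1 by (simp add: field_simps)
    then have "sqrt \<kappa> * s < pi" using pi_gt_zero by linarith
    then have "0 < sin (sqrt \<kappa> * s)" using assms 1 by (intro sin_gt_zero) auto
    with 1 show ?thesis by (simp add: sn_def)
  qed (use assms in \<open>auto simp: sn_def sinh_real_pos_iff\<close>)
qed

lemma sn_nonneg:
  assumes "0 \<le> s" "ereal s < tau \<kappa>"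
  shows "0 \<le> sn \<kappa> s"
  using sn_pos[of s \<kappa>] assms by (cases "s = 0") auto

lemma sn_bar_eq_sn: "ereal s < tau \<kappa> \<Longrightarrow> 0 \<le> s \<Longrightarrow> sn_bar \<kappa> s = sn \<kappa> s"
  using mult_nonneg_nonneg[of s "sqrt \<kappa>"] pi_gt_zero
  by (auto simp: sn_bar_def sn_zero_def tau_def field_simps simp del: pi_gt_zero split: if_splits)

lemma continuous_on_sn: "continuous_on S (sn \<kappa>)"
  using DERIV_sn DERIV_isCont by (metis continuous_at_imp_continuous_on)

text \<open>\<open>S\<close> is an interval with no last point, so it is exhausted by compact
  intervals and monotone convergence applies. It serves the part of a ray beyond a given point,
  whose right end is never attained.\<close>

lemma nn_integral_right_open_le:
  fixes f :: "real \<Rightarrow> ennreal"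
  assumes [measurable]: "f \<in> borel_measurable borel"
    and right: "\<And>t. t \<in> S \<Longrightarrow> \<exists>t'\<in>S. t < t'"
    and conv: "\<And>t \<xi>. t \<in> S \<Longrightarrow> a \<le> \<xi> \<Longrightarrow> \<xi> \<le> t \<Longrightarrow> \<xi> \<in> S"
    and low: "\<And>t. t \<in> S \<Longrightarrow> a \<le> t"
    and le: "\<And>b. b \<in> S \<Longrightarrow> (\<integral>\<^sup>+t\<in>{a..b}. f t \<partial>lborel) \<le> C"
  shows "(\<integral>\<^sup>+t\<in>S. f t \<partial>lborel) \<le> C"
proof (cases "S = {}")
  case False
  then obtain t0 where "t0 \<in> S" by blast
  with right obtain t1 where t1: "t1 \<in> S" "t0 < t1" by blast
  obtain q0 where q0: "q0 \<in> \<rat>" "t0 < q0" "q0 < t1" using Rats_dense_in_real t1(2) by blast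
  have "q0 \<in> S" using conv[OF t1(1), of q0] low[OF \<open>t0 \<in> S\<close>] q0 by auto
  define D where "D = S \<inter> \<rat>"
  have D: "countable D" "D \<noteq> {}" using \<open>q0 \<in> S\<close> q0 unfolding D_def
    by (auto intro: countable_subset[OF _ countable_rat])
  define d where "d = from_nat_into D"
  have dD: "d k \<in> D" for k unfolding d_def using D by (simp add: from_nat_into)
  have ran: "range d = D" unfolding d_def using D by simp
  \<comment> \<open>Running maxima of an enumeration of the rationals in \<open>S\<close> form an
    increasing sequence that passes every point of \<open>S\<close>.\<close>
  define b where "b k = Max (d ` {..k})" for k :: nat
  have bS: "b k \<in> S" for k
  proof -
    have "b k \<in> d ` {..k}" unfolding b_def by (intro Max_in) auto
    then show ?thesis using dD D_def by auto
  qed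
  have "mono b" unfolding b_def by (intro monoI Max_mono) auto
  have ind: "indicator S t = (SUP k. indicator {a..b k} t :: ennreal)" for t
  proof (cases "t \<in> S")
    case True
    then obtain t' where t': "t' \<in> S" "t < t'" using right by blast
    obtain q where q: "q \<in> \<rat>" "t < q" "q < t'" using Rats_dense_in_real t' by blast
    have "q \<in> D" unfolding D_def using q conv[OF t'(1), of q] low[OF True] by auto
    then obtain k where k: "q = d k" using ran by auto
    have "q \<le> b k" unfolding b_def k by (intro Max_ge) auto
    then have "t \<in> {a..b k}" using q low[OF True] by auto
    then have "(SUP k. indicator {a..b k} t :: ennreal) \<ge> 1"
      by (intro SUP_upper2[of k]) auto
    moreover have "(SUP k. indicator {a..b k} t :: ennreal) \<le> 1"
      by (intro SUP_least) (auto simp: indicator_def)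
    ultimately show ?thesis using True by (auto intro: antisym)
  next
    case False
    then have "t \<notin> {a..b k}" for k using conv[OF bS] by auto
    then show ?thesis using False by simp
  qed
  have "(\<integral>\<^sup>+t\<in>S. f t \<partial>lborel) = (\<integral>\<^sup>+t. (SUP k. f t * indicator {a..b k} t) \<partial>lborel)"
    by (simp add: ind SUP_mult_left_ennreal)
  also have "\<dots> = (SUP k. \<integral>\<^sup>+t\<in>{a..b k}. f t \<partial>lborel)"
  proof (intro nn_integral_monotone_convergence_SUP)
    show "incseq (\<lambda>k t. f t * indicator {a..b k} t)"
      using \<open>mono b\<close> by (auto intro!: incseq_SucI le_funI mult_left_mono simp: indicator_def mono_def)
        (meson order_trans le_Suc_eq nat_le_linear)
  qed measurable
  also have "\<dots> \<le> C" by (intro SUP_least le bS)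
  finally show ?thesis .
qed simp

lemma DERIV_eq_on_interval:
  fixes f g :: "real \<Rightarrow> real"
  assumes "\<And>x. x \<in> {a<..<b} \<Longrightarrow> f x = g x" "x \<in> {a<..<b}"
    and "(f has_real_derivative f') (at x)" "(g has_real_derivative g') (at x)"
  shows "f' = g'"
proof -
  have "(g has_real_derivative f') (at x)"
    by (rule has_field_derivative_transform_within_open[OF assms(3), of "{a<..<b}"]) (use assms in auto)
  then show ?thesis using assms(4) DERIV_unique by blast
qed

text \<open>The restriction of \<open>h\<close> to one ray: \<open>J\<close> is the set of times
  spent in \<open>\<Omega>\<close>, \<open>J_right\<close> reflects that \<open>\<Omega>\<close> is
  open, and \<open>m\<close> is the dimension minus one. Two-sided derivatives at \<open>0\<close>
  make sense because \<open>0\<close> is an interior point of \<open>\<Omega>\<close>.\<close>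

locale warped_ray =
  fixes J :: "real set" and H H1 H2 :: "real \<Rightarrow> real" and \<kappa> :: real and m :: nat
  assumes zero_J: "0 \<in> J"
    and J_nonneg: "t \<in> J \<Longrightarrow> 0 \<le> t"
    and J_down: "t \<in> J \<Longrightarrow> 0 \<le> \<xi> \<Longrightarrow> \<xi> \<le> t \<Longrightarrow> \<xi> \<in> J"
    and J_right: "t \<in> J \<Longrightarrow> \<exists>t'\<in>J. t < t'"
    and DH: "t \<in> J \<Longrightarrow> (H has_real_derivative H1 t) (at t)"
    and DH1: "t \<in> J \<Longrightarrow> (H1 has_real_derivative H2 t) (at t)"
    and H_pos: "t \<in> J \<Longrightarrow> 0 < H t"
    and H2_ge: "t \<in> J \<Longrightarrow> \<kappa> / H t ^ 3 \<le> H2 t"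
    and m_pos: "1 \<le> m"
begin

text \<open>\<open>I r\<close> is the contribution of the ray to the weighted volume of the ball of radius \<open>r\<close>, \<open>V r\<close> that
  of the model, and the densities are related by \<open>p = \<rho> ^ m * q\<close>.\<close>

definition s :: "real \<Rightarrow> real" where "s t = integral {0..t} (\<lambda>\<xi>. 1 / (H \<xi>)\<^sup>2)"
definition V :: "real \<Rightarrow> real" where "V r = integral {0..r} (\<lambda>\<xi>. sn \<kappa> \<xi> ^ m)"
definition p :: "real \<Rightarrow> real" where "p t = t ^ m / H t ^ (m + 2)"
definition q :: "real \<Rightarrow> real" where "q t = sn \<kappa> (s t) ^ m / (H t)\<^sup>2"
definition E :: "real \<Rightarrow> real set" where "E r = {t \<in> J. 0 < t \<and> s t < r}"
definition I :: "real \<Rightarrow> ennreal" where "I r = (\<integral>\<^sup>+t\<in>E r. ennreal (p t) \<partial>lborel)"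
definition \<rho> :: "real \<Rightarrow> real" where "\<rho> t = t / H t / sn \<kappa> (s t)"

section \<open>The arc parameter of a ray\<close>

lemma Icc_J: "t \<in> J \<Longrightarrow> {0..t} \<subseteq> J"
  using J_down by auto

lemma cont_H: "continuous_on J H"
  using DH DERIV_isCont by (metis continuous_at_imp_continuous_on)

lemma cont_H1: "continuous_on J H1"
  using DH1 DERIV_isCont by (metis continuous_at_imp_continuous_on)

lemma cont_inv: "continuous_on J (\<lambda>t. 1 / (H t)\<^sup>2)"
  using H_pos by (intro continuous_intros cont_H) force

lemma s_0 [simp]: "s 0 = 0" by (simp add: s_def)

lemma Ds_within: "t \<in> {0..b} \<Longrightarrow> b \<in> J \<Longrightarrow> (s has_real_derivative 1 / (H t)\<^sup>2) (at t within {0..b})"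
  unfolding s_def
  by (intro integral_has_real_derivative continuous_on_subset[OF cont_inv Icc_J]) auto

text \<open>Time \<open>0\<close> is excluded because \<open>integral {0..t}\<close> vanishes for
  negative \<open>t\<close>, so \<open>s\<close> has a kink there. Later derivative arguments
  therefore work on open intervals and add continuity at the ends.\<close>

lemma Ds: "t \<in> J \<Longrightarrow> 0 < t \<Longrightarrow> (s has_real_derivative 1 / (H t)\<^sup>2) (at t)"
proof -
  assume t: "t \<in> J" "0 < t"
  from J_right[OF t(1)] obtain b where b: "b \<in> J" "t < b" by blast
  have "(s has_real_derivative 1 / (H t)\<^sup>2) (at t within {0<..<b})"
    by (rule DERIV_subset[OF Ds_within[of t b]]) (use t b in auto)
  then show ?thesis using t b at_within_open[of t "{0<..<b}"] by simp
qed

lemma cont_s_Icc: "b \<in> J \<Longrightarrow> continuous_on {0..b} s"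
  using Ds_within by (meson DERIV_continuous_on)

lemma s_less: "a < b \<Longrightarrow> 0 \<le> a \<Longrightarrow> b \<in> J \<Longrightarrow> s a < s b"
proof (rule DERIV_pos_imp_increasing_open[of a b s])
  fix x assume *: "0 \<le> a" "b \<in> J" "a < x" "x < b"
  then have "x \<in> J" using J_down by auto
  then show "\<exists>y. (s has_real_derivative y) (at x) \<and> y > 0"
    using Ds[of x] H_pos[of x] * by (intro exI[of _ "1 / (H x)\<^sup>2"]) auto
qed (auto intro: continuous_on_subset[OF cont_s_Icc])

lemma s_le: "a \<le> b \<Longrightarrow> 0 \<le> a \<Longrightarrow> b \<in> J \<Longrightarrow> s a \<le> s b"
  using s_less[of a b] by (cases "a = b") auto

lemma s_pos: "0 < b \<Longrightarrow> b \<in> J \<Longrightarrow> 0 < s b"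
  using s_less[of 0 b] by simp

lemma s_nonneg: "b \<in> J \<Longrightarrow> 0 \<le> s b"
  using s_le[of 0 b] J_nonneg by auto

lemma cont_s: "continuous_on J s"
proof -
  have "continuous (at t within J) s" if "t \<in> J" for t
  proof -
    obtain b where b: "b \<in> J" "t < b" using J_right[OF \<open>t \<in> J\<close>] by blast
    have "continuous (at t within {0..b}) s"
      using cont_s_Icc[OF b(1)] b that J_nonneg by (auto simp: continuous_on_eq_continuous_within)
    moreover have "at t within J = at t within {0..b}"
      by (rule at_within_nhd[of t "{..<b}"]) (use b that J_nonneg J_down[OF b(1)] in auto)
    ultimately show ?thesis by simp
  qed
  then show ?thesis by (simp add: continuous_on_eq_continuous_within)
qed

lemma E_right:
  assumes "t \<in> E r" shows "\<exists>t'\<in>E r. t < t'"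
proof -
  have t: "t \<in> J" "0 < t" "s t < r" using assms by (auto simp: E_def)
  obtain b where b: "b \<in> J" "t < b" using J_right[OF t(1)] by blast
  have "isCont s t" using Ds[OF t(1,2)] DERIV_isCont by blast
  then have "\<forall>\<^sub>F x in at t. s x < r" using t(3) by (auto simp: isCont_def dest: order_tendstoD(2))
  then obtain d where d: "d > 0" "\<And>x. x \<noteq> t \<Longrightarrow> dist x t < d \<Longrightarrow> s x < r"
    unfolding eventually_at by auto
  define t' where "t' = min b (t + d / 2)"
  have "t < t'" "t' \<le> b" using b d by (auto simp: t'_def)
  moreover have "s t' < r" using d \<open>t < t'\<close> by (intro d(2)) (auto simp: t'_def dist_real_def)
  ultimately show ?thesis using t b J_down by (intro bexI[of _ t']) (auto simp: E_def)
qed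

lemma E_down: "t \<in> E r \<Longrightarrow> 0 < \<xi> \<Longrightarrow> \<xi> \<le> t \<Longrightarrow> \<xi> \<in> E r"
  unfolding E_def using J_down[of t \<xi>] s_le[of \<xi> t] by auto

lemma E_open: "open (E r)"
proof (subst open_subopen, intro ballI)
  fix t assume "t \<in> E r"
  then obtain t' where t': "t' \<in> E r" "t < t'" using E_right by blast
  show "\<exists>T. open T \<and> t \<in> T \<and> T \<subseteq> E r"
    by (rule exI[of _ "{0<..<t'}"]) (use t' \<open>t \<in> E r\<close> E_down[OF t'(1)] in \<open>auto simp: E_def\<close>)
qed

lemma E_borel [measurable]: "E r \<in> sets borel"
  using E_open by simp

lemma tau_less: "a \<le> b \<Longrightarrow> ereal b < tau \<kappa> \<Longrightarrow> ereal a < tau \<kappa>"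
  using order_le_less_trans[of "ereal a" "ereal b"] by simp

section \<open>Sturm comparison with the model\<close>

text \<open>Sturm's argument: the Wronskian of \<open>t / H\<close> and \<open>sn \<kappa>\<close>
  in the parameter \<open>s\<close> starts at \<open>0\<close> and decreases by the Hessian bound,
  and the derivative of \<open>\<rho>\<close> is this Wronskian divided by a positive
  square.\<close>

lemma \<rho>_antimono:
  assumes "0 < a" "a \<le> b" "b \<in> J" "ereal (s b) < tau \<kappa>"
  shows "\<rho> b \<le> \<rho> a"
proof (rule DERIV_nonpos_imp_nonincreasing[OF assms(2)])
  \<comment> \<open>The product rule for \<open>W\<close> at time \<open>y\<close>, with
    \<open>h\<close>, \<open>h1\<close>, \<open>h2\<close> for \<open>H\<close>, \<open>H1\<close>,
    \<open>H2\<close> and with \<open>u\<close>, \<open>c\<close> for \<open>sn\<close> and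
    \<open>cs\<close> at \<open>s y\<close>: the terms in \<open>c\<close> cancel, and only the
    defect in the Hessian bound remains.\<close>
  have W_alg: "h \<noteq> 0 \<Longrightarrow> (h1 - (1 * h1 + h2 * y)) * u + c * (1 / h\<^sup>2) * (h - y * h1)
      - ((1 * h - y * h1) / (h * h) * c + - \<kappa> * u * (1 / h\<^sup>2) * (y / h)) = y * u * (\<kappa> / h ^ 3 - h2)"
    for h h1 h2 y u c :: real
  proof -
    assume h: "h \<noteq> 0"
    have 1: "(1 * h - y * h1) / (h * h) * c = c * (1 / h\<^sup>2) * (h - y * h1)"
      by (simp add: power2_eq_square)
    have 2: "- \<kappa> * u * (1 / h\<^sup>2) * (y / h) = - (y * u * (\<kappa> / h ^ 3))"
      using h by (simp add: power2_eq_square power3_eq_cube)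
    show ?thesis unfolding 1 2 by (simp add: algebra_simps)
  qed
  \<comment> \<open>The Wronskian: \<open>H t - t * H1 t\<close> is the derivative of
    \<open>t / H t\<close> with respect to \<open>s\<close>.\<close>
  define W where "W t = (H t - t * H1 t) * sn \<kappa> (s t) - t / H t * cs \<kappa> (s t)" for t
  have J: "x \<in> J" if "0 \<le> x" "x \<le> b" for x using assms J_down that by auto
  have small: "ereal (s x) < tau \<kappa>" if "0 \<le> x" "x \<le> b" for x
    using that by (intro tau_less[OF s_le[of x b] assms(4)] assms(3)) auto
  have W: "W x \<le> 0" if x: "0 \<le> x" "x \<le> b" for x
  proof -
    have "W x \<le> W 0"
    proof (rule DERIV_nonpos_imp_decreasing_open[OF x(1)])
      fix y assume y: "0 < y" "y < x"
      have yJ: "y \<in> J" using J y x by auto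
      have Hn: "H y \<noteq> 0" using H_pos[OF yJ] by simp
      note D1 = DH[OF yJ] DH1[OF yJ] DERIV_chain2[OF DERIV_sn Ds[OF yJ y(1)]]
        DERIV_chain2[OF DERIV_cs Ds[OF yJ y(1)]]
      have D: "(W has_real_derivative y * sn \<kappa> (s y) * (\<kappa> / H y ^ 3 - H2 y)) (at y)"
        unfolding W_def
        apply (rule DERIV_cong)
         apply (rule DERIV_diff DERIV_mult DERIV_divide DERIV_ident D1 Hn)+
        apply (rule W_alg[OF Hn])
        done
      have "0 \<le> sn \<kappa> (s y)" using small y x s_nonneg[OF yJ] by (intro sn_nonneg) auto
      then have "y * sn \<kappa> (s y) * (\<kappa> / H y ^ 3 - H2 y) \<le> 0"
        using H2_ge[OF yJ] y by (intro mult_nonneg_nonpos) auto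
      with D show "\<exists>z. (W has_real_derivative z) (at y) \<and> z \<le> 0" by blast
    next
      have sub: "{0..x} \<subseteq> J" using J x by auto
      have c: "continuous_on {0..x} H" "continuous_on {0..x} H1" "continuous_on {0..x} s"
        by (rule continuous_on_subset[OF _ sub], rule cont_H cont_H1 cont_s)+
      have csc: "continuous_on UNIV (cs \<kappa>)" "continuous_on UNIV (sn \<kappa>)"
        using DERIV_cs DERIV_sn DERIV_isCont by (metis continuous_at_imp_continuous_on)+
      have comp: "continuous_on {0..x} (\<lambda>t. cs \<kappa> (s t))" "continuous_on {0..x} (\<lambda>t. sn \<kappa> (s t))"
        by (rule continuous_on_compose2[OF csc(1) c(3)] continuous_on_compose2[OF csc(2) c(3)], simp)+
      have "\<forall>t\<in>{0..x}. H t \<noteq> 0" using sub H_pos by force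
      then show "continuous_on {0..x} W"
        unfolding W_def by (intro continuous_intros c comp) 
    qed
    also have "W 0 = 0" by (simp add: W_def)
    finally show ?thesis .
  qed
  fix x assume x: "a \<le> x" "x \<le> b"
  then have x0: "0 < x" using assms by simp
  have xJ: "x \<in> J" using J x x0 by auto
  have u: "0 < sn \<kappa> (s x)" using small x x0 s_pos xJ by (intro sn_pos) auto
  have nz: "H x \<noteq> 0" "sn \<kappa> (s x) \<noteq> 0" using H_pos[OF xJ] u by auto
  have rho_alg: "((1 * h - x * h1) / (h * h) * u - x / h * (c * (1 / h\<^sup>2))) / (u * u)
      = ((h - x * h1) * u - x / h * c) / (h\<^sup>2 * u\<^sup>2)" if "h \<noteq> 0" "u \<noteq> 0" for h h1 u c :: real
    using that by (simp add: field_simps power2_eq_square)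
  have "(\<rho> has_real_derivative W x / ((H x)\<^sup>2 * (sn \<kappa> (s x))\<^sup>2)) (at x)"
    unfolding \<rho>_def W_def
    apply (rule DERIV_cong)
     apply (rule DERIV_divide DERIV_ident DH[OF xJ] DERIV_chain2[OF DERIV_sn Ds[OF xJ x0]] nz)+
    using nz by (intro rho_alg)
  moreover have "W x / ((H x)\<^sup>2 * (sn \<kappa> (s x))\<^sup>2) \<le> 0"
    using W[of x] x x0 by (intro divide_nonpos_nonneg) auto
  ultimately show "\<exists>y. (\<rho> has_real_derivative y) (at x) \<and> y \<le> 0" by blast
qed

section \<open>Densities and volume along a ray\<close>

lemma V_0 [simp]: "V 0 = 0" by (simp add: V_def)

lemma DV_within: "x \<in> {0..r} \<Longrightarrow> (V has_real_derivative sn \<kappa> x ^ m) (at x within {0..r})"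
  unfolding V_def
  by (intro integral_has_real_derivative continuous_intros continuous_on_sn) auto

lemma DV: "0 < x \<Longrightarrow> (V has_real_derivative sn \<kappa> x ^ m) (at x)"
proof -
  assume x: "0 < x"
  have "(V has_real_derivative sn \<kappa> x ^ m) (at x within {0<..<x+1})"
    by (rule DERIV_subset[OF DV_within[of x "x + 1"]]) (use x in auto)
  then show ?thesis using x at_within_open[of x "{0<..<x+1}"] by simp
qed

lemma V_less: "0 \<le> a \<Longrightarrow> a < b \<Longrightarrow> ereal b < tau \<kappa> \<Longrightarrow> V a < V b"
proof (rule DERIV_pos_imp_increasing_open[of a b V])
  fix x assume *: "0 \<le> a" "ereal b < tau \<kappa>" "a < x" "x < b"
  then show "\<exists>y. (V has_real_derivative y) (at x) \<and> y > 0"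
    using DV[of x] sn_pos[of x \<kappa>] tau_less[of x b] by (intro exI[of _ "sn \<kappa> x ^ m"]) auto
next
  assume "0 \<le> a"
  have "continuous_on {0..b} V" using DV_within by (meson DERIV_continuous_on)
  then show "continuous_on {a..b} V" by (rule continuous_on_subset) (use \<open>0 \<le> a\<close> in auto)
qed

lemma V_nonneg: "0 \<le> r \<Longrightarrow> ereal r < tau \<kappa> \<Longrightarrow> 0 \<le> V r"
  using V_less[of 0 r] by (cases "r = 0") auto

lemma V_le: "0 \<le> a \<Longrightarrow> a \<le> b \<Longrightarrow> ereal b < tau \<kappa> \<Longrightarrow> V a \<le> V b"
  using V_less[of a b] by (cases "a = b") auto

lemma reach_IVT:
  assumes "t \<in> J" "0 \<le> r" "r \<le> s t"
  obtains a where "a \<in> J" "a \<le> t" "s a = r"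
proof -
  have "\<exists>a. 0 \<le> a \<and> a \<le> t \<and> s a = r"
    using assms J_nonneg by (intro IVT' cont_s_Icc) auto
  then show ?thesis using that J_down[OF assms(1)] by blast
qed

lemma q_nonneg: "t \<in> J \<Longrightarrow> ereal (s t) < tau \<kappa> \<Longrightarrow> 0 \<le> q t"
  by (simp add: q_def sn_nonneg s_nonneg)

text \<open>This is the substitution by \<open>s\<close>: \<open>q\<close> is the derivative of
  \<open>V \<circ> s\<close>. The interior form of the fundamental theorem copes with the kink of
  \<open>s\<close> at \<open>0\<close>.\<close>

lemma q_has_integral:
  assumes "0 \<le> a" "a \<le> b" "b \<in> J"
  shows "(q has_integral V (s b) - V (s a)) {a..b}"
proof -
  have J: "x \<in> J" if "0 \<le> x" "x \<le> b" for x using that J_down[OF assms(3)] by simp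
  have "continuous_on {0..s b} V" using DV_within by (meson DERIV_continuous_on)
  moreover have "s ` {a..b} \<subseteq> {0..s b}" using assms s_nonneg J s_le by auto
  moreover have "continuous_on {a..b} s" using cont_s_Icc[OF assms(3)] assms(1)
    by (auto intro: continuous_on_subset)
  ultimately have "continuous_on {a..b} (\<lambda>t. V (s t))" by (auto intro: continuous_on_compose2)
  moreover have "((\<lambda>t. V (s t)) has_vector_derivative q x) (at x)" if "x \<in> {a<..<b}" for x
    using DERIV_chain2[OF DV Ds, of x] J that assms s_pos[of x]
    by (auto simp: has_real_derivative_iff_has_vector_derivative[symmetric] q_def)
  ultimately show ?thesis
    using assms by (intro fundamental_theorem_of_calculus_interior) auto
qed

lemma p_nonneg: "t \<in> J \<Longrightarrow> 0 \<le> p t"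
  unfolding p_def using J_nonneg H_pos by (intro divide_nonneg_nonneg) (auto intro: less_imp_le)

lemma p_pos: "t \<in> J \<Longrightarrow> 0 < t \<Longrightarrow> 0 < p t"
  unfolding p_def using H_pos by auto

lemma p_eq: "t \<in> J \<Longrightarrow> 0 < t \<Longrightarrow> ereal (s t) < tau \<kappa> \<Longrightarrow> p t = \<rho> t ^ m * q t"
  using sn_pos[of "s t" \<kappa>] s_pos[of t] H_pos[of t]
  by (simp add: p_def q_def \<rho>_def power_divide power_mult_distrib power_add power2_eq_square)

lemma \<rho>_pos: "t \<in> J \<Longrightarrow> 0 < t \<Longrightarrow> ereal (s t) < tau \<kappa> \<Longrightarrow> 0 < \<rho> t"
  unfolding \<rho>_def using H_pos s_pos sn_pos by auto

lemma cont_p: "continuous_on J p"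
  unfolding p_def using H_pos by (intro continuous_intros cont_H) force

lemma p_measurable: "(\<lambda>t. ennreal (indicator (E r) t * p t)) \<in> borel_measurable borel"
proof -
  have "continuous_on (E r) p" by (rule continuous_on_subset[OF cont_p]) (auto simp: E_def)
  then have "(\<lambda>t. indicator (E r) t *\<^sub>R p t) \<in> borel_measurable borel"
    using E_borel by (intro borel_measurable_continuous_on_indicator) auto
  then show ?thesis by simp
qed

lemma I_alt: "I r = (\<integral>\<^sup>+t. ennreal (indicator (E r) t * p t) \<partial>lborel)"
  unfolding I_def by (intro nn_integral_cong) (simp add: indicator_def)

lemma E_reached: "a \<in> J \<Longrightarrow> 0 < a \<Longrightarrow> E (s a) = {0<..<a}"
  using J_down[of a] s_less s_le[of a] by (fastforce simp: E_def not_less[symmetric])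

lemma I_reached:
  assumes "a \<in> J" "0 < a"
  shows "I (s a) = (\<integral>\<^sup>+t\<in>{0..a}. ennreal (p t) \<partial>lborel)"
  unfolding I_def E_reached[OF assms]
proof (rule nn_integral_cong_AE)
  show "AE t in lborel. ennreal (p t) * indicator {0<..<a} t = ennreal (p t) * indicator {0..a} t"
    using AE_lborel_singleton[of 0] AE_lborel_singleton[of a]
    by eventually_elim (auto simp: indicator_def)
qed

lemma I_split:
  assumes "r \<le> R"
  shows "I R = I r + (\<integral>\<^sup>+t\<in>E R - E r. ennreal (indicator (E R) t * p t) \<partial>lborel)"
proof -
  have [measurable]: "(\<lambda>t. ennreal (indicator (E x) t * p t)) \<in> borel_measurable borel" for x
    by (rule p_measurable)
  have "I R = (\<integral>\<^sup>+t. ennreal (indicator (E r) t * p t)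
      + ennreal (indicator (E R) t * p t) * indicator (E R - E r) t \<partial>lborel)"
    unfolding I_alt using assms
    by (intro nn_integral_cong) (auto simp: indicator_def E_def)
  also have "\<dots> = I r + (\<integral>\<^sup>+t\<in>E R - E r. ennreal (indicator (E R) t * p t) \<partial>lborel)"
    unfolding I_alt by (intro nn_integral_add) measurable
  finally show ?thesis .
qed

text \<open>By the intermediate value theorem, a value that \<open>s\<close> never takes bounds
  \<open>s\<close> on the whole ray, so larger radii add no points. This is the case of a ray that
  leaves \<open>\<Omega>\<close> early.\<close>

lemma E_not_reached:
  assumes "r \<le> R" "0 \<le> r" "\<And>a. a \<in> J \<Longrightarrow> s a \<noteq> r"
  shows "E R = E r"
proof -
  have "s t < r" if "t \<in> J" for t
    using reach_IVT[of t r] assms that by (metis not_less)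
  then show ?thesis using assms by (force simp: E_def)
qed

section \<open>Bishop--Gromov inequality along a ray\<close>

text \<open>Up to time \<open>a\<close> the factor in \<open>p = \<rho> ^ m * q\<close> is at least
  its value at \<open>a\<close>, because \<open>\<rho>\<close> is nonincreasing, and
  \<open>q\<close> integrates to \<open>V (s a)\<close>.\<close>

lemma I_lower:
  assumes "a \<in> J" "0 < a" "ereal (s a) < tau \<kappa>"
  shows "ennreal (\<rho> a ^ m) * ennreal (V (s a)) \<le> I (s a)"
proof -
  have J: "x \<in> J" if "0 \<le> x" "x \<le> a" for x using that J_down[OF assms(1)] by simp
  have sm: "ereal (s x) < tau \<kappa>" if "0 \<le> x" "x \<le> a" for x
    using that by (intro tau_less[OF s_le[of x a] assms(3)] assms(1)) auto
  have "ennreal (\<rho> a ^ m) * ennreal (V (s a)) = (\<integral>\<^sup>+t\<in>{0..a}. ennreal (\<rho> a ^ m * q t) \<partial>lborel)"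
  proof -
    have "((\<lambda>t. \<rho> a ^ m * q t) has_integral \<rho> a ^ m * (V (s a) - V (s 0))) {0..a}"
      using assms by (intro has_integral_mult_right q_has_integral) auto
    then have "(\<integral>\<^sup>+t\<in>{0..a}. ennreal (\<rho> a ^ m * q t) \<partial>lborel) = ennreal (\<rho> a ^ m * (V (s a) - V (s 0)))"
      using J sm \<rho>_pos[OF assms] q_nonneg
      by (intro nn_integral_has_integral_lebesgue') auto
    then show ?thesis using \<rho>_pos[OF assms] V_nonneg[OF s_nonneg[OF assms(1)] assms(3)]
      by (simp add: ennreal_mult)
  qed
  also have "\<dots> \<le> (\<integral>\<^sup>+t\<in>{0..a}. ennreal (p t) \<partial>lborel)"
  proof (rule nn_integral_mono_AE)
    have le: "\<rho> a ^ m * q t \<le> p t" if "0 < t" "t \<le> a" for t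
      using that J sm \<rho>_pos[OF assms] q_nonneg
      by (simp add: p_eq mult_right_mono power_mono \<rho>_antimono assms)
    show "AE t in lborel. ennreal (\<rho> a ^ m * q t) * indicator {0..a} t \<le> ennreal (p t) * indicator {0..a} t"
      using AE_lborel_singleton[of 0]
      by eventually_elim (auto simp: indicator_def intro!: ennreal_leI le)
  qed
  also have "\<dots> = I (s a)" using I_reached[OF assms(1,2)] by simp
  finally show ?thesis .
qed

text \<open>The counterpart of \<open>I_lower\<close> beyond \<open>a\<close>, where
  \<open>\<rho>\<close> is at most \<open>\<rho> a\<close>. The remaining piece has no last point,
  so each compact part is bounded first.\<close>

lemma I_upper:
  assumes "a \<in> J" "0 < a" "s a < R" "ereal R < tau \<kappa>"
  shows "(\<integral>\<^sup>+t\<in>E R - E (s a). ennreal (indicator (E R) t * p t) \<partial>lborel)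
    \<le> ennreal (\<rho> a ^ m) * ennreal (V R - V (s a))"
proof (rule nn_integral_right_open_le[where a = a, OF p_measurable])
  have E: "E R - E (s a) = {t \<in> E R. a \<le> t}"
    unfolding E_reached[OF assms(1,2)] by (auto simp: E_def)
  show "\<exists>t'\<in>E R - E (s a). t < t'" if "t \<in> E R - E (s a)" for t
    using E_right[of t R] that unfolding E by force
  show "\<xi> \<in> E R - E (s a)" if "t \<in> E R - E (s a)" "a \<le> \<xi>" "\<xi> \<le> t" for t \<xi>
    using that E_down[of t R \<xi>] assms(2) unfolding E by auto
  show "a \<le> t" if "t \<in> E R - E (s a)" for t using that E by auto
  fix b assume "b \<in> E R - E (s a)"
  then have b: "b \<in> J" "a \<le> b" "s b < R" unfolding E by (auto simp: E_def)
  have J: "x \<in> J" if "0 \<le> x" "x \<le> b" for x using that J_down[OF b(1)] by simp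
  have sb: "ereal (s b) < tau \<kappa>" using tau_less[of "s b" R] b assms by simp
  have sm: "ereal (s x) < tau \<kappa>" if "0 \<le> x" "x \<le> b" for x
    using that by (intro tau_less[OF s_le[of x b] sb] b) auto
  have sa: "ereal (s a) < tau \<kappa>" using sm b assms by simp
  note \<rho>a = \<rho>_pos[OF assms(1,2) sa]
  have "(\<integral>\<^sup>+t\<in>{a..b}. ennreal (indicator (E R) t * p t) \<partial>lborel)
      \<le> (\<integral>\<^sup>+t\<in>{a..b}. ennreal (\<rho> a ^ m * q t) \<partial>lborel)"
  proof (rule nn_integral_mono)
    have "p t \<le> \<rho> a ^ m * q t" if "a \<le> t" "t \<le> b" for t
    proof -
      have t: "t \<in> J" "0 < t" "ereal (s t) < tau \<kappa>" using that J sm assms by auto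
      have "\<rho> t ^ m \<le> \<rho> a ^ m"
        using \<rho>_antimono[of a t] that assms t \<rho>_pos[OF t] by (intro power_mono) auto
      then show ?thesis using t q_nonneg by (simp add: p_eq mult_right_mono)
    qed
    moreover have "0 \<le> \<rho> a ^ m * q t" if "a \<le> t" "t \<le> b" for t
      using that J sm assms(2) \<rho>a q_nonneg by simp
    ultimately show "ennreal (indicator (E R) t * p t) * indicator {a..b} t
      \<le> ennreal (\<rho> a ^ m * q t) * indicator {a..b} t" for t
      by (auto simp: indicator_def ennreal_leI)
  qed
  also have "\<dots> = ennreal (\<rho> a ^ m * (V (s b) - V (s a)))"
  proof (rule nn_integral_has_integral_lebesgue')
    show "0 \<le> \<rho> a ^ m * q t" if "t \<in> {a..b}" for t
      using that J sm assms(2) \<rho>a q_nonneg by simp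
    show "((\<lambda>t. \<rho> a ^ m * q t) has_integral \<rho> a ^ m * (V (s b) - V (s a))) {a..b}"
      using b assms by (intro has_integral_mult_right q_has_integral) auto
  qed
  also have "\<dots> \<le> ennreal (\<rho> a ^ m * (V R - V (s a)))"
    using \<rho>a b assms V_le[of "s b" R] s_nonneg by (intro ennreal_leI mult_left_mono) auto
  also have "\<dots> = ennreal (\<rho> a ^ m) * ennreal (V R - V (s a))"
    using \<rho>a assms V_le[of "s a" R] s_nonneg by (intro ennreal_mult) auto
  finally show "(\<integral>\<^sup>+t\<in>{a..b}. ennreal (indicator (E R) t * p t) \<partial>lborel)
    \<le> ennreal (\<rho> a ^ m) * ennreal (V R - V (s a))" .
qed

text \<open>Gromov's averaging argument: the mean of \<open>p\<close> against the model is at least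
  \<open>\<rho> a ^ m\<close> inside radius \<open>r\<close> and at most that outside. The product
  form stays meaningful in \<open>ennreal\<close> even if a volume is infinite.\<close>

lemma I_ratio:
  assumes "0 < r" "r < R" "ereal R < tau \<kappa>"
  shows "I R * ennreal (V r) \<le> I r * ennreal (V R)"
proof (cases "\<exists>a\<in>J. s a = r")
  case False
  then have "I R = I r" using E_not_reached[of r R] assms unfolding I_def by force
  then show ?thesis using assms V_le[of r R] by (auto intro!: mult_left_mono ennreal_leI)
next
  case True
  then obtain a where a: "a \<in> J" "s a = r" by blast
  have "a \<noteq> 0" using a assms by auto
  then have a0: "0 < a" using J_nonneg a by force
  have r: "ereal r < tau \<kappa>" using tau_less[of r R] assms by simp
  define K where "K = ennreal (\<rho> a ^ m)"
  define Y where "Y = (\<integral>\<^sup>+t\<in>E R - E r. ennreal (indicator (E R) t * p t) \<partial>lborel)"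
  have lo: "K * ennreal (V r) \<le> I r" using I_lower[OF a(1) a0] a r by (simp add: K_def)
  have up: "Y \<le> K * ennreal (V R - V r)"
    using I_upper[OF a(1) a0, of R] a assms by (simp add: K_def Y_def)
  have "I R * ennreal (V r) = I r * ennreal (V r) + Y * ennreal (V r)"
    using I_split[of r R] assms by (simp add: Y_def distrib_right)
  also have "Y * ennreal (V r) \<le> K * ennreal (V R - V r) * ennreal (V r)"
    using up by (intro mult_right_mono) auto
  also have "\<dots> = (K * ennreal (V r)) * ennreal (V R - V r)" by (simp add: mult_ac)
  also have "\<dots> \<le> I r * ennreal (V R - V r)" using lo by (intro mult_right_mono) auto
  also have "I r * ennreal (V r) + I r * ennreal (V R - V r) = I r * ennreal (V R)"
    using V_nonneg[of r] V_le[of r R] assms r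
    by (simp add: distrib_left[symmetric] ennreal_plus[symmetric] del: ennreal_plus)
  finally show ?thesis by (simp add: add_left_mono)
qed

text \<open>Rational radii only: this makes it a countable conjunction, which therefore holds along almost
  every ray as soon as each instance does.\<close>

definition rigid :: bool where
  "rigid \<longleftrightarrow> (\<forall>r. 0 < r \<and> ereal r < tau \<kappa> \<longrightarrow> I r < \<infinity>) \<and>
     (\<forall>r\<in>\<rat>. \<forall>R\<in>\<rat>. 0 < r \<and> r < R \<and> ereal R < tau \<kappa> \<longrightarrow> I R * ennreal (V r) = I r * ennreal (V R))"

section \<open>The equality case along a ray\<close>

lemma tau_room:
  assumes "ereal r < tau \<kappa>" obtains R where "r < R" "R \<in> \<rat>" "ereal R < tau \<kappa>"
proof -
  obtain z where z: "ereal r < ereal z" "ereal z < tau \<kappa>"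
    using ereal_dense2[OF assms] by auto
  then obtain R where "R \<in> \<rat>" "r < R" "R < z" using Rats_dense_in_real[of r z] by auto
  then show ?thesis using that[of R] z(2) tau_less[of R z] by simp
qed

text \<open>By \<open>I_ratio\<close> the quotient of \<open>I\<close> and \<open>V\<close> is
  nonincreasing, and it is the same at all rational radii; a monotone function with this property is
  constant.\<close>

lemma rigid_const:
  assumes rigid
  obtains k where "\<And>r. 0 < r \<Longrightarrow> ereal r < tau \<kappa> \<Longrightarrow> enn2real (I r) = k * V r"
proof -
  define i where "i r = enn2real (I r)" for r
  have V: "0 < V r" if "0 < r" "ereal r < tau \<kappa>" for r using V_less[of 0 r] that by simp
  have I: "I r = ennreal (i r)" if "0 < r" "ereal r < tau \<kappa>" for r
    using assms that unfolding rigid_def i_def by simp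
  have i0: "0 \<le> i r" for r by (simp add: i_def)
  have anti: "i R / V R \<le> i r / V r" if "0 < r" "r \<le> R" "ereal R < tau \<kappa>" for r R
  proof (cases "r = R")
    case False
    then have "ennreal (i R) * ennreal (V r) \<le> ennreal (i r) * ennreal (V R)"
      using I_ratio[of r R] that I[of r] I[of R] tau_less[of r R] by simp
    then have "i R * V r \<le> i r * V R"
      using V[of r] V[of R] that tau_less[of r R] i0
      by (simp add: ennreal_mult[symmetric])
    then show ?thesis using V[of r] V[of R] that tau_less[of r R] by (simp add: divide_simps mult_ac)
  qed simp
  have eqQ: "i R / V R = i r / V r" if "0 < r" "r < R" "ereal R < tau \<kappa>" "r \<in> \<rat>" "R \<in> \<rat>" for r R
  proof -
    have "I R * ennreal (V r) = I r * ennreal (V R)"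
      using assms that unfolding rigid_def by blast
    then have "ennreal (i R) * ennreal (V r) = ennreal (i r) * ennreal (V R)"
      using that I[of r] I[of R] tau_less[of r R] by simp
    then have "i R * V r = i r * V R"
      using V[of r] V[of R] that tau_less[of r R] i0
      by (simp add: ennreal_mult[symmetric])
    then show ?thesis using V[of r] V[of R] that tau_less[of r R] by (simp add: divide_simps mult_ac)
  qed
  have eq: "i R / V R = i r / V r" if "0 < r" "r < R" "ereal R < tau \<kappa>" for r R
  proof -
    \<comment> \<open>The real radii \<open>r < R\<close> are enclosed between rational ones, at
      which the quotients agree.\<close>
    obtain r' where r': "0 < r'" "r' < r" "r' \<in> \<rat>" using Rats_dense_in_real[of 0 r] \<open>0 < r\<close> by auto
    obtain R' where R': "R < R'" "R' \<in> \<rat>" "ereal R' < tau \<kappa>" using tau_room[OF \<open>ereal R < tau \<kappa>\<close>] by blast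
    have "i r / V r \<le> i r' / V r'" using r' that by (intro anti tau_less[of r R]) auto
    also have "\<dots> = i R' / V R'" using r' R' that by (intro eqQ[symmetric]) auto
    also have "\<dots> \<le> i R / V R" using R' that by (intro anti) auto
    finally show ?thesis using anti[of r R] that by simp
  qed
  obtain r0 where r0: "0 < r0" "ereal r0 < tau \<kappa>" using tau_pos by blast
  show ?thesis
  proof (rule that[of "i r0 / V r0"])
    fix r assume r: "0 < r" "ereal r < tau \<kappa>"
    have "i r / V r = i r0 / V r0"
      using eq[of r r0] eq[of r0 r] r r0 by (cases r r0 rule: linorder_cases) auto
    then show "enn2real (I r) = i r0 / V r0 * V r" using V[OF r] by (simp add: i_def field_simps)
  qed
qed

lemma I_pos:
  assumes "t \<in> E r"
  shows "0 < I r"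
proof (rule ccontr)
  assume "\<not> 0 < I r"
  then have "(\<integral>\<^sup>+t. ennreal (indicator (E r) t * p t) \<partial>lborel) = 0" by (simp add: I_alt)
  then have "AE x in lborel. ennreal (indicator (E r) x * p x) = 0"
    using nn_integral_0_iff_AE[of "\<lambda>x. ennreal (indicator (E r) x * p x)" lborel] p_measurable[of r] by simp
  then have "AE x in lborel. x \<notin> {0<..<t}"
  proof eventually_elim
    case (elim x)
    show ?case
    proof
      assume "x \<in> {0<..<t}"
      then have "x \<in> E r" using E_down[OF assms, of x] by auto
      then have "0 < p x" using p_pos by (auto simp: E_def)
      with elim \<open>x \<in> E r\<close> show False by (simp add: ennreal_eq_0_iff)
    qed
  qed
  then have "emeasure lborel {0<..<t} = 0"
    using AE_iff_measurable[of "{0<..<t}" lborel "\<lambda>x. x \<notin> {0<..<t}"]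
    by (simp del: greaterThanLessThan_iff)
  then show False using assms by (auto simp: E_def)
qed

text \<open>If \<open>s\<close> missed the value \<open>r\<close>, then \<open>I\<close> would stay
  constant beyond \<open>r\<close> while \<open>V\<close> grows strictly. The proportionality factor
  would be \<open>0\<close>, against the positive volume of the initial piece of the ray.\<close>

lemma rigid_reached:
  assumes rigid "0 < r" "ereal r < tau \<kappa>"
  shows "\<exists>t\<in>J. s t = r"
proof (rule ccontr)
  assume no: "\<not> (\<exists>t\<in>J. s t = r)"
  obtain k where k: "\<And>r. 0 < r \<Longrightarrow> ereal r < tau \<kappa> \<Longrightarrow> enn2real (I r) = k * V r"
    using rigid_const[OF assms(1)] by blast
  obtain R where R: "r < R" "ereal R < tau \<kappa>" using tau_room[OF assms(3)] by blast
  have "I R = I r" using E_not_reached[of r R] R no assms by (auto simp: I_def)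
  then have "k * V r = k * V R" using k[of r] k[of R] assms R by simp
  then have "k = 0" using V_less[of r R] assms R by auto
  obtain t where t: "t \<in> J" "0 < t" using J_right[OF zero_J] by auto
  have "s t < r" using reach_IVT[of t r] t no assms by (metis not_less order_less_imp_le)
  then have "t \<in> E r" using t by (simp add: E_def)
  then have "0 < I r" by (rule I_pos)
  \<comment> \<open>Finiteness matters here, because \<open>enn2real\<close> sends infinity to
    \<open>0\<close>.\<close>
  moreover have "I r < \<infinity>" using assms unfolding rigid_def by simp
  ultimately have "0 < enn2real (I r)" by (simp add: enn2real_positive_iff)
  then show False using k[of r] assms \<open>k = 0\<close> by simp
qed

text \<open>Differentiating \<open>I (s t) = k * V (s t)\<close> in \<open>t\<close> gives
  \<open>p = k * q\<close>, so \<open>\<rho> ^ m\<close> is constant; \<open>\<rho>\<close> is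
  positive and \<open>m\<close> is at least \<open>1\<close>, so \<open>\<rho>\<close> is constant
  too.\<close>

lemma rigid_ratio:
  assumes rigid "b \<in> J" "0 < b" "ereal (s b) < tau \<kappa>"
  obtains c where "\<And>t. t \<in> {0<..<b} \<Longrightarrow> t / H t = c * sn \<kappa> (s t)"
proof -
  obtain k where k: "\<And>r. 0 < r \<Longrightarrow> ereal r < tau \<kappa> \<Longrightarrow> enn2real (I r) = k * V r"
    using rigid_const[OF assms(1)] by blast
  have J: "x \<in> J" if "0 \<le> x" "x \<le> b" for x using that J_down[OF assms(2)] by simp
  have sm: "ereal (s x) < tau \<kappa>" if "0 \<le> x" "x \<le> b" for x
    using that by (intro tau_less[OF s_le[of x b] assms(4)] assms(2)) auto
  have pb: "continuous_on {0..b} p" by (rule continuous_on_subset[OF cont_p]) (use J in auto)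
  define P where "P t = integral {0..t} p" for t
  have P: "P t = k * V (s t)" if "t \<in> {0<..<b}" for t
  proof -
    have t: "t \<in> J" "0 < t" "t \<le> b" using that J by auto
    have "(p has_integral P t) {0..t}" unfolding P_def using pb t
      by (intro integrable_integral integrable_continuous_interval) (auto intro: continuous_on_subset)
    then have "I (s t) = ennreal (P t)"
      unfolding I_reached[OF t(1,2)] using J t p_nonneg
      by (intro nn_integral_has_integral_lebesgue') auto
    moreover have "0 \<le> P t" unfolding P_def using J t p_nonneg
      by (intro integral_nonneg) (use \<open>(p has_integral P t) {0..t}\<close> in auto)
    ultimately show ?thesis using k[of "s t"] s_pos[of t] t sm by simp
  qed
  have pq: "\<rho> t ^ m = k" if t: "t \<in> {0<..<b}" for t
  proof -
    have "(P has_real_derivative p t) (at t within {0..b})"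
      unfolding P_def by (intro integral_has_real_derivative pb) (use t in auto)
    then have "(P has_real_derivative p t) (at t within {0<..<b})"
      by (rule DERIV_subset) auto
    then have 1: "(P has_real_derivative p t) (at t)"
      using t at_within_open[of t "{0<..<b}"] by simp
    have 2: "((\<lambda>t. k * V (s t)) has_real_derivative k * q t) (at t)"
      using DERIV_cmult[OF DERIV_chain2[OF DV Ds, of t], of k] J t s_pos[of t] by (auto simp: q_def)
    have "p t = k * q t" by (rule DERIV_eq_on_interval[OF P t 1 2])
    moreover have "q t > 0" unfolding q_def using J[of t] t sm[of t] H_pos[of t] s_pos[of t] sn_pos[of "s t"]
      by auto
    ultimately show ?thesis using p_eq[of t] J t sm by auto
  qed
  have \<rho>_eq: "\<rho> t = \<rho> (b / 2)" if t: "t \<in> {0<..<b}" for t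
    using pq[OF t] pq[of "b / 2"] t assms(3) m_pos J sm \<rho>_pos[of t] \<rho>_pos[of "b / 2"]
    by (intro power_eq_imp_eq_base[of "\<rho> t" m]) auto
  show ?thesis
  proof (rule that[of "\<rho> (b / 2)"])
    fix t assume t: "t \<in> {0<..<b}"
    have "0 < sn \<kappa> (s t)" using J[of t] t sm[of t] s_pos[of t] by (intro sn_pos) auto
    then show "t / H t = \<rho> (b / 2) * sn \<kappa> (s t)"
      unfolding \<rho>_eq[OF t, symmetric] by (simp add: \<rho>_def)
  qed
qed

text \<open>Two differentiations of \<open>t / H = c * sn \<kappa> (s t)\<close>: the first gives
  \<open>H - t H' = c * cs \<kappa> (s t)\<close>, the second
  \<open>t H'' = \<kappa> * c * sn \<kappa> (s t) / H^2\<close>, and the original identity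
  eliminates \<open>c\<close>.\<close>

lemma rigid_ODE:
  assumes rigid "b \<in> J" "ereal (s b) < tau \<kappa>" "t \<in> {0<..<b}"
  shows "H2 t = \<kappa> / H t ^ 3"
proof -
  have J: "x \<in> J" "0 < x" "H x \<noteq> 0" if "x \<in> {0<..<b}" for x
    using that J_down[OF assms(2)] H_pos[of x] by auto
  obtain c where c: "\<And>t. t \<in> {0<..<b} \<Longrightarrow> t / H t = c * sn \<kappa> (s t)"
    using rigid_ratio[of b] assms by auto
  have 1: "H t - t * H1 t = c * cs \<kappa> (s t)" if t: "t \<in> {0<..<b}" for t
  proof -
    have "(1 * H t - t * H1 t) / (H t * H t) = c * (cs \<kappa> (s t) * (1 / (H t)\<^sup>2))"
      by (rule DERIV_eq_on_interval[where f = "\<lambda>t. t / H t" and g = "\<lambda>t. c * sn \<kappa> (s t)", OF _ t])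
        (erule c | intro DERIV_divide DERIV_ident DH J t DERIV_cmult DERIV_chain2[OF DERIV_sn Ds])+
    then show ?thesis using J[OF t] by (simp add: field_simps power2_eq_square)
  qed
  have "H1 t - (1 * H1 t + H2 t * t) = c * (- \<kappa> * sn \<kappa> (s t) * (1 / (H t)\<^sup>2))"
    by (rule DERIV_eq_on_interval[where f = "\<lambda>t. H t - t * H1 t" and g = "\<lambda>t. c * cs \<kappa> (s t)", OF _ assms(4)])
      (erule 1 | intro DERIV_diff DERIV_mult DERIV_ident DH DH1 J assms(4) DERIV_cmult DERIV_chain2[OF DERIV_cs Ds])+
  then have "t * H2 t = \<kappa> * (c * sn \<kappa> (s t)) / (H t)\<^sup>2" by (simp add: mult_ac)
  also have "\<dots> = t * (\<kappa> / H t ^ 3)"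
    unfolding c[OF assms(4), symmetric] using J[OF assms(4)] by (simp add: power3_eq_cube power2_eq_square mult_ac)
  finally show ?thesis using J[OF assms(4)] by (simp add: field_simps)
qed

text \<open>This integrates the Ermakov equation \<open>H'' = \<kappa> / H^3\<close>. The energy
  \<open>H'^2 + \<kappa> / H^2\<close> is conserved and equals the derivative of
  \<open>H H'\<close>, so \<open>H^2\<close> is a quadratic polynomial determined by the data at
  \<open>0\<close>.\<close>

lemma rigid_H:
  assumes rigid "b \<in> J" "ereal (s b) < tau \<kappa>"
  shows "(H b)\<^sup>2 = (H 0 + H1 0 * b)\<^sup>2 + \<kappa> * b\<^sup>2 / (H 0)\<^sup>2"
proof (cases "b = 0")
  case False
  then have b0: "0 < b" using J_nonneg[OF assms(2)] by simp
  have J: "x \<in> J" "0 < H x" if "0 \<le> x" "x \<le> b" for x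
    using that J_down[OF assms(2)] H_pos[of x] by auto
  \<comment> \<open>The value of the conserved energy at time \<open>0\<close>.\<close>
  define e where "e = (H1 0)\<^sup>2 + \<kappa> / (H 0)\<^sup>2"
  have c: "continuous_on {0..x} H" "continuous_on {0..x} H1" if "x \<le> b" for x
    using J that by (auto intro: continuous_on_subset[OF cont_H] continuous_on_subset[OF cont_H1])
  have en: "(H1 x)\<^sup>2 + \<kappa> / (H x)\<^sup>2 = e" if x: "0 < x" "x \<le> b" for x
    unfolding e_def
  proof (rule DERIV_isconst_end[OF x(1)])
    show "continuous_on {0..x} (\<lambda>t. (H1 t)\<^sup>2 + \<kappa> / (H t)\<^sup>2)"
      using J x by (intro continuous_intros c) force+
    show "((\<lambda>t. (H1 t)\<^sup>2 + \<kappa> / (H t)\<^sup>2) has_real_derivative 0) (at y)" if y: "0 < y" "y < x" for y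
    proof -
      have yJ: "y \<in> J" "H y \<noteq> 0" using J[of y] x y by auto
      have ode: "H2 y = \<kappa> / H y ^ 3" using rigid_ODE[OF assms, of y] x y by auto
      show ?thesis using yJ
        by (auto intro!: derivative_eq_intros DH DH1 simp: ode field_simps power2_eq_square power3_eq_cube)
    qed
  qed
  have HH: "H x * H1 x - e * x = H 0 * H1 0 - e * 0" if x: "0 < x" "x \<le> b" for x
  proof (rule DERIV_isconst_end[OF x(1)])
    show "continuous_on {0..x} (\<lambda>t. H t * H1 t - e * t)" using x by (intro continuous_intros c) auto
    show "((\<lambda>t. H t * H1 t - e * t) has_real_derivative 0) (at y)" if y: "0 < y" "y < x" for y
    proof -
      have yJ: "y \<in> J" "H y \<noteq> 0" using J[of y] x y by auto
      have "H2 y * H y = \<kappa> / (H y)\<^sup>2"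
        using rigid_ODE[OF assms, of y] x y yJ by (simp add: power2_eq_square power3_eq_cube)
      then have "(H1 y)\<^sup>2 + H2 y * H y = e" using en[of y] x y by simp
      then show ?thesis using yJ
        by (auto intro!: derivative_eq_intros DH DH1 simp: power2_eq_square)
    qed
  qed
  have "(H b)\<^sup>2 - 2 * (H 0 * H1 0) * b - e * b\<^sup>2 = (H 0)\<^sup>2 - 2 * (H 0 * H1 0) * 0 - e * 0\<^sup>2"
  proof (rule DERIV_isconst_end[OF b0])
    show "continuous_on {0..b} (\<lambda>t. (H t)\<^sup>2 - 2 * (H 0 * H1 0) * t - e * t\<^sup>2)"
      by (intro continuous_intros c) auto
    show "((\<lambda>t. (H t)\<^sup>2 - 2 * (H 0 * H1 0) * t - e * t\<^sup>2) has_real_derivative 0) (at y)"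
      if y: "0 < y" "y < b" for y
    proof -
      have yJ: "y \<in> J" using J[of y] y by auto
      have "H y * H1 y = H 0 * H1 0 + e * y" using HH[of y] y by simp
      then show ?thesis using yJ
        by (auto intro!: derivative_eq_intros DH simp: algebra_simps)
    qed
  qed
  then show ?thesis unfolding e_def by (simp add: algebra_simps power2_eq_square add_divide_distrib)
qed simp

end

section \<open>Polar coordinates\<close>

lemma nn_integral_lborel_scaleR:
  fixes f :: "'a::euclidean_space \<Rightarrow> ennreal"
  assumes [measurable]: "f \<in> borel_measurable borel" and "0 < c"
  shows "(\<integral>\<^sup>+x. f x \<partial>lborel) = ennreal (c ^ DIM('a)) * (\<integral>\<^sup>+x. f (c *\<^sub>R x) \<partial>lborel)"
  using assms(2)
  by (subst lborel_affine[of c 0]) (simp_all add: nn_integral_density nn_integral_distr nn_integral_cmult)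

lemma nn_integral_inverse_power:
  fixes a :: real
  assumes "0 < a" "0 < n"
  shows "(\<integral>\<^sup>+u\<in>{a<..}. ennreal (1 / u ^ (n + 1)) \<partial>lborel) = ennreal (1 / (real n * a ^ n))"
proof -
  have "(\<integral>\<^sup>+u\<in>{a<..}. ennreal (1 / u ^ (n + 1)) \<partial>lborel) = (\<integral>\<^sup>+u\<in>{a..}. ennreal (1 / u ^ (n + 1)) \<partial>lborel)"
  proof (rule nn_integral_cong_AE)
    show "AE u in lborel. ennreal (1 / u ^ (n + 1)) * indicator {a<..} u = ennreal (1 / u ^ (n + 1)) * indicator {a..} u"
      using AE_lborel_singleton[of a] by eventually_elim (auto simp: indicator_def)
  qed
  also have "\<dots> = ennreal (0 - (- 1 / (real n * a ^ n)))"
  proof (rule nn_integral_FTC_atLeast)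
    show "((\<lambda>u. - 1 / (real n * u ^ n)) has_real_derivative 1 / u ^ (n + 1)) (at u)" if "a \<le> u" for u
      using that assms
      by (auto intro!: derivative_eq_intros simp: field_simps power_diff)
    have "((\<lambda>u. - 1 / real n * inverse (u ^ n)) \<longlongrightarrow> - 1 / real n * 0) at_top"
      using assms(2) by (intro tendsto_intros tendsto_inverse_0_at_top filterlim_pow_at_top filterlim_ident) auto
    then show "((\<lambda>u. - 1 / (real n * u ^ n)) \<longlongrightarrow> 0) at_top"
      by (simp add: field_simps)
  qed (use assms in auto)
  finally show ?thesis by simp
qed

text \<open>Polar coordinates without a measure on the sphere: the directions are those of the points
  of the unit ball.\<close>

lemma nn_integral_polar:
  fixes f :: "'a::euclidean_space \<Rightarrow> ennreal"
  assumes [measurable]: "f \<in> borel_measurable borel"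
  defines "n \<equiv> DIM('a)"
  shows "(\<integral>\<^sup>+x. f x \<partial>lborel) = ennreal (real n) *
    (\<integral>\<^sup>+x\<in>ball 0 1. (\<integral>\<^sup>+t\<in>{0<..}. f (t *\<^sub>R (x /\<^sub>R norm x)) * ennreal (t ^ (n - 1)) \<partial>lborel) \<partial>lborel)"
proof -
  have n: "0 < n" by (simp add: n_def)
  have [measurable]: "ball (0::'a) 1 \<in> sets borel" by simp
  \<comment> \<open>Substitution \<open>t = norm x * u\<close>, which replaces the unit direction by
    \<open>x\<close> itself.\<close>
  have inner: "(\<integral>\<^sup>+t\<in>{0<..}. f (t *\<^sub>R (x /\<^sub>R norm x)) * ennreal (t ^ (n - 1)) \<partial>lborel)
    = (\<integral>\<^sup>+u\<in>{0<..}. f (u *\<^sub>R x) * ennreal (norm x ^ n * u ^ (n - 1)) \<partial>lborel)" if "x \<noteq> 0" for x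
  proof -
    have "(\<integral>\<^sup>+t\<in>{0<..}. f (t *\<^sub>R (x /\<^sub>R norm x)) * ennreal (t ^ (n - 1)) \<partial>lborel)
      = ennreal (norm x) * (\<integral>\<^sup>+u. f ((norm x * u) *\<^sub>R (x /\<^sub>R norm x)) * ennreal ((norm x * u) ^ (n - 1))
          * indicator {0<..} (norm x * u) \<partial>lborel)"
      using that by (subst nn_integral_real_affine[where c = "norm x" and t = 0]) auto
    also have "\<dots> = (\<integral>\<^sup>+u. ennreal (norm x) * (f ((norm x * u) *\<^sub>R (x /\<^sub>R norm x)) * ennreal ((norm x * u) ^ (n - 1))
          * indicator {0<..} (norm x * u)) \<partial>lborel)"
      by (subst nn_integral_cmult) auto
    also have "\<dots> = (\<integral>\<^sup>+u\<in>{0<..}. f (u *\<^sub>R x) * ennreal (norm x ^ n * u ^ (n - 1)) \<partial>lborel)"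
    proof (rule nn_integral_cong)
      fix u :: real
      have "norm x ^ n = norm x * norm x ^ (n - 1)" using n by (cases n) auto
      then show "ennreal (norm x) * (f ((norm x * u) *\<^sub>R (x /\<^sub>R norm x)) * ennreal ((norm x * u) ^ (n - 1))
          * indicator {0<..} (norm x * u)) = f (u *\<^sub>R x) * ennreal (norm x ^ n * u ^ (n - 1)) * indicator {0<..} u"
        using that by (cases "u > 0") (auto simp: zero_less_mult_iff ennreal_mult power_mult_distrib mult_ac)
    qed
    finally show ?thesis .
  qed
  \<comment> \<open>Substitution \<open>y = u *\<^sub>R x\<close> at fixed \<open>u\<close>. The
    unit ball becomes the condition \<open>norm y < u\<close>, written as an indicator of
    \<open>u - norm y\<close> so that it is jointly measurable for the second exchange of
    integrals.\<close>
  have outer: "(\<integral>\<^sup>+x\<in>ball 0 1. f (u *\<^sub>R x) * ennreal (norm x ^ n * u ^ (n - 1)) \<partial>lborel)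
    = (\<integral>\<^sup>+y. f y * ennreal (norm y ^ n) * ennreal (1 / u ^ (n + 1)) * indicator {0<..} (u - norm y) \<partial>lborel)"
    if u: "0 < u" for u
  proof -
    have "(\<integral>\<^sup>+y. f y * ennreal (norm y ^ n) * ennreal (1 / u ^ (n + 1)) * indicator {0<..} (u - norm y) \<partial>lborel)
      = ennreal (u ^ n) * (\<integral>\<^sup>+x. f (u *\<^sub>R x) * ennreal (norm (u *\<^sub>R x) ^ n) * ennreal (1 / u ^ (n + 1))
          * indicator {0<..} (u - norm (u *\<^sub>R x)) \<partial>lborel)"
      unfolding n_def
      by (rule nn_integral_lborel_scaleR[OF _ u]) measurable
    also have "\<dots> = (\<integral>\<^sup>+x. ennreal (u ^ n) * (f (u *\<^sub>R x) * ennreal (norm (u *\<^sub>R x) ^ n) * ennreal (1 / u ^ (n + 1))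
          * indicator {0<..} (u - norm (u *\<^sub>R x))) \<partial>lborel)"
      by (subst nn_integral_cmult) auto
    also have "\<dots> = (\<integral>\<^sup>+x\<in>ball 0 1. f (u *\<^sub>R x) * ennreal (norm x ^ n * u ^ (n - 1)) \<partial>lborel)"
    proof (rule nn_integral_cong)
      fix x :: 'a
      have e: "u ^ n * ((norm (u *\<^sub>R x) ^ n) * (1 / u ^ (n + 1))) = norm x ^ n * u ^ (n - 1)"
        using u n by (cases n) (auto simp: power_mult_distrib field_simps)
      have ee: "ennreal (u ^ n) * (ennreal (norm (u *\<^sub>R x) ^ n) * ennreal (1 / u ^ (n + 1))) = ennreal (norm x ^ n * u ^ (n - 1))"
        unfolding e[symmetric] ennreal_mult'[OF zero_le_power[OF less_imp_le[OF u]]]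
          ennreal_mult'[OF zero_le_power[OF norm_ge_zero]] ..
      have ind: "indicator {0<..} (u - norm (u *\<^sub>R x)) = (indicator (ball 0 1) x :: ennreal)"
        using u by (auto simp: indicator_def)
      have "ennreal (u ^ n) * (f (u *\<^sub>R x) * ennreal (norm (u *\<^sub>R x) ^ n) * ennreal (1 / u ^ (n + 1))
          * indicator {0<..} (u - norm (u *\<^sub>R x)))
        = f (u *\<^sub>R x) * (ennreal (u ^ n) * (ennreal (norm (u *\<^sub>R x) ^ n) * ennreal (1 / u ^ (n + 1))))
          * indicator (ball 0 1) x"
        unfolding ind by (simp only: mult_ac)
      then show "ennreal (u ^ n) * (f (u *\<^sub>R x) * ennreal (norm (u *\<^sub>R x) ^ n) * ennreal (1 / u ^ (n + 1))
          * indicator {0<..} (u - norm (u *\<^sub>R x))) = f (u *\<^sub>R x) * ennreal (norm x ^ n * u ^ (n - 1)) * indicator (ball 0 1) x"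
        unfolding ee .
    qed
    finally show ?thesis by simp
  qed
  have "(\<integral>\<^sup>+x\<in>ball 0 1. (\<integral>\<^sup>+t\<in>{0<..}. f (t *\<^sub>R (x /\<^sub>R norm x)) * ennreal (t ^ (n - 1)) \<partial>lborel) \<partial>lborel)
    = (\<integral>\<^sup>+x. (\<integral>\<^sup>+u. f (u *\<^sub>R x) * ennreal (norm x ^ n * u ^ (n - 1)) * indicator {0<..} u * indicator (ball 0 1) x \<partial>lborel) \<partial>lborel)"
  proof (rule nn_integral_cong_AE)
    show "AE x in lborel. (\<integral>\<^sup>+t\<in>{0<..}. f (t *\<^sub>R (x /\<^sub>R norm x)) * ennreal (t ^ (n - 1)) \<partial>lborel) * indicator (ball 0 1) x
      = (\<integral>\<^sup>+u. f (u *\<^sub>R x) * ennreal (norm x ^ n * u ^ (n - 1)) * indicator {0<..} u * indicator (ball 0 1) x \<partial>lborel)"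
      using AE_lborel_singleton[of 0]
    proof eventually_elim
      case (elim x)
      show ?case unfolding inner[OF elim] by (subst nn_integral_multc) auto
    qed
  qed
  also have "\<dots> = (\<integral>\<^sup>+u. (\<integral>\<^sup>+x. f (u *\<^sub>R x) * ennreal (norm x ^ n * u ^ (n - 1)) * indicator {0<..} u * indicator (ball 0 1) x \<partial>lborel) \<partial>lborel)"
    by (intro lborel_pair.Fubini') measurable
  also have "\<dots> = (\<integral>\<^sup>+u. (\<integral>\<^sup>+y. f y * ennreal (norm y ^ n) * ennreal (1 / u ^ (n + 1)) * indicator {0<..} (u - norm y) \<partial>lborel) \<partial>lborel)"
  proof (rule nn_integral_cong)
    fix u :: real
    show "(\<integral>\<^sup>+x. f (u *\<^sub>R x) * ennreal (norm x ^ n * u ^ (n - 1)) * indicator {0<..} u * indicator (ball 0 1) x \<partial>lborel)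
      = (\<integral>\<^sup>+y. f y * ennreal (norm y ^ n) * ennreal (1 / u ^ (n + 1)) * indicator {0<..} (u - norm y) \<partial>lborel)"
    proof (cases "0 < u")
      case True
      then show ?thesis unfolding outer[OF True, symmetric] by simp
    next
      case False
      have "\<not> norm y < u" for y :: 'a using False norm_ge_zero[of y] by linarith
      then show ?thesis using False by simp
    qed
  qed
  also have "\<dots> = (\<integral>\<^sup>+y. (\<integral>\<^sup>+u. f y * ennreal (norm y ^ n) * ennreal (1 / u ^ (n + 1)) * indicator {0<..} (u - norm y) \<partial>lborel) \<partial>lborel)"
    by (intro lborel_pair.Fubini') measurable
  \<comment> \<open>The \<open>u\<close>-integral runs over \<open>u > norm y\<close> and
    contributes \<open>norm y ^ n / (n * norm y ^ n) = 1 / n\<close>, which the factor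
    \<open>n\<close> in front compensates.\<close>
  also have "\<dots> = (\<integral>\<^sup>+y. f y * ennreal (1 / real n) \<partial>lborel)"
  proof (rule nn_integral_cong_AE)
    show "AE y in lborel. (\<integral>\<^sup>+u. f y * ennreal (norm y ^ n) * ennreal (1 / u ^ (n + 1)) * indicator {0<..} (u - norm y) \<partial>lborel)
      = f y * ennreal (1 / real n)"
      using AE_lborel_singleton[of 0]
    proof eventually_elim
      case (elim y)
      have "(\<integral>\<^sup>+u. f y * ennreal (norm y ^ n) * ennreal (1 / u ^ (n + 1)) * indicator {0<..} (u - norm y) \<partial>lborel)
        = f y * ennreal (norm y ^ n) * (\<integral>\<^sup>+u\<in>{norm y<..}. ennreal (1 / u ^ (n + 1)) \<partial>lborel)"
        by (subst nn_integral_cmult[symmetric])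
          (auto simp: mult_ac indicator_def intro!: nn_integral_cong)
      also have "\<dots> = f y * (ennreal (norm y ^ n) * ennreal (1 / (real n * norm y ^ n)))"
        using elim n by (subst nn_integral_inverse_power) (auto simp: mult_ac)
      also have "\<dots> = f y * ennreal (1 / real n)"
        using elim n by (subst ennreal_mult[symmetric]) auto
      finally show ?case .
    qed
  qed
  also have "\<dots> = (\<integral>\<^sup>+y. f y \<partial>lborel) * ennreal (1 / real n)"
    by (intro nn_integral_multc) auto
  finally have "ennreal (real n) * (\<integral>\<^sup>+x\<in>ball 0 1. (\<integral>\<^sup>+t\<in>{0<..}. f (t *\<^sub>R (x /\<^sub>R norm x)) * ennreal (t ^ (n - 1)) \<partial>lborel) \<partial>lborel)
    = (\<integral>\<^sup>+y. f y \<partial>lborel) * (ennreal (real n) * ennreal (1 / real n))" by (simp add: mult_ac)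
  also have "ennreal (real n) * ennreal (1 / real n) = 1"
    using n by (subst ennreal_mult[symmetric]) auto
  finally show ?thesis by simp
qed

text \<open>The difference is nonnegative with integral \<open>0\<close>. Finiteness is what allows
  the two integrals to be subtracted.\<close>

lemma nn_integral_eq_imp_AE_eq:
  assumes [measurable]: "f \<in> borel_measurable M" "g \<in> borel_measurable M"
    and le: "AE x in M. f x \<le> g x"
    and eq: "(\<integral>\<^sup>+x. f x \<partial>M) = (\<integral>\<^sup>+x. g x \<partial>M)" and fin: "(\<integral>\<^sup>+x. f x \<partial>M) < \<infinity>"
  shows "AE x in M. f x = (g x :: ennreal)"
proof -
  have "(\<integral>\<^sup>+x. g x - f x \<partial>M) = (\<integral>\<^sup>+x. g x \<partial>M) - (\<integral>\<^sup>+x. f x \<partial>M)"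
    using le fin by (intro nn_integral_diff) auto
  also have "\<dots> = 0" using eq fin by simp
  finally have "AE x in M. g x - f x = 0" by (subst (asm) nn_integral_0_iff_AE) auto
  with le show ?thesis
  proof eventually_elim
    case (elim x)
    then show ?case by (metis antisym diff_eq_0_iff_ennreal not_less top.not_eq_extremum order.refl)
  qed
qed

text \<open>In \<open>ennreal\<close>, division by \<open>0\<close> gives \<open>0\<close> or
  infinity and division by infinity gives \<open>0\<close>. A positive real quotient therefore
  certifies a positive finite denominator; this is how the volume hypothesis yields finiteness of
  the volumes.\<close>

lemma ennreal_divide_eq_posD:
  fixes a b :: ennreal
  assumes "a / b = ennreal c" "0 < c"
  shows "0 < b" "b < \<infinity>" "a = ennreal c * b"
proof -
  show b0: "0 < b"
  proof (rule ccontr)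
    assume "\<not> 0 < b"
    then have "b = 0" by simp
    then show False using assms by (cases "a = 0") (auto simp: ennreal_divide_zero)
  qed
  show bf: "b < \<infinity>"
  proof (rule ccontr)
    assume "\<not> b < \<infinity>"
    then have "b = top" by (metis top.not_eq_extremum infinity_ennreal_def)
    then show False using assms by (simp add: ennreal_divide_top)
  qed
  have "a / b * b = a" using b0 bf by (simp add: ennreal_divide_times)
  then show "a = ennreal c * b" using assms by simp
qed

section \<open>The graph of a positive function\<close>

text \<open>\<open>frechet_derivative\<close> is a choice among all derivatives at \<open>x\<close>,
  and \<open>f\<close> and \<open>g\<close> have the same ones. It transfers formulas known only on
  \<open>\<Omega>\<close> to functions defined on the whole space.\<close>

lemma frechet_derivative_cong_open:
  assumes "open S" "x \<in> S" "\<And>z. z \<in> S \<Longrightarrow> f z = g z"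
  shows "frechet_derivative f (at x) = frechet_derivative g (at x)"
proof -
  have "(f has_derivative f') (at x) \<longleftrightarrow> (g has_derivative f') (at x)" for f'
    using has_derivative_transform_within_open[of f f' x UNIV S g] has_derivative_transform_within_open[of g f' x UNIV S f] assms
    by auto
  then show ?thesis by (simp add: frechet_derivative_def)
qed

lemma partial_deriv_const_on_open:
  assumes "open S" "x \<in> S" "\<And>z. z \<in> S \<Longrightarrow> f z = c"
  shows "partial_deriv i f x = 0"
proof -
  have "frechet_derivative f (at x) = frechet_derivative (\<lambda>_. c) (at x)"
    using assms by (rule frechet_derivative_cong_open)
  then show ?thesis by (simp add: partial_deriv_def)
qed

locale positive_graph =
  fixes \<Omega> :: "(real^'n::finite) set" and h :: "real^'n \<Rightarrow> real"
  assumes open_\<Omega>: "open \<Omega>" and convex_\<Omega>: "convex \<Omega>" and zero_\<Omega>: "0 \<in> \<Omega>"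
    and smooth_h: "smooth_on \<Omega> h" and h_pos: "x \<in> \<Omega> \<Longrightarrow> 0 < h x"
begin

abbreviation F :: "real^'n \<Rightarrow> real \<times> (real^'n)" where "F \<equiv> F_map h"
abbreviation M :: "(real \<times> (real^'n)) set" where "M \<equiv> F ` \<Omega>"
abbreviation g :: "(real \<times> (real^'n)) metric_tensor" where "g \<equiv> g_bar \<Omega> h"
abbreviation f :: "real \<times> (real^'n) \<Rightarrow> real" where "f \<equiv> f_bar \<Omega> h"

definition D :: "real^'n \<Rightarrow> real^'n \<Rightarrow> real" where "D v x = frechet_derivative h (at x) v"
definition D2 :: "real^'n \<Rightarrow> real^'n \<Rightarrow> real^'n \<Rightarrow> real" where "D2 v w x = frechet_derivative (D v) (at x) w"
definition dF :: "real^'n \<Rightarrow> real^'n \<Rightarrow> real \<times> (real^'n)" where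
  "dF x v = (- D v x / (h x)\<^sup>2) *\<^sub>R (1, x) + (1 / h x) *\<^sub>R (0, v)"

lemma h_deriv: "x \<in> \<Omega> \<Longrightarrow> (h has_derivative (\<lambda>v. D v x)) (at x)"
proof -
  assume "x \<in> \<Omega>"
  moreover have "Ck_on (Suc 0) \<Omega> h" using smooth_h by (simp only: smooth_on_def)
  ultimately have "h differentiable (at x)" by simp
  then show ?thesis unfolding D_def by (simp add: frechet_derivative_works)
qed

lemma D_deriv: "x \<in> \<Omega> \<Longrightarrow> (D v has_derivative (\<lambda>w. D2 v w x)) (at x)"
proof -
  assume "x \<in> \<Omega>"
  moreover have "Ck_on (Suc (Suc 0)) \<Omega> h" using smooth_h by (simp only: smooth_on_def)
  ultimately have "(\<lambda>x. frechet_derivative h (at x) v) differentiable (at x)" by simp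
  then show ?thesis unfolding D2_def D_def[abs_def] by (simp add: frechet_derivative_works)
qed

lemma linear_D: "x \<in> \<Omega> \<Longrightarrow> linear (\<lambda>v. D v x)"
  using h_deriv has_derivative_linear by blast

lemma linear_D2: "x \<in> \<Omega> \<Longrightarrow> linear (\<lambda>w. D2 v w x)"
  using D_deriv has_derivative_linear by blast

lemma continuous_h: "continuous_on \<Omega> h"
  using h_deriv has_derivative_continuous by (metis continuous_at_imp_continuous_on)

lemma continuous_D: "continuous_on \<Omega> (D v)"
  using D_deriv has_derivative_continuous by (metis continuous_at_imp_continuous_on)

lemma D_sum_axis: "x \<in> \<Omega> \<Longrightarrow> D v x = (\<Sum>i\<in>UNIV. v $ i * D (axis i 1) x)"
proof -
  assume x: "x \<in> \<Omega>"
  have "D v x = D (\<Sum>i\<in>UNIV. v $ i *\<^sub>R axis i 1) x" using basis_expansion[of v] by (simp add: scalar_mult_eq_scaleR)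
  also have "\<dots> = (\<Sum>i\<in>UNIV. v $ i * D (axis i 1) x)"
    by (simp add: linear_sum[OF linear_D[OF x]] linear_cmul[OF linear_D[OF x]])
  finally show ?thesis .
qed

lemma D2_sum_axis:
  assumes x: "x \<in> \<Omega>"
  shows "D2 v v x = (\<Sum>i\<in>UNIV. \<Sum>j\<in>UNIV. v $ i * v $ j * D2 (axis j 1) (axis i 1) x)"
proof -
  \<comment> \<open>Linearity in the direction of the first differentiation comes from
    differentiating the expansion of \<open>D v\<close>, which holds on the open set
    \<open>\<Omega>\<close>.\<close>
  have 1: "D2 v w x = (\<Sum>j\<in>UNIV. v $ j * D2 (axis j 1) w x)" for w
  proof -
    have "((\<lambda>z. \<Sum>j\<in>UNIV. v $ j * D (axis j 1) z) has_derivative (\<lambda>w. \<Sum>j\<in>UNIV. v $ j * D2 (axis j 1) w x)) (at x)"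
      by (auto intro!: derivative_eq_intros D_deriv x)
    then have "(D v has_derivative (\<lambda>w. \<Sum>j\<in>UNIV. v $ j * D2 (axis j 1) w x)) (at x)"
      by (rule has_derivative_transform_within_open[OF _ open_\<Omega> x]) (simp add: D_sum_axis[symmetric])
    from has_derivative_unique[OF this D_deriv[OF x]] show ?thesis by (metis)
  qed
  have 2: "D2 u v x = (\<Sum>i\<in>UNIV. v $ i * D2 u (axis i 1) x)" for u
  proof -
    have "D2 u v x = D2 u (\<Sum>i\<in>UNIV. v $ i *\<^sub>R axis i 1) x" using basis_expansion[of v] by (simp add: scalar_mult_eq_scaleR)
    also have "\<dots> = (\<Sum>i\<in>UNIV. v $ i * D2 u (axis i 1) x)"
      by (simp add: linear_sum[OF linear_D2[OF x]] linear_cmul[OF linear_D2[OF x]])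
    finally show ?thesis .
  qed
  show ?thesis
    unfolding 2[of v] by (subst 1) (simp add: sum_distrib_left mult_ac)
qed

lemma h_line_deriv:
  "x + t *\<^sub>R u \<in> \<Omega> \<Longrightarrow> ((\<lambda>t. h (x + t *\<^sub>R u)) has_real_derivative D u (x + t *\<^sub>R u)) (at t)"
proof -
  assume x: "x + t *\<^sub>R u \<in> \<Omega>"
  have "((\<lambda>t. x + t *\<^sub>R u) has_derivative (\<lambda>t. t *\<^sub>R u)) (at t)"
    by (auto intro!: derivative_eq_intros)
  from has_derivative_compose[OF this h_deriv[OF x]]
  have "((\<lambda>t. h (x + t *\<^sub>R u)) has_derivative (\<lambda>s. D (s *\<^sub>R u) (x + t *\<^sub>R u))) (at t)" .
  then show ?thesis
    using linear_cmul[OF linear_D[OF x]] by (simp add: has_field_derivative_def mult_commute_abs)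
qed

lemma D_line_deriv:
  "x + t *\<^sub>R u \<in> \<Omega> \<Longrightarrow> ((\<lambda>t. D v (x + t *\<^sub>R u)) has_real_derivative D2 v u (x + t *\<^sub>R u)) (at t)"
proof -
  assume x: "x + t *\<^sub>R u \<in> \<Omega>"
  have "((\<lambda>t. x + t *\<^sub>R u) has_derivative (\<lambda>t. t *\<^sub>R u)) (at t)"
    by (auto intro!: derivative_eq_intros)
  from has_derivative_compose[OF this D_deriv[OF x]]
  have "((\<lambda>t. D v (x + t *\<^sub>R u)) has_derivative (\<lambda>s. D2 v (s *\<^sub>R u) (x + t *\<^sub>R u))) (at t)" .
  then show ?thesis
    using linear_cmul[OF linear_D2[OF x]] by (simp add: has_field_derivative_def mult_commute_abs)
qed

section \<open>The embedding and its chart\<close>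

lemma F_deriv: "x \<in> \<Omega> \<Longrightarrow> (F has_derivative dF x) (at x)"
proof -
  assume x: "x \<in> \<Omega>"
  have "h x \<noteq> 0" using h_pos[OF x] by simp
  then show ?thesis
    unfolding F_map_def[abs_def] dF_def
    by (auto intro!: derivative_eq_intros h_deriv[OF x] simp: power2_eq_square divide_inverse fun_eq_iff)
qed

lemma frechet_F: "x \<in> \<Omega> \<Longrightarrow> frechet_derivative F (at x) = dF x"
  using F_deriv frechet_derivative_at by metis

text \<open>The first components yield equal derivatives of \<open>h\<close>, after which the second
  components yield the vectors. Injectivity makes the \<open>inv\<close> inside
  \<open>chart_vec\<close> a genuine inverse on tangent vectors.\<close>

lemma inj_dF: "x \<in> \<Omega> \<Longrightarrow> inj (dF x)"
proof (rule injI)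
  fix u v assume x: "x \<in> \<Omega>" and e: "dF x u = dF x v"
  have h: "0 < h x" using h_pos[OF x] .
  have "D u x = D v x" using e h by (simp add: dF_def)
  then show "u = v" using e h by (simp add: dF_def)
qed

lemma inj_F: "inj_on F \<Omega>"
proof (rule inj_onI)
  fix x y assume x: "x \<in> \<Omega>" "y \<in> \<Omega>" and e: "F x = F y"
  then show "x = y" using h_pos[OF x(1)] h_pos[OF x(2)] by (auto simp: F_map_def)
qed

lemma chart_F [simp]: "x \<in> \<Omega> \<Longrightarrow> chart F \<Omega> (F x) = x"
  unfolding chart_def by (rule the_inv_into_f_f[OF inj_F])

text \<open>The chart is the central projection from the origin. The closed form shows continuity
  and differentiability, which are invisible in \<open>the_inv_into\<close>.\<close>

lemma chart_eq: "y \<in> M \<Longrightarrow> chart F \<Omega> y = snd y /\<^sub>R fst y"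
proof -
  assume "y \<in> M"
  then obtain x where x: "x \<in> \<Omega>" "y = F x" by blast
  have "x = snd (F x) /\<^sub>R fst (F x)" using h_pos[OF x(1)] by (simp add: F_map_def)
  then show ?thesis using x by simp
qed

lemma chart_vec_dF [simp]: "x \<in> \<Omega> \<Longrightarrow> chart_vec F \<Omega> (F x) (dF x v) = v"
  unfolding chart_vec_def by (simp add: frechet_F inv_f_f[OF inj_dF])

lemma g_dF: "x \<in> \<Omega> \<Longrightarrow> g (F x) (dF x u) (dF x v) = u \<bullet> v"
  by (simp add: g_bar_def pushforward_metric_def euclidean_metric_def)

lemma f_F: "x \<in> \<Omega> \<Longrightarrow> f (F x) = (real CARD('n) - 1) * ln (h x)"
  using chart_F[of x] by (simp add: f_bar_def f_fun_def chart_def)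

section \<open>Flatness and the Ricci tensor\<close>

lemma metric_matrix_eq: "x \<in> \<Omega> \<Longrightarrow> metric_matrix F g x = mat 1"
  by (simp add: metric_matrix_def partial_deriv_def frechet_F g_dF inner_axis_axis inner_real_def mat_def vec_eq_iff)

lemma christoffel_0: "x \<in> \<Omega> \<Longrightarrow> christoffel F g k i j x = 0"
proof -
  assume x: "x \<in> \<Omega>"
  have "partial_deriv a (\<lambda>z. metric_matrix F g z $ b $ c) x = 0" for a b c
    by (rule partial_deriv_const_on_open[OF open_\<Omega> x, where c = "mat 1 $ b $ c"])
      (simp add: metric_matrix_eq)
  then show ?thesis by (simp add: christoffel_def)
qed

lemma ricci_coeff_0: "x \<in> \<Omega> \<Longrightarrow> ricci_coeff F g i j x = 0"
proof -
  assume x: "x \<in> \<Omega>"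
  have "partial_deriv a (christoffel F g k i j) x = 0" for a k i j
    by (rule partial_deriv_const_on_open[OF open_\<Omega> x]) (rule christoffel_0)
  then show ?thesis by (simp add: ricci_coeff_def christoffel_0[OF x])
qed

lemma f_frechet:
  assumes x: "x \<in> \<Omega>"
  shows "frechet_derivative (f \<circ> F) (at x) v = (real CARD('n) - 1) * (D v x / h x)"
proof -
  have "frechet_derivative (f \<circ> F) (at x) = frechet_derivative (\<lambda>x. (real CARD('n) - 1) * ln (h x)) (at x)"
    using open_\<Omega> x by (rule frechet_derivative_cong_open) (simp add: f_F)
  also have "\<dots> = (\<lambda>v. (real CARD('n) - 1) * (D v x / h x))"
    by (rule frechet_derivative_at[symmetric])
      (use h_pos[OF x] in \<open>auto intro!: derivative_eq_intros h_deriv[OF x] simp: field_simps\<close>)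
  finally show ?thesis by simp
qed

lemma hess_coeff_eq:
  assumes x: "x \<in> \<Omega>"
  shows "hess_coeff F g f i j x = (real CARD('n) - 1) *
    (D2 (axis j 1) (axis i 1) x / h x - D (axis i 1) x * D (axis j 1) x / (h x)\<^sup>2)"
proof -
  have hx: "h x \<noteq> 0" using h_pos[OF x] by simp
  have "partial_deriv i (partial_deriv j (f \<circ> F)) x
    = frechet_derivative (\<lambda>x. (real CARD('n) - 1) * (D (axis j 1) x / h x)) (at x) (axis i 1)"
    unfolding partial_deriv_def
    by (subst frechet_derivative_cong_open[OF open_\<Omega> x]) (auto simp: f_frechet)
  also have "frechet_derivative (\<lambda>x. (real CARD('n) - 1) * (D (axis j 1) x / h x)) (at x)
    = (\<lambda>v. (real CARD('n) - 1) * (D2 (axis j 1) v x / h x - D v x * D (axis j 1) x / (h x)\<^sup>2))"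
    by (rule frechet_derivative_at[symmetric])
      (use hx in \<open>auto intro!: derivative_eq_intros h_deriv[OF x] D_deriv[OF x]
        simp: fun_eq_iff field_simps power2_eq_square\<close>)
  finally have P: "partial_deriv i (partial_deriv j (f \<circ> F)) x = (real CARD('n) - 1) *
    (D2 (axis j 1) (axis i 1) x / h x - D (axis i 1) x * D (axis j 1) x / (h x)\<^sup>2)" .
  show ?thesis unfolding hess_coeff_def P by (simp add: christoffel_0[OF x])
qed

text \<open>The Hessian of \<open>(n-1) ln h\<close> contributes
  \<open>-(n-1) (D v h)^2 / h^2\<close>, and the term \<open>df * df / (n-1)\<close> cancels it
  exactly. The bound on \<open>Ric1\<close> thus becomes linear in the second derivatives of
  \<open>h\<close>.\<close>

lemma Ric1_dF:
  assumes x: "x \<in> \<Omega>" and n: "CARD('n) \<ge> 2"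
  shows "Ric1 F \<Omega> g f (F x) (dF x v) (dF x v) = (real CARD('n) - 1) * (D2 v v x / h x)"
proof -
  define N where "N = real CARD('n) - 1"
  have N: "N \<noteq> 0" using n by (simp add: N_def)
  have "Hess F \<Omega> g f (F x) (dF x v) (dF x v)
    = (\<Sum>i\<in>UNIV. \<Sum>j\<in>UNIV. N / h x * (v $ i * v $ j * D2 (axis j 1) (axis i 1) x)
        - N / (h x)\<^sup>2 * ((v $ i * D (axis i 1) x) * (v $ j * D (axis j 1) x)))"
    unfolding Hess_def N_def[symmetric] using x
    by (simp add: hess_coeff_eq N_def[symmetric]) (simp add: algebra_simps divide_inverse)
  also have "\<dots> = N / h x * D2 v v x - N / (h x)\<^sup>2 * (D v x * D v x)"
    unfolding D2_sum_axis[OF x] D_sum_axis[OF x, of v] sum_product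
    by (simp add: sum_subtractf sum_distrib_left)
  finally have H: "Hess F \<Omega> g f (F x) (dF x v) (dF x v) = N / h x * D2 v v x - N / (h x)\<^sup>2 * (D v x * D v x)" .
  have R: "Ric F \<Omega> g (F x) (dF x v) (dF x v) = 0"
    using x by (simp add: Ric_def ricci_coeff_0)
  have d: "differential F \<Omega> f (F x) (dF x v) = N * (D v x / h x)"
    using x by (simp add: differential_def f_frechet N_def)
  show ?thesis unfolding Ric1_def H R d N_def[symmetric]
    using N h_pos[OF x] by (simp add: field_simps power2_eq_square)
qed

lemma tangent_space_F: "x \<in> \<Omega> \<Longrightarrow> tangent_space F \<Omega> (F x) = range (dF x)"
  by (simp add: tangent_space_def frechet_F)

lemma linear_dF: "x \<in> \<Omega> \<Longrightarrow> linear (dF x)"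
  using F_deriv has_derivative_linear by blast

lemma F_line_deriv:
  "t *\<^sub>R v \<in> \<Omega> \<Longrightarrow> ((\<lambda>t. F (t *\<^sub>R v)) has_vector_derivative dF (t *\<^sub>R v) v) (at t)"
proof -
  assume x: "t *\<^sub>R v \<in> \<Omega>"
  have "((\<lambda>t. t *\<^sub>R v) has_derivative (\<lambda>t. t *\<^sub>R v)) (at t)"
    by (auto intro!: derivative_eq_intros)
  from has_derivative_compose[OF this F_deriv[OF x]]
  show ?thesis by (simp add: has_vector_derivative_def linear_cmul[OF linear_dF[OF x]])
qed

lemma F_chart: "y \<in> M \<Longrightarrow> F (chart F \<Omega> y) = y" and chart_in: "y \<in> M \<Longrightarrow> chart F \<Omega> y \<in> \<Omega>"
  by auto

section \<open>Geodesics, distance and cut time\<close>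

lemma ray_down: "t *\<^sub>R v \<in> \<Omega> \<Longrightarrow> 0 \<le> \<xi> \<Longrightarrow> \<xi> \<le> t \<Longrightarrow> \<xi> *\<^sub>R v \<in> \<Omega>"
proof (cases "t = 0")
  case False
  assume a: "t *\<^sub>R v \<in> \<Omega>" "0 \<le> \<xi>" "\<xi> \<le> t"
  then have "(1 - \<xi> / t) *\<^sub>R 0 + (\<xi> / t) *\<^sub>R (t *\<^sub>R v) \<in> \<Omega>"
    using False by (intro convexD[OF convex_\<Omega> zero_\<Omega>]) auto
  then show ?thesis using False by simp
qed auto

lemma ray_right:
  assumes "t *\<^sub>R v \<in> \<Omega>" obtains T where "t < T" "T *\<^sub>R v \<in> \<Omega>"
proof -
  have "open ((\<lambda>t. t *\<^sub>R v) -` \<Omega>)" by (intro open_vimage open_\<Omega> continuous_intros)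
  then obtain e where "e > 0" "ball t e \<subseteq> (\<lambda>t. t *\<^sub>R v) -` \<Omega>"
    using assms open_contains_ball by (metis vimageI2)
  then have "(t + e / 2) *\<^sub>R v \<in> \<Omega>" by (auto simp: subset_iff dist_real_def)
  then show ?thesis using \<open>e > 0\<close> that[of "t + e / 2"] by simp
qed

text \<open>With vanishing Christoffel symbols the geodesic equation makes the chart velocity
  constant, so the chart curve is affine. The statement includes uniqueness, which the
  \<open>THE\<close> in \<open>max_geodesic\<close> requires.\<close>

lemma is_geodesic_iff:
  "is_geodesic F \<Omega> g (F 0) (dF 0 v) T \<gamma> \<longleftrightarrow> 0 < T \<and> (\<forall>t\<in>{0..<T}. t *\<^sub>R v \<in> \<Omega> \<and> \<gamma> t = F (t *\<^sub>R v))"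
    (is "?L \<longleftrightarrow> ?R")
proof
  assume ?L
  then obtain c' where T: "0 < T" and im: "\<And>t. t \<in> {0..<T} \<Longrightarrow> \<gamma> t \<in> M" and g0: "\<gamma> 0 = F 0"
    and d0: "(\<gamma> has_vector_derivative dF 0 v) (at 0 within {0..<T})"
    and d1: "\<And>t. t \<in> {0..<T} \<Longrightarrow> ((chart F \<Omega> \<circ> \<gamma>) has_vector_derivative c' t) (at t within {0..<T})"
    and d2: "\<And>t. t \<in> {0..<T} \<Longrightarrow> (c' has_vector_derivative
           (\<chi> k. - (\<Sum>i\<in>UNIV. \<Sum>j\<in>UNIV. christoffel F g k i j (chart F \<Omega> (\<gamma> t)) * c' t $ i * c' t $ j)))
          (at t within {0..<T})"
    unfolding is_geodesic_def by blast
  have "(c' has_vector_derivative 0) (at t within {0..<T})" if "t \<in> {0..<T}" for t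
    using d2[OF that] christoffel_0[OF chart_in[OF im[OF that]]] by (simp add: zero_vec_def)
  then obtain w where w: "\<And>t. t \<in> {0..<T} \<Longrightarrow> c' t = w"
    using has_vector_derivative_zero_constant[of "{0..<T}" c'] by auto
  have "((\<lambda>t. (chart F \<Omega> \<circ> \<gamma>) t - t *\<^sub>R w) has_vector_derivative 0) (at t within {0..<T})" if "t \<in> {0..<T}" for t
  proof -
    have "((\<lambda>t. t *\<^sub>R w) has_vector_derivative w) (at t within {0..<T})"
      by (auto intro!: derivative_eq_intros)
    from has_vector_derivative_diff[OF d1[OF that] this] show ?thesis unfolding w[OF that] diff_self .
  qed
  then obtain w0 where w0: "\<And>t. t \<in> {0..<T} \<Longrightarrow> (chart F \<Omega> \<circ> \<gamma>) t - t *\<^sub>R w = w0"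
    using has_vector_derivative_zero_constant[of "{0..<T}" "\<lambda>t. (chart F \<Omega> \<circ> \<gamma>) t - t *\<^sub>R w"] by auto
  have "w0 = 0" using w0[of 0] T g0 zero_\<Omega> by simp
  then have c: "chart F \<Omega> (\<gamma> t) = t *\<^sub>R w" if "t \<in> {0..<T}" for t using w0[OF that] by simp
  have tw: "t *\<^sub>R w \<in> \<Omega>" "\<gamma> t = F (t *\<^sub>R w)" if "t \<in> {0..<T}" for t
    using c[OF that] chart_in[OF im[OF that]] F_chart[OF im[OF that]] by auto
  \<comment> \<open>The constant chart velocity \<open>w\<close> is identified with \<open>v\<close>
    by comparing ambient initial velocities through the injective \<open>dF 0\<close>.\<close>
  have "((\<lambda>t. F (t *\<^sub>R w)) has_vector_derivative dF 0 w) (at 0 within {0..<T})"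
    using F_line_deriv[of 0 w] zero_\<Omega> by (auto intro: has_vector_derivative_at_within)
  then have "(\<gamma> has_vector_derivative dF 0 w) (at 0 within {0..<T})"
    by (rule has_vector_derivative_transform[rotated 2]) (use T tw in auto)
  moreover have "at 0 within {0..<T} \<noteq> bot"
  proof -
    have "{0..<T} - {0} = {0<..<T}" by auto
    then show ?thesis using T by (simp add: at_within_eq_bot_iff)
  qed
  ultimately have "dF 0 w = dF 0 v"
    using d0 vector_derivative_unique_within by blast
  then have "w = v" using inj_dF[OF zero_\<Omega>] by (simp add: inj_eq)
  then show ?R using T tw by simp
next
  assume R: ?R
  then have T: "0 < T" and tv: "\<And>t. t \<in> {0..<T} \<Longrightarrow> t *\<^sub>R v \<in> \<Omega>" "\<And>t. t \<in> {0..<T} \<Longrightarrow> \<gamma> t = F (t *\<^sub>R v)"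
    by auto
  have "((\<lambda>t. F (t *\<^sub>R v)) has_vector_derivative dF 0 v) (at 0 within {0..<T})"
    using F_line_deriv[of 0 v] zero_\<Omega> by (auto intro: has_vector_derivative_at_within)
  then have d0: "(\<gamma> has_vector_derivative dF 0 v) (at 0 within {0..<T})"
    by (rule has_vector_derivative_transform[rotated 2]) (use T tv in auto)
  have d1: "((chart F \<Omega> \<circ> \<gamma>) has_vector_derivative v) (at t within {0..<T})" if "t \<in> {0..<T}" for t
  proof (rule has_vector_derivative_transform[OF that])
    show "((\<lambda>t. t *\<^sub>R v) has_vector_derivative v) (at t within {0..<T})"
      by (auto intro!: derivative_eq_intros)
  qed (use tv in auto)
  have d2: "(\<chi> k. - (\<Sum>i\<in>UNIV. \<Sum>j\<in>UNIV. christoffel F g k i j (chart F \<Omega> (\<gamma> t)) * v $ i * v $ j)) = 0"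
    if "t \<in> {0..<T}" for t
    using tv[OF that] by (simp add: christoffel_0 zero_vec_def)
  show ?L
    unfolding is_geodesic_def
  proof (intro conjI exI[of _ "\<lambda>_. v"] ballI)
    show "\<gamma> ` {0..<T} \<subseteq> M" using tv by auto
    show "\<gamma> 0 = F 0" using tv(2)[of 0] T by simp
    fix t assume t: "t \<in> {0..<T}"
    show "((\<lambda>_. v) has_vector_derivative (\<chi> k. - (\<Sum>i\<in>UNIV. \<Sum>j\<in>UNIV.
        christoffel F g k i j (chart F \<Omega> (\<gamma> t)) * v $ i * v $ j))) (at t within {0..<T})"
      unfolding d2[OF t] by simp
  qed (use T d0 d1 in auto)
qed

lemma less_geodesic_end:
  assumes "0 \<le> t"
  shows "ereal t < geodesic_end F \<Omega> g (F 0) (dF 0 v) \<longleftrightarrow> t *\<^sub>R v \<in> \<Omega>"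
proof
  assume "ereal t < geodesic_end F \<Omega> g (F 0) (dF 0 v)"
  then obtain T \<gamma> where "t < T" "is_geodesic F \<Omega> g (F 0) (dF 0 v) T \<gamma>"
    by (auto simp: geodesic_end_def less_Sup_iff)
  then show "t *\<^sub>R v \<in> \<Omega>" using assms by (auto simp: is_geodesic_iff)
next
  assume "t *\<^sub>R v \<in> \<Omega>"
  then obtain T where T: "t < T" "T *\<^sub>R v \<in> \<Omega>" using ray_right by blast
  then have "is_geodesic F \<Omega> g (F 0) (dF 0 v) T (\<lambda>t. F (t *\<^sub>R v))"
    using assms ray_down[OF T(2)] by (auto simp: is_geodesic_iff)
  then show "ereal t < geodesic_end F \<Omega> g (F 0) (dF 0 v)"
    unfolding geodesic_end_def less_Sup_iff using T(1) by (intro bexI[of _ "ereal T"]) auto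
qed

lemma max_geodesic_eq:
  assumes "0 \<le> t" "t *\<^sub>R v \<in> \<Omega>"
  shows "max_geodesic F \<Omega> g (F 0) (dF 0 v) t = F (t *\<^sub>R v)"
  unfolding max_geodesic_def
proof (rule the_equality)
  obtain T where T: "t < T" "T *\<^sub>R v \<in> \<Omega>" using ray_right[OF assms(2)] by blast
  then have "is_geodesic F \<Omega> g (F 0) (dF 0 v) T (\<lambda>t. F (t *\<^sub>R v))"
    using assms ray_down[OF T(2)] by (auto simp: is_geodesic_iff)
  then show "\<exists>T \<gamma>. is_geodesic F \<Omega> g (F 0) (dF 0 v) T \<gamma> \<and> t < T \<and> F (t *\<^sub>R v) = \<gamma> t"
    using T(1) by (intro exI[of _ T] exI[of _ "\<lambda>t. F (t *\<^sub>R v)"]) simp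
qed (use assms in \<open>auto simp: is_geodesic_iff\<close>)

text \<open>Convexity keeps the segment from \<open>0\<close> to \<open>x\<close> inside
  \<open>\<Omega>\<close>, and its image has constant speed \<open>norm x\<close>.\<close>

lemma riemannian_dist_le:
  assumes x: "x \<in> \<Omega>"
  shows "riemannian_dist M g (F 0) (F x) \<le> ennreal (norm x)"
  unfolding riemannian_dist_def
proof (rule INF_lower2)
  define c where "c t = F (t *\<^sub>R x)" for t
  have tx: "t *\<^sub>R x \<in> \<Omega>" if "t \<in> {0..1}" for t
    using ray_down[of 1 x t] x that by simp
  have c: "(c has_vector_derivative dF (t *\<^sub>R x) x) (at t)" if "t \<in> {0..1}" for t
    unfolding c_def using F_line_deriv tx[OF that] by simp
  have seg: "(\<lambda>t. t *\<^sub>R x) ` {0..1} \<subseteq> \<Omega>" using tx by auto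
  have lin: "continuous_on {0..1} (\<lambda>t. t *\<^sub>R x)" by (intro continuous_intros)
  have "\<forall>t\<in>{0..1}. h (t *\<^sub>R x) \<noteq> 0" using tx h_pos by force
  then have "continuous_on {0..1} (\<lambda>t. dF (t *\<^sub>R x) x)"
    unfolding dF_def
    by (intro continuous_intros continuous_on_compose2[OF continuous_D lin seg]
        continuous_on_compose2[OF continuous_h lin seg]) auto
  then have "c C1_differentiable_on {0..1}"
    unfolding C1_differentiable_on_def using c by (intro exI[of _ "\<lambda>t. dF (t *\<^sub>R x) x"]) simp
  then have "valid_path c" by (simp add: valid_path_def C1_differentiable_imp_piecewise)
  then show "c \<in> {c. valid_path c \<and> path_image c \<subseteq> M \<and> pathstart c = F 0 \<and> pathfinish c = F x}"
    using tx by (auto simp: path_image_def pathstart_def pathfinish_def c_def)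
  have "curve_length g c = (\<integral>\<^sup>+t. ennreal (norm x) * indicator {0..1::real} t \<partial>lborel)"
    unfolding curve_length_def
  proof (rule nn_integral_cong)
    fix t :: real
    show "ennreal (sqrt (g (c t) (vector_derivative c (at t)) (vector_derivative c (at t)))) * indicator {0..1} t
      = ennreal (norm x) * indicator {0..1} t"
    proof (cases "t \<in> {0..1}")
      case True
      have "g (c t) (vector_derivative c (at t)) (vector_derivative c (at t)) = x \<bullet> x"
        unfolding vector_derivative_at[OF c[OF True]] using g_dF[OF tx[OF True]] by (simp add: c_def)
      then show ?thesis by (simp add: norm_eq_sqrt_inner)
    qed simp
  qed
  then show "curve_length g c \<le> ennreal (norm x)" by (simp add: nn_integral_cmult_indicator)
qed

text \<open>The speed of a curve is at least the component of its chart velocity along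
  \<open>x\<close>, and that component integrates to \<open>norm x\<close>. The velocity may be
  unbounded near break points, so its integral is a gauge integral and has to be compared with a
  Lebesgue integral.\<close>

lemma riemannian_dist_ge:
  assumes x: "x \<in> \<Omega>"
  shows "ennreal (norm x) \<le> riemannian_dist M g (F 0) (F x)"
  unfolding riemannian_dist_def
proof (rule INF_greatest)
  fix c assume "c \<in> {c. valid_path c \<and> path_image c \<subseteq> M \<and> pathstart c = F 0 \<and> pathfinish c = F x}"
  then have vp: "valid_path c" and im: "\<And>t. t \<in> {0..1} \<Longrightarrow> c t \<in> M" and c0: "c 0 = F 0" and c1: "c 1 = F x"
    by (auto simp: path_image_def pathstart_def pathfinish_def)
  obtain S where S: "finite S" "c C1_differentiable_on ({0..1} - S)" and cont: "continuous_on {0..1} c"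
    using vp by (auto simp: valid_path_def piecewise_C1_differentiable_on_def)
  \<comment> \<open>The chart curve by its closed formula, from which differentiability can be read
    off.\<close>
  define \<gamma> where "\<gamma> t = snd (c t) /\<^sub>R fst (c t)" for t
  have ch: "chart F \<Omega> (c t) = \<gamma> t" "\<gamma> t \<in> \<Omega>" "c t = F (\<gamma> t)" if "t \<in> {0..1}" for t
    using chart_eq[OF im[OF that]] chart_in[OF im[OF that]] F_chart[OF im[OF that]] by (auto simp: \<gamma>_def)
  have fst_c: "fst (c t) \<noteq> 0" if "t \<in> {0..1}" for t
    using h_pos[OF ch(2)[OF that]] unfolding ch(3)[OF that] by (simp add: F_map_def)
  have \<gamma>_cont: "continuous_on {0..1} \<gamma>"
    unfolding \<gamma>_def[abs_def] using cont fst_c by (intro continuous_intros) auto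
  define w where "w t = vector_derivative \<gamma> (at t)" for t
  have \<gamma>_deriv: "(\<gamma> has_vector_derivative w t) (at t)"
    and c_deriv: "vector_derivative c (at t) = dF (\<gamma> t) (w t)" if t: "t \<in> {0<..<1} - S" for t
  proof -
    have t01: "t \<in> {0..1}" using t by auto
    have "c differentiable (at t)" using S(2) t unfolding C1_differentiable_on_eq by auto
    then have "\<gamma> differentiable (at t)" unfolding \<gamma>_def[abs_def]
      using fst_c[OF t01]
      by (intro differentiable_scaleR differentiable_inverse)
        (auto intro: bounded_linear.has_derivative[OF bounded_linear_fst] bounded_linear.has_derivative[OF bounded_linear_snd] simp: differentiable_def)
    then show 1: "(\<gamma> has_vector_derivative w t) (at t)" unfolding w_def using vector_derivative_works by blast
    have "((\<lambda>t. F (\<gamma> t)) has_vector_derivative dF (\<gamma> t) (w t)) (at t)"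
      using has_derivative_compose[OF 1[unfolded has_vector_derivative_def] F_deriv[OF ch(2)[OF t01]]]
      by (simp add: has_vector_derivative_def linear_cmul[OF linear_dF[OF ch(2)[OF t01]]])
    then have "(c has_vector_derivative dF (\<gamma> t) (w t)) (at t)"
      by (rule has_vector_derivative_transform_within_open[of _ _ _ "{0<..<1}"]) (use t ch in auto)
    then show "vector_derivative c (at t) = dF (\<gamma> t) (w t)" by (rule vector_derivative_at)
  qed
  \<comment> \<open>For \<open>x = 0\<close> this is the zero vector, hence only
    \<open>norm e \<le> 1\<close>.\<close>
  define e where "e = x /\<^sub>R norm x"
  have e: "norm e \<le> 1" "x \<bullet> e = norm x"
    by (cases "x = 0"; simp add: e_def dot_square_norm power2_eq_square)+
  have "(w has_integral (\<gamma> 1 - \<gamma> 0)) {0..1}"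
    using S(1) \<gamma>_cont \<gamma>_deriv by (intro fundamental_theorem_of_calculus_interior_strong[of S]) auto
  then have "((\<lambda>t. w t \<bullet> e) has_integral ((\<gamma> 1 - \<gamma> 0) \<bullet> e)) {0..1}"
    using has_integral_linear[OF _ bounded_linear_inner_left[of e]] by (force simp: o_def)
  moreover have "\<gamma> 1 = x" "\<gamma> 0 = 0" using ch(1)[of 0] ch(1)[of 1] c0 c1 x zero_\<Omega> by auto
  ultimately have int: "((\<lambda>t. w t \<bullet> e) has_integral norm x) {0..1}" using e by simp
  \<comment> \<open>The positive part turns the gauge integrand into one with a Lebesgue integral.
    It is measurable only for the completed measure.\<close>
  define k where "k t = max 0 (indicator {0..1} t * (w t \<bullet> e))" for t
  have [measurable]: "k \<in> borel_measurable lebesgue"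
    unfolding k_def[abs_def] using has_integral_implies_lebesgue_measurable[OF int] by simp
  have "(\<integral>\<^sup>+t. ennreal (k t) \<partial>lebesgue) \<le> curve_length g c"
    unfolding curve_length_def nn_integral_completion
  proof (rule nn_integral_mono_AE)
    have "AE t in lborel. t \<notin> S" using S(1) by (intro AE_not_in) (auto intro: finite_imp_null_set_lborel)
    then show "AE t in lborel. ennreal (k t) \<le> ennreal (sqrt (g (c t) (vector_derivative c (at t)) (vector_derivative c (at t)))) * indicator {0..1} t"
      using AE_lborel_singleton[of 0] AE_lborel_singleton[of 1]
    proof eventually_elim
      case (elim t)
      show ?case
      proof (cases "t \<in> {0..1}")
        case True
        then have t: "t \<in> {0<..<1} - S" using elim by auto
        have "g (c t) (vector_derivative c (at t)) (vector_derivative c (at t)) = w t \<bullet> w t"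
          unfolding c_deriv[OF t] ch(3)[OF True] by (rule g_dF[OF ch(2)[OF True]])
        moreover have "w t \<bullet> e \<le> norm (w t)"
          using norm_cauchy_schwarz[of "w t" e] mult_left_mono[OF e(1) norm_ge_zero[of "w t"]] by simp
        ultimately show ?thesis using True by (simp add: k_def norm_eq_sqrt_inner ennreal_leI)
      qed (simp add: k_def)
    qed
  qed
  moreover have "ennreal (norm x) \<le> (\<integral>\<^sup>+t. ennreal (k t) \<partial>lebesgue)"
  \<comment> \<open>If the integral is infinite there is nothing to show; if it is finite, it is
    also the gauge integral of \<open>k\<close>, and the two gauge integrals can be
    compared.\<close>
  proof (cases "(\<integral>\<^sup>+t. ennreal (k t) \<partial>lebesgue)")
    case (real r)
    then have k: "(k has_integral r) UNIV"
      by (subst has_integral_iff_nn_integral_lebesgue) (auto simp: k_def)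
    have "((\<lambda>t. if t \<in> {0..1} then w t \<bullet> e else 0) has_integral norm x) UNIV"
      using int by (simp only: has_integral_restrict_UNIV)
    from has_integral_le[OF this k] have "norm x \<le> r" by (auto simp: k_def)
    then show ?thesis using real by (simp add: ennreal_leI)
  qed simp
  ultimately show "ennreal (norm x) \<le> curve_length g c" by (rule order_trans[rotated])
qed

lemma riemannian_dist_eq: "x \<in> \<Omega> \<Longrightarrow> riemannian_dist M g (F 0) (F x) = ennreal (norm x)"
  by (intro antisym riemannian_dist_le riemannian_dist_ge)

text \<open>Every ray minimises as long as it stays in \<open>\<Omega>\<close>, so the cut time is
  the exit time. As a membership test this also covers rays that never leave.\<close>

lemma less_cut_time:
  assumes "0 \<le> t" "norm v = 1"
  shows "ereal t < cut_time F \<Omega> g (F 0) (dF 0 v) \<longleftrightarrow> t *\<^sub>R v \<in> \<Omega>"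
proof -
  have dist: "riemannian_dist M g (F 0) (max_geodesic F \<Omega> g (F 0) (dF 0 v) T) = ennreal T"
    if "0 \<le> T" "T *\<^sub>R v \<in> \<Omega>" for T
    using that assms by (simp add: max_geodesic_eq riemannian_dist_eq)
  show ?thesis
  proof
    assume "ereal t < cut_time F \<Omega> g (F 0) (dF 0 v)"
    then obtain T where "t < T" "ereal T < geodesic_end F \<Omega> g (F 0) (dF 0 v)"
      by (auto simp: cut_time_def less_Sup_iff)
    then show "t *\<^sub>R v \<in> \<Omega>" using less_geodesic_end[of T v] ray_down[of T v t] assms by simp
  next
    assume "t *\<^sub>R v \<in> \<Omega>"
    then obtain T where T: "t < T" "T *\<^sub>R v \<in> \<Omega>" using ray_right by blast
    then show "ereal t < cut_time F \<Omega> g (F 0) (dF 0 v)"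
      unfolding cut_time_def less_Sup_iff
      using assms less_geodesic_end[of T v] dist[of T] by (intro bexI[of _ "ereal T"]) auto
  qed
qed

section \<open>Weighted balls and their volume\<close>

definition arc :: "real^'n \<Rightarrow> real \<Rightarrow> real" where
  "arc v t = integral {0..t} (\<lambda>\<xi>. 1 / (h (\<xi> *\<^sub>R v))\<^sup>2)"

lemma reparam_eq:
  assumes "0 \<le> t" "t *\<^sub>R v \<in> \<Omega>" "CARD('n) \<ge> 2"
  shows "reparam F \<Omega> g f (F 0) (dF 0 v) t = arc v t"
  unfolding reparam_def arc_def
proof (rule integral_cong)
  fix \<xi> assume "\<xi> \<in> {0..t}"
  then have \<xi>: "0 \<le> \<xi>" "\<xi> *\<^sub>R v \<in> \<Omega>" using ray_down[OF assms(2)] by auto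
  have "exp (- (2 * ln (h (\<xi> *\<^sub>R v)))) = 1 / (h (\<xi> *\<^sub>R v))\<^sup>2"
    using h_pos[OF \<xi>(2)] by (simp add: exp_minus exp_double divide_inverse)
  then show "exp (- (2 * f (max_geodesic F \<Omega> g (F 0) (dF 0 v) \<xi>) / (real CARD('n) - 1))) = 1 / (h (\<xi> *\<^sub>R v))\<^sup>2"
    using assms(3) by (simp add: max_geodesic_eq \<xi> f_F)
qed

lemma weighted_ball_eq:
  assumes "CARD('n) \<ge> 2"
  shows "weighted_ball F \<Omega> g f r (F 0) = {F (t *\<^sub>R v) |v t. norm v = 1 \<and> 0 \<le> t \<and> t *\<^sub>R v \<in> \<Omega> \<and> arc v t < r}"
proof -
  have U: "unit_tangent_space F \<Omega> g (F 0) = dF 0 ` {v. norm v = 1}"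
    using zero_\<Omega> by (auto simp: unit_tangent_space_def tangent_space_F g_dF norm_eq_1)
  show ?thesis
    unfolding weighted_ball_def U
  proof (rule set_eqI, rule iffI)
    fix y assume "y \<in> {max_geodesic F \<Omega> g (F 0) \<theta> t |\<theta> t. \<theta> \<in> dF 0 ` {v. norm v = 1} \<and> 0 \<le> t \<and>
        ereal t < cut_time F \<Omega> g (F 0) \<theta> \<and> reparam F \<Omega> g f (F 0) \<theta> t < r}"
    then obtain v t where a: "norm v = 1" "0 \<le> t" "ereal t < cut_time F \<Omega> g (F 0) (dF 0 v)"
      "reparam F \<Omega> g f (F 0) (dF 0 v) t < r" "y = max_geodesic F \<Omega> g (F 0) (dF 0 v) t" by blast
    then have "t *\<^sub>R v \<in> \<Omega>" using less_cut_time by simp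
    with a show "y \<in> {F (t *\<^sub>R v) |v t. norm v = 1 \<and> 0 \<le> t \<and> t *\<^sub>R v \<in> \<Omega> \<and> arc v t < r}"
      using assms by (intro CollectI exI[of _ v] exI[of _ t]) (simp add: max_geodesic_eq reparam_eq)
  next
    fix y assume "y \<in> {F (t *\<^sub>R v) |v t. norm v = 1 \<and> 0 \<le> t \<and> t *\<^sub>R v \<in> \<Omega> \<and> arc v t < r}"
    then obtain v t where a: "norm v = 1" "0 \<le> t" "t *\<^sub>R v \<in> \<Omega>" "arc v t < r" "y = F (t *\<^sub>R v)" by blast
    then show "y \<in> {max_geodesic F \<Omega> g (F 0) \<theta> t |\<theta> t. \<theta> \<in> dF 0 ` {v. norm v = 1} \<and> 0 \<le> t \<and>
        ereal t < cut_time F \<Omega> g (F 0) \<theta> \<and> reparam F \<Omega> g f (F 0) \<theta> t < r}"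
      using assms by (intro CollectI exI[of _ "dF 0 v"] exI[of _ t]) (simp add: max_geodesic_eq reparam_eq less_cut_time)
  qed
qed

definition mvol :: "(real \<times> (real^'n)) measure" where
  "mvol = weighted_volume F \<Omega> (\<lambda>y. (real CARD('n) + 1) / (real CARD('n) - 1) * f y) g"

definition wball :: "real \<Rightarrow> (real \<times> (real^'n)) set" where
  "wball r = weighted_ball F \<Omega> g f r (F 0)"

lemma \<Omega>_borel [measurable]: "\<Omega> \<in> sets borel"
  using open_\<Omega> by simp

lemma F_continuous: "continuous_on \<Omega> F"
  using F_deriv has_derivative_continuous by (metis continuous_at_imp_continuous_on)

lemma F_measurable: "F \<in> restrict_space lborel \<Omega> \<rightarrow>\<^sub>M restrict_space borel M"
proof (rule measurable_restrict_space2)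
  show "F \<in> restrict_space lborel \<Omega> \<rightarrow>\<^sub>M borel"
    using borel_measurable_continuous_on_restrict[OF F_continuous]
    by (simp add: measurable_def space_restrict_space sets_restrict_space)
qed (auto simp: space_restrict_space)

lemma f_measurable: "f \<in> borel_measurable (restrict_space borel M)"
proof -
  have pos: "0 < fst y" if "y \<in> M" for y using that h_pos by (auto simp: F_map_def)
  have "continuous_on M (\<lambda>y. snd y /\<^sub>R fst y)"
    using pos by (intro continuous_intros) (metis less_irrefl)
  moreover have "(\<lambda>y. snd y /\<^sub>R fst y) ` M \<subseteq> \<Omega>" using chart_eq chart_in by force
  ultimately have "continuous_on M (\<lambda>y. h (snd y /\<^sub>R fst y))"
    using continuous_on_compose2[OF continuous_h] by blast
  moreover have "\<forall>y\<in>M. h (snd y /\<^sub>R fst y) \<noteq> 0"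
    using chart_eq chart_in h_pos by (metis less_irrefl)
  ultimately have "continuous_on M (\<lambda>y. (real CARD('n) - 1) * ln (h (snd y /\<^sub>R fst y)))"
    by (intro continuous_intros) auto
  moreover have "f y = (real CARD('n) - 1) * ln (h (snd y /\<^sub>R fst y))" if "y \<in> M" for y
    using f_F[OF chart_in[OF that]] F_chart[OF that] chart_eq[OF that] by simp
  ultimately have "continuous_on M f" by (simp cong: continuous_on_cong)
  then show ?thesis by (rule borel_measurable_continuous_on_restrict)
qed

lemma riemannian_volume_eq:
  "riemannian_volume F \<Omega> g = distr (restrict_space lborel \<Omega>) (restrict_space borel M) F"
proof -
  let ?K = "restrict_space lborel \<Omega>"
  have sq: "ennreal (sqrt (det (metric_matrix F g x))) = 1" if "x \<in> space ?K" for x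
    using that by (simp add: space_restrict_space metric_matrix_eq)
  have "density ?K (\<lambda>x. ennreal (sqrt (det (metric_matrix F g x)))) = density ?K (\<lambda>_. 1)"
  proof (rule density_cong)
    show "(\<lambda>x. ennreal (sqrt (det (metric_matrix F g x)))) \<in> borel_measurable ?K"
      by (subst measurable_cong[OF sq]) auto
  qed (use sq in auto)
  then show ?thesis by (simp add: riemannian_volume_def density_1)
qed

lemma sets_mvol: "sets mvol = sets (restrict_space borel M)"
  by (simp add: mvol_def weighted_volume_def riemannian_volume_eq)

lemma exp_f_F:
  assumes "CARD('n) \<ge> 2" "x \<in> \<Omega>"
  shows "exp (- ((real CARD('n) + 1) / (real CARD('n) - 1) * f (F x))) = 1 / h x ^ (CARD('n) + 1)"
proof -
  have "(real CARD('n) + 1) / (real CARD('n) - 1) * f (F x) = real (CARD('n) + 1) * ln (h x)"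
    using assms by (simp add: f_F)
  then show ?thesis
    using h_pos[OF assms(2)] by (simp only: exp_minus exp_of_nat_mult exp_ln inverse_eq_divide)
qed

text \<open>The indicator of \<open>\<Omega>\<close> makes the integrand Borel on the whole space,
  as polar coordinates require, although \<open>F\<close> is controlled only on
  \<open>\<Omega>\<close>.\<close>

lemma
  assumes n: "CARD('n) \<ge> 2" and A: "A \<in> sets mvol"
  shows emeasure_mvol: "emeasure mvol A = (\<integral>\<^sup>+x. indicator \<Omega> x * indicator A (F x) * ennreal (1 / h x ^ (CARD('n) + 1)) \<partial>lborel)"
    and mvol_integrand_measurable:
      "(\<lambda>x. indicator \<Omega> x * indicator A (F x) * ennreal (1 / h x ^ (CARD('n) + 1))) \<in> borel_measurable borel"
proof -
  let ?K = "restrict_space lborel \<Omega>" and ?B = "restrict_space borel M"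
  let ?w = "\<lambda>y. ennreal (exp (- ((real CARD('n) + 1) / (real CARD('n) - 1) * f y)))"
  have [measurable]: "F \<in> ?K \<rightarrow>\<^sub>M ?B" by (rule F_measurable)
  have [measurable]: "f \<in> borel_measurable ?B" by (rule f_measurable)
  have [measurable]: "A \<in> sets ?B" using A sets_mvol by simp
  have "emeasure mvol A = (\<integral>\<^sup>+y\<in>A. ?w y \<partial>distr ?K ?B F)"
    unfolding mvol_def weighted_volume_def riemannian_volume_eq by (intro emeasure_density) measurable
  also have "\<dots> = (\<integral>\<^sup>+x. ?w (F x) * indicator A (F x) \<partial>?K)"
    by (intro nn_integral_distr) measurable
  also have "\<dots> = (\<integral>\<^sup>+x. ?w (F x) * indicator A (F x) * indicator \<Omega> x \<partial>lborel)"
    by (intro nn_integral_restrict_space) simp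
  also have e: "(\<lambda>x. ?w (F x) * indicator A (F x) * indicator \<Omega> x)
      = (\<lambda>x. indicator \<Omega> x * indicator A (F x) * ennreal (1 / h x ^ (CARD('n) + 1)))"
  proof (rule ext)
    show "?w (F x) * indicator A (F x) * indicator \<Omega> x
      = indicator \<Omega> x * indicator A (F x) * ennreal (1 / h x ^ (CARD('n) + 1))" for x
    proof (cases "x \<in> \<Omega>")
      case True
      show ?thesis unfolding exp_f_F[OF n True] by (simp only: mult_ac)
    qed simp
  qed
  finally show "emeasure mvol A = (\<integral>\<^sup>+x. indicator \<Omega> x * indicator A (F x) * ennreal (1 / h x ^ (CARD('n) + 1)) \<partial>lborel)" .
  have "(\<lambda>x. ?w (F x) * indicator A (F x)) \<in> borel_measurable ?K" by measurable
  then have "(\<lambda>x. ?w (F x) * indicator A (F x) * indicator \<Omega> x) \<in> borel_measurable lborel"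
    by (subst (asm) borel_measurable_restrict_space_iff_ennreal) auto
  then show "(\<lambda>x. indicator \<Omega> x * indicator A (F x) * ennreal (1 / h x ^ (CARD('n) + 1))) \<in> borel_measurable borel"
    unfolding e by simp
qed

definition ray :: "real^'n \<Rightarrow> real set" where "ray v = {t. 0 \<le> t \<and> t *\<^sub>R v \<in> \<Omega>}"

text \<open>Written with \<open>wball\<close> rather than \<open>arc\<close>, so that measurability
  in the direction follows from that of the polar integrand. \<open>rayI_eq\<close> identifies it
  with the volume along the ray.\<close>

definition rayI :: "real^'n \<Rightarrow> real \<Rightarrow> ennreal" where
  "rayI v r = (\<integral>\<^sup>+t\<in>{0<..}. indicator \<Omega> (t *\<^sub>R v) * indicator (wball r) (F (t *\<^sub>R v))
      * ennreal (1 / h (t *\<^sub>R v) ^ (CARD('n) + 1)) * ennreal (t ^ (CARD('n) - 1)) \<partial>lborel)"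

lemma
  assumes n: "CARD('n) \<ge> 2" and A: "wball r \<in> sets mvol"
  shows emeasure_wball: "emeasure mvol (wball r) = ennreal (real CARD('n)) * (\<integral>\<^sup>+x\<in>ball 0 1. rayI (x /\<^sub>R norm x) r \<partial>lborel)"
    and rayI_measurable: "(\<lambda>x. rayI (x /\<^sub>R norm x) r) \<in> borel_measurable borel"
proof -
  note [measurable] = mvol_integrand_measurable[OF n A]
  show "emeasure mvol (wball r) = ennreal (real CARD('n)) * (\<integral>\<^sup>+x\<in>ball 0 1. rayI (x /\<^sub>R norm x) r \<partial>lborel)"
    unfolding emeasure_mvol[OF n A] rayI_def
    by (subst nn_integral_polar[OF mvol_integrand_measurable[OF n A]]) simp
  have "(\<lambda>(x, t). (\<lambda>x. indicator \<Omega> x * indicator (wball r) (F x) * ennreal (1 / h x ^ (CARD('n) + 1))) (t *\<^sub>R (x /\<^sub>R norm x))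
      * ennreal (t ^ (CARD('n) - 1)) * indicator {0<..} t) \<in> borel_measurable (borel \<Otimes>\<^sub>M lborel)"
    by measurable
  then show "(\<lambda>x. rayI (x /\<^sub>R norm x) r) \<in> borel_measurable borel"
    unfolding rayI_def by (intro lborel.borel_measurable_nn_integral) simp
qed

text \<open>Membership could be witnessed by another direction and time; injectivity of
  \<open>F\<close>, comparison of norms and \<open>0 < t\<close> force both to agree.\<close>

lemma F_in_wball:
  assumes n: "CARD('n) \<ge> 2" and "norm v = 1" "0 < t" "t *\<^sub>R v \<in> \<Omega>"
  shows "F (t *\<^sub>R v) \<in> wball r \<longleftrightarrow> arc v t < r"
proof
  assume "F (t *\<^sub>R v) \<in> wball r"
  then obtain w u where w: "norm w = 1" "0 \<le> u" "u *\<^sub>R w \<in> \<Omega>" "arc w u < r" "F (t *\<^sub>R v) = F (u *\<^sub>R w)"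
    unfolding wball_def weighted_ball_eq[OF n] by blast
  then have e: "t *\<^sub>R v = u *\<^sub>R w" using inj_F assms by (auto dest: inj_onD)
  then have "norm (t *\<^sub>R v) = norm (u *\<^sub>R w)" by simp
  then have "t = u" using assms w by simp
  then show "arc v t < r" using e w assms by simp
next
  assume "arc v t < r"
  then show "F (t *\<^sub>R v) \<in> wball r"
    unfolding wball_def weighted_ball_eq[OF n] using assms
    by (intro CollectI exI[of _ v] exI[of _ t]) simp
qed

end

section \<open>From total volumes to almost every ray\<close>

locale comparison_graph = positive_graph \<Omega> h
  for \<Omega> :: "(real^'n::finite) set" and h +
  fixes \<kappa> :: real
  assumes n2: "CARD('n) \<ge> 2"
    and hess: "x \<in> \<Omega> \<Longrightarrow> \<kappa> * (norm v)\<^sup>2 / h x ^ 3 \<le> D2 v v x"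
begin

lemma warped_ray:
  assumes "norm v = 1"
  shows "warped_ray (ray v) (\<lambda>t. h (t *\<^sub>R v)) (\<lambda>t. D v (t *\<^sub>R v)) (\<lambda>t. D2 v v (t *\<^sub>R v)) \<kappa> (CARD('n) - 1)"
proof
  fix t assume t: "t \<in> ray v"
  then have t': "0 \<le> t" "t *\<^sub>R v \<in> \<Omega>" by (auto simp: ray_def)
  show "\<exists>t'\<in>ray v. t < t'" using ray_right[OF t'(2)] t'(1) by (metis (mono_tags, lifting) mem_Collect_eq order.trans order_less_imp_le ray_def)
  show "((\<lambda>t. h (t *\<^sub>R v)) has_real_derivative D v (t *\<^sub>R v)) (at t)"
    using h_line_deriv[of 0 t v] t' by simp
  show "((\<lambda>t. D v (t *\<^sub>R v)) has_real_derivative D2 v v (t *\<^sub>R v)) (at t)"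
    using D_line_deriv[of 0 t v v] t' by simp
  show "\<kappa> / h (t *\<^sub>R v) ^ 3 \<le> D2 v v (t *\<^sub>R v)" using hess[OF t'(2), of v] assms by simp
qed (use zero_\<Omega> h_pos n2 ray_down in \<open>auto simp: ray_def\<close>)

definition rigid_dir :: "real^'n \<Rightarrow> bool" where
  "rigid_dir v \<longleftrightarrow> warped_ray.rigid (ray v) (\<lambda>t. h (t *\<^sub>R v)) \<kappa> (CARD('n) - 1)"

lemma s_eq_arc: "norm v = 1 \<Longrightarrow> warped_ray.s (\<lambda>t. h (t *\<^sub>R v)) = arc v"
  using warped_ray.s_def[OF warped_ray] by (intro ext) (simp add: arc_def)

lemma rayI_eq:
  assumes v: "norm v = 1"
  shows "rayI v r = warped_ray.I (ray v) (\<lambda>t. h (t *\<^sub>R v)) (CARD('n) - 1) r"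
proof -
  interpret W: warped_ray "ray v" "\<lambda>t. h (t *\<^sub>R v)" "\<lambda>t. D v (t *\<^sub>R v)" "\<lambda>t. D2 v v (t *\<^sub>R v)" \<kappa> "CARD('n) - 1"
    by (rule warped_ray[OF v])
  show ?thesis
    unfolding rayI_def W.I_def
  proof (rule nn_integral_cong)
    fix t :: real
    show "indicator \<Omega> (t *\<^sub>R v) * indicator (wball r) (F (t *\<^sub>R v)) * ennreal (1 / h (t *\<^sub>R v) ^ (CARD('n) + 1))
        * ennreal (t ^ (CARD('n) - 1)) * indicator {0<..} t = ennreal (W.p t) * indicator (W.E r) t"
    proof (cases "0 < t \<and> t *\<^sub>R v \<in> \<Omega>")
      case True
      have "CARD('n) - 1 + 2 = CARD('n) + 1" using n2 by simp
      then have "ennreal (1 / h (t *\<^sub>R v) ^ (CARD('n) + 1)) * ennreal (t ^ (CARD('n) - 1)) = ennreal (W.p t)"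
        unfolding W.p_def using True h_pos by (subst ennreal_mult[symmetric]) (auto simp: less_imp_le)
      moreover have "t \<in> W.E r \<longleftrightarrow> F (t *\<^sub>R v) \<in> wball r"
        using True F_in_wball[OF n2 v, of t r] unfolding W.E_def by (simp add: ray_def s_eq_arc[OF v])
      ultimately show ?thesis using True by (simp add: indicator_def)
    next
      case False
      then show ?thesis unfolding W.E_def by (auto simp: indicator_def ray_def)
    qed
  qed
qed

lemma model_volume_eq:
  assumes "norm (v :: real^'n) = 1" "0 < r" "ereal r < tau \<kappa>"
  shows "model_volume CARD('n) \<kappa> r = unit_sphere_vol CARD('n) * warped_ray.V \<kappa> (CARD('n) - 1) r"
proof -
  interpret W: warped_ray "ray v" "\<lambda>t. h (t *\<^sub>R v)" "\<lambda>t. D v (t *\<^sub>R v)" "\<lambda>t. D2 v v (t *\<^sub>R v)" \<kappa> "CARD('n) - 1"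
    by (rule warped_ray[OF assms(1)])
  have "integral {0..r} (\<lambda>\<xi>. sn_bar \<kappa> \<xi> ^ (CARD('n) - 1)) = W.V r"
    unfolding W.V_def
  proof (rule integral_cong)
    fix \<xi> assume "\<xi> \<in> {0..r}"
    then have "sn_bar \<kappa> \<xi> = sn \<kappa> \<xi>" using W.tau_less[of \<xi> r] assms by (intro sn_bar_eq_sn) auto
    then show "sn_bar \<kappa> \<xi> ^ (CARD('n) - 1) = sn \<kappa> \<xi> ^ (CARD('n) - 1)" by simp
  qed
  then show ?thesis by (simp add: model_volume_def)
qed

text \<open>\<open>I_ratio\<close> compares the integrands over all directions, and the volume
  hypothesis says that their finite integrals agree, so the integrands agree almost
  everywhere.\<close>

lemma AE_rigid:
  assumes ratio: "\<And>r R. 0 < r \<Longrightarrow> r < R \<Longrightarrow> ereal R < tau \<kappa> \<Longrightarrow>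
    emeasure mvol (wball R) / emeasure mvol (wball r) = ennreal (model_volume CARD('n) \<kappa> R / model_volume CARD('n) \<kappa> r)"
  shows "AE x in lborel. x \<in> ball 0 1 \<longrightarrow> rigid_dir (x /\<^sub>R norm x)"
proof -
  \<comment> \<open>An arbitrary direction gives access to the model volume \<open>V\<close>, which
    is common to all rays.\<close>
  obtain v0 :: "real^'n" where v0: "norm v0 = 1" using norm_axis_1 by blast
  interpret V: warped_ray "ray v0" "\<lambda>t. h (t *\<^sub>R v0)" "\<lambda>t. D v0 (t *\<^sub>R v0)" "\<lambda>t. D2 v0 v0 (t *\<^sub>R v0)" \<kappa> "CARD('n) - 1"
    by (rule warped_ray[OF v0])
  have Vpos: "0 < V.V r" if "0 < r" "ereal r < tau \<kappa>" for r using V.V_less[OF order.refl, unfolded V.V_0] that by blast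
  have sph: "0 < unit_sphere_vol CARD('n)" using n2 by (simp add: unit_sphere_vol_def)
  define Mv where "Mv r = emeasure mvol (wball r)" for r
  define a where "a r = (\<integral>\<^sup>+x\<in>ball 0 1. rayI (x /\<^sub>R norm x) r \<partial>lborel)" for r
  have ratio': "Mv R / Mv r = ennreal (V.V R / V.V r)" "0 < V.V R / V.V r" if "0 < r" "r < R" "ereal R < tau \<kappa>" for r R
  proof -
    have r: "ereal r < tau \<kappa>" using V.tau_less[of r R] that by simp
    show "Mv R / Mv r = ennreal (V.V R / V.V r)"
      unfolding Mv_def ratio[OF that] using sph that r
      by (simp add: model_volume_eq[OF v0])
    show "0 < V.V R / V.V r" using Vpos[of r] Vpos[of R] that r by simp
  qed
  have Mfin: "0 < Mv r" "Mv r < \<infinity>" if r: "0 < r" "ereal r < tau \<kappa>" for r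
  proof -
    \<comment> \<open>A larger radius puts \<open>Mv r\<close> into the denominator of the
      hypothesis.\<close>
    obtain R where R: "r < R" "ereal R < tau \<kappa>" using V.tau_room[OF r(2)] by blast
    show "0 < Mv r" "Mv r < \<infinity>"
      using ennreal_divide_eq_posD[OF ratio'(1) ratio'(2)] r R by blast+
  qed
  \<comment> \<open>Measurability of the balls comes from the hypothesis: \<open>emeasure\<close> is
    \<open>0\<close> on nonmeasurable sets, but these values are positive.\<close>
  have sets: "wball r \<in> sets mvol" if "0 < r" "ereal r < tau \<kappa>" for r
    using Mfin(1)[OF that] emeasure_notin_sets[of "wball r" mvol] unfolding Mv_def by force
  have Ma: "Mv r = ennreal (real CARD('n)) * a r" if "0 < r" "ereal r < tau \<kappa>" for r
    unfolding Mv_def a_def by (rule emeasure_wball[OF n2 sets[OF that]])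
  have meas: "(\<lambda>x. rayI (x /\<^sub>R norm x) r * indicator (ball 0 1) x) \<in> borel_measurable lborel"
    if "0 < r" "ereal r < tau \<kappa>" for r
    using rayI_measurable[OF n2 sets[OF that]]
    by (auto intro!: borel_measurable_times_ennreal borel_measurable_indicator)
  have afin: "a r < \<infinity>" if "0 < r" "ereal r < tau \<kappa>" for r
    using Mfin(2)[OF that] unfolding Ma[OF that] by (auto simp: ennreal_mult_less_top)
  have aeq: "a R * ennreal (V.V r) = a r * ennreal (V.V R)" if "0 < r" "r < R" "ereal R < tau \<kappa>" for r R
  proof -
    have r: "ereal r < tau \<kappa>" using V.tau_less[of r R] that by simp
    have "Mv R * ennreal (V.V r) = ennreal (V.V R / V.V r) * Mv r * ennreal (V.V r)"
      using ennreal_divide_eq_posD(3)[OF ratio'[OF that]] by simp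
    also have "\<dots> = Mv r * (ennreal (V.V R / V.V r) * ennreal (V.V r))" by (simp add: mult_ac)
    also have "ennreal (V.V R / V.V r) * ennreal (V.V r) = ennreal (V.V R)"
      using Vpos[of r] Vpos[of R] that r by (subst ennreal_mult[symmetric]) auto
    finally have "ennreal (real CARD('n)) * (a R * ennreal (V.V r)) = ennreal (real CARD('n)) * (a r * ennreal (V.V R))"
      using Ma[of r] Ma[of R] that r by (simp add: mult_ac)
    then show ?thesis by (subst (asm) ennreal_mult_cancel_left) auto
  qed
  have nz: "AE x in lborel. x \<noteq> (0::real^'n)" by (rule AE_lborel_singleton)
  have AEeq: "AE x in lborel. x \<in> ball 0 1 \<longrightarrow> rayI (x /\<^sub>R norm x) R * ennreal (V.V r) = rayI (x /\<^sub>R norm x) r * ennreal (V.V R)"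
    if rR: "0 < r" "r < R" "ereal R < tau \<kappa>" for r R
  proof -
    have r: "ereal r < tau \<kappa>" using V.tau_less[of r R] rR by simp
    have R: "0 < R" using rR by simp
    have "AE x in lborel. rayI (x /\<^sub>R norm x) R * indicator (ball 0 1) x * ennreal (V.V r)
        = rayI (x /\<^sub>R norm x) r * indicator (ball 0 1) x * ennreal (V.V R)"
    proof (rule nn_integral_eq_imp_AE_eq)
      show "AE x in lborel. rayI (x /\<^sub>R norm x) R * indicator (ball 0 1) x * ennreal (V.V r)
        \<le> rayI (x /\<^sub>R norm x) r * indicator (ball 0 1) x * ennreal (V.V R)"
        using nz
      proof eventually_elim
        case (elim x)
        then have v: "norm (x /\<^sub>R norm x) = 1" by simp
        interpret W: warped_ray "ray (x /\<^sub>R norm x)" "\<lambda>t. h (t *\<^sub>R (x /\<^sub>R norm x))"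
          "\<lambda>t. D (x /\<^sub>R norm x) (t *\<^sub>R (x /\<^sub>R norm x))"
          "\<lambda>t. D2 (x /\<^sub>R norm x) (x /\<^sub>R norm x) (t *\<^sub>R (x /\<^sub>R norm x))" \<kappa> "CARD('n) - 1"
          by (rule warped_ray[OF v])
        show ?case
          using W.I_ratio[OF rR] unfolding rayI_eq[OF v] by (simp add: indicator_def)
      qed
      have 1: "(\<integral>\<^sup>+x. rayI (x /\<^sub>R norm x) R * indicator (ball 0 1) x * ennreal (V.V r) \<partial>lborel) = a R * ennreal (V.V r)"
        unfolding a_def using R rR by (intro nn_integral_multc meas)
      have 2: "(\<integral>\<^sup>+x. rayI (x /\<^sub>R norm x) r * indicator (ball 0 1) x * ennreal (V.V R) \<partial>lborel) = a r * ennreal (V.V R)"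
        unfolding a_def using r rR by (intro nn_integral_multc meas)
      show "(\<integral>\<^sup>+x. rayI (x /\<^sub>R norm x) R * indicator (ball 0 1) x * ennreal (V.V r) \<partial>lborel)
        = (\<integral>\<^sup>+x. rayI (x /\<^sub>R norm x) r * indicator (ball 0 1) x * ennreal (V.V R) \<partial>lborel)"
        unfolding 1 2 by (rule aeq[OF rR])
      show "(\<integral>\<^sup>+x. rayI (x /\<^sub>R norm x) R * indicator (ball 0 1) x * ennreal (V.V r) \<partial>lborel) < \<infinity>"
        unfolding 1 using afin[OF R rR(3)] by (simp add: ennreal_mult_less_top)
      show "(\<lambda>x. rayI (x /\<^sub>R norm x) R * indicator (ball 0 1) x * ennreal (V.V r)) \<in> borel_measurable lborel"
        "(\<lambda>x. rayI (x /\<^sub>R norm x) r * indicator (ball 0 1) x * ennreal (V.V R)) \<in> borel_measurable lborel"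
        using meas[OF rR(1) r] meas[OF R rR(3)] by (auto intro!: borel_measurable_times_ennreal)
    qed
    then show ?thesis by eventually_elim (auto simp: indicator_def)
  qed
  have AEfin: "AE x in lborel. x \<in> ball 0 1 \<longrightarrow> rayI (x /\<^sub>R norm x) r < \<infinity>" if r: "0 < r" "ereal r < tau \<kappa>" for r
  proof -
    have "AE x in lborel. rayI (x /\<^sub>R norm x) r * indicator (ball 0 1) x \<noteq> \<infinity>"
      using afin[OF r] unfolding a_def by (intro nn_integral_PInf_AE meas[OF r]) auto
    then show ?thesis by eventually_elim (auto simp: indicator_def less_top)
  qed
  \<comment> \<open>The exceptional null set depends on the radii; restricting these to the
    rationals leaves a countable union.\<close>
  have "AE x in lborel. \<forall>r\<in>\<rat>. 0 < r \<and> ereal r < tau \<kappa> \<longrightarrow> x \<in> ball 0 1 \<longrightarrow> rayI (x /\<^sub>R norm x) r < \<infinity>"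
    using AEfin by (subst AE_ball_countable[OF countable_rat]) auto
  moreover have "AE x in lborel. \<forall>r\<in>\<rat>. \<forall>R\<in>\<rat>. 0 < r \<and> r < R \<and> ereal R < tau \<kappa> \<longrightarrow> x \<in> ball 0 1 \<longrightarrow>
      rayI (x /\<^sub>R norm x) R * ennreal (V.V r) = rayI (x /\<^sub>R norm x) r * ennreal (V.V R)"
    using AEeq by (subst AE_ball_countable[OF countable_rat] | intro ballI)+ auto
  ultimately show ?thesis
    using nz
  proof eventually_elim
    case (elim x)
    show ?case
    proof
      assume x: "x \<in> ball 0 1"
      define v where "v = x /\<^sub>R norm x"
      have v: "norm v = 1" using elim(3) by (simp add: v_def)
      interpret W: warped_ray "ray v" "\<lambda>t. h (t *\<^sub>R v)" "\<lambda>t. D v (t *\<^sub>R v)"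
          "\<lambda>t. D2 v v (t *\<^sub>R v)" \<kappa> "CARD('n) - 1"
        by (rule warped_ray[OF v])
      have fin: "W.I r < \<infinity>" if r: "0 < r" "ereal r < tau \<kappa>" for r
      proof -
        \<comment> \<open>Finiteness at a real radius is inherited from a larger rational one by
          monotonicity of \<open>I\<close>.\<close>
        obtain R where R: "r < R" "R \<in> \<rat>" "ereal R < tau \<kappa>" using V.tau_room[OF r(2)] by blast
        have "0 < R" using R r by simp
        then have "rayI v R < \<infinity>" using elim(1)[folded v_def] R x by blast
        then have "W.I R < \<infinity>" unfolding rayI_eq[OF v] .
        moreover have "W.I r \<le> W.I R" using W.I_split[of r R] R by simp
        ultimately show ?thesis by (rule order_le_less_trans[rotated])
      qed
      have eq: "W.I R * ennreal (W.V r) = W.I r * ennreal (W.V R)"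
        if "r \<in> \<rat>" "R \<in> \<rat>" "0 < r" "r < R" "ereal R < tau \<kappa>" for r R
        using elim(2) that x unfolding v_def[symmetric] rayI_eq[OF v] by blast
      show "rigid_dir (x /\<^sub>R norm x)"
        unfolding rigid_dir_def v_def[symmetric] W.rigid_def using fin eq by blast
    qed
  qed
qed

text \<open>The points of the punctured ball whose direction is close to that of \<open>y\<close>
  form a nonempty open set, which cannot lie in the exceptional null set.\<close>

lemma rigid_dense:
  assumes AE: "AE x in lborel. x \<in> ball 0 1 \<longrightarrow> rigid_dir (x /\<^sub>R norm x)" and "y \<noteq> 0" "0 < e"
  obtains v where "norm v = 1" "rigid_dir v" "dist (norm y *\<^sub>R v) y < e"
proof -
  define U where "U = {x. x \<in> ball 0 1 \<and> x \<noteq> 0} \<inter> {x. x \<noteq> 0 \<and> dist (norm y *\<^sub>R (x /\<^sub>R norm x)) y < e}"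
  have "open {x. x \<noteq> 0 \<and> dist (norm y *\<^sub>R (x /\<^sub>R norm x)) y < e}"
  proof -
    have "continuous_on (- {0}) (\<lambda>x. dist (norm y *\<^sub>R (x /\<^sub>R norm x)) y)"
      by (intro continuous_intros) auto
    then have "open (- {0} \<inter> (\<lambda>x. dist (norm y *\<^sub>R (x /\<^sub>R norm x)) y) -` {..<e})"
      by (intro continuous_open_preimage) auto
    also have "- {0} \<inter> (\<lambda>x. dist (norm y *\<^sub>R (x /\<^sub>R norm x)) y) -` {..<e}
        = {x. x \<noteq> 0 \<and> dist (norm y *\<^sub>R (x /\<^sub>R norm x)) y < e}" by auto
    finally show ?thesis .
  qed
  moreover have "{x. x \<in> ball 0 1 \<and> x \<noteq> (0::real^'n)} = ball 0 1 \<inter> - {0}" by auto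
  ultimately have "open U" unfolding U_def by auto
  moreover have "(1 / 2) *\<^sub>R (y /\<^sub>R norm y) \<in> U"
    using assms(2,3) by (simp add: U_def)
  ultimately have "\<not> negligible U" using open_not_negligible by blast
  then have "U \<notin> null_sets lborel"
    using negligible_iff_null_sets null_sets_completionI by blast
  have "\<not> (AE x in lborel. x \<notin> U)"
    using \<open>U \<notin> null_sets lborel\<close> \<open>open U\<close> AE_iff_null_sets[of U lborel] by simp
  moreover have "AE x in lborel. x \<notin> U" if "\<forall>x\<in>U. \<not> rigid_dir (x /\<^sub>R norm x)"
    using AE by eventually_elim (use that in \<open>auto simp: U_def\<close>)
  ultimately obtain x where "x \<in> U" "rigid_dir (x /\<^sub>R norm x)" by blast
  then show ?thesis using that[of "x /\<^sub>R norm x"] by (auto simp: U_def)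
qed

end

section \<open>Rigidity\<close>

text \<open>For \<open>\<kappa> > 0\<close> the integral is
  \<open>arctan (sqrt \<kappa> * t / c^2) / sqrt \<kappa>\<close>, and the bound
  \<open>pi / 2\<close> on \<open>arctan\<close> is the origin of \<open>tau\<close>. The constant
  \<open>c\<close> will be \<open>h 0\<close>.\<close>

lemma model_arc_less_tau:
  assumes "0 \<le> t" "0 < c"
  shows "ereal (integral {0..t} (\<lambda>\<xi>. 1 / (c\<^sup>2 + \<kappa> * \<xi>\<^sup>2 / c\<^sup>2))) < tau \<kappa>"
proof (cases "\<kappa> > 0")
  case True
  define F where "F \<xi> = arctan (sqrt \<kappa> / c\<^sup>2 * \<xi>) / sqrt \<kappa>" for \<xi>
  have "((\<lambda>\<xi>. 1 / (c\<^sup>2 + \<kappa> * \<xi>\<^sup>2 / c\<^sup>2)) has_integral F t - F 0) {0..t}"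
  proof (rule fundamental_theorem_of_calculus[OF assms(1)])
    fix \<xi> assume "\<xi> \<in> {0..t}"
    have "(F has_real_derivative inverse (1 + (sqrt \<kappa> / c\<^sup>2 * \<xi>)\<^sup>2) * (sqrt \<kappa> / c\<^sup>2) / sqrt \<kappa>) (at \<xi>)"
      unfolding F_def by (rule DERIV_cdivide[OF DERIV_chain2[OF DERIV_arctan DERIV_cmult_Id]])
    moreover have "inverse (1 + (sqrt \<kappa> / c\<^sup>2 * \<xi>)\<^sup>2) * (sqrt \<kappa> / c\<^sup>2) / sqrt \<kappa> = 1 / (c\<^sup>2 + \<kappa> * \<xi>\<^sup>2 / c\<^sup>2)"
    proof -
      have "(sqrt \<kappa> / c\<^sup>2 * \<xi>)\<^sup>2 = \<kappa> * \<xi>\<^sup>2 / (c\<^sup>2)\<^sup>2" using True by (simp add: power_mult_distrib power_divide)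
      then have "c\<^sup>2 * (1 + (sqrt \<kappa> / c\<^sup>2 * \<xi>)\<^sup>2) = c\<^sup>2 + \<kappa> * \<xi>\<^sup>2 / c\<^sup>2"
        using assms(2) by (simp add: distrib_left power2_eq_square)
      then have "1 / (c\<^sup>2 + \<kappa> * \<xi>\<^sup>2 / c\<^sup>2) = 1 / (c\<^sup>2 * (1 + (sqrt \<kappa> / c\<^sup>2 * \<xi>)\<^sup>2))" by simp
      also have "\<dots> = inverse (1 + (sqrt \<kappa> / c\<^sup>2 * \<xi>)\<^sup>2) * (sqrt \<kappa> / c\<^sup>2) / sqrt \<kappa>"
        using True by (simp add: divide_inverse)
      finally show ?thesis by simp
    qed
    ultimately show "(F has_vector_derivative 1 / (c\<^sup>2 + \<kappa> * \<xi>\<^sup>2 / c\<^sup>2)) (at \<xi> within {0..t})"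
      by (auto simp: has_real_derivative_iff_has_vector_derivative[symmetric] intro: has_field_derivative_at_within)
  qed
  then have "integral {0..t} (\<lambda>\<xi>. 1 / (c\<^sup>2 + \<kappa> * \<xi>\<^sup>2 / c\<^sup>2)) = arctan (sqrt \<kappa> / c\<^sup>2 * t) / sqrt \<kappa>"
    by (simp add: integral_unique F_def)
  also have "\<dots> < (pi / 2) / sqrt \<kappa>"
    using True arctan_ubound by (intro divide_strict_right_mono) auto
  finally show ?thesis using True by (simp add: tau_def)
qed (simp add: tau_def)

lemma quadratic_pos_mono:
  fixes \<kappa> c :: real
  assumes "0 < c\<^sup>2 + \<kappa> * t\<^sup>2 / c\<^sup>2" "0 \<le> u" "u \<le> t" "c \<noteq> 0"
  shows "0 < c\<^sup>2 + \<kappa> * u\<^sup>2 / c\<^sup>2"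
proof (cases "\<kappa> \<ge> 0")
  case True
  then show ?thesis using assms(4) by (intro add_pos_nonneg) auto
next
  case False
  have "u\<^sup>2 \<le> t\<^sup>2" using assms by (intro power_mono) auto
  then have "\<kappa> * t\<^sup>2 / c\<^sup>2 \<le> \<kappa> * u\<^sup>2 / c\<^sup>2"
    using False by (intro divide_right_mono mult_left_mono_neg) auto
  then show ?thesis using assms(1) by linarith
qed

locale rigid_graph = comparison_graph \<Omega> h \<kappa>
  for \<Omega> :: "(real^'n::finite) set" and h :: "real^'n \<Rightarrow> real" and \<kappa> :: real +
  assumes rigid: "AE x in lborel. x \<in> ball 0 1 \<longrightarrow> rigid_dir (x /\<^sub>R norm x)"
begin

lemma h0: "0 < h 0"
  using h_pos zero_\<Omega> by simp

text \<open>Continuity together with density of the rigid directions on the sphere through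
  \<open>x\<close>; it carries identities from rigid rays to all of \<open>\<Omega>\<close>.\<close>

lemma dense_zero:
  fixes P :: "real^'n \<Rightarrow> real"
  assumes "isCont P x" "x \<in> \<Omega>" "x \<noteq> 0"
    and "\<And>v. norm v = 1 \<Longrightarrow> rigid_dir v \<Longrightarrow> norm x *\<^sub>R v \<in> \<Omega> \<Longrightarrow> P (norm x *\<^sub>R v) = 0"
  shows "P x = 0"
proof (rule ccontr)
  assume "P x \<noteq> 0"
  then obtain d where d: "0 < d" "\<And>z. dist z x < d \<Longrightarrow> P z \<noteq> 0"
    using continuous_at_avoid[OF assms(1), of 0] by (auto simp: dist_commute)
  obtain e where e: "0 < e" "ball x e \<subseteq> \<Omega>" using open_\<Omega> assms(2) open_contains_ball by blast
  obtain v where v: "norm v = 1" "rigid_dir v" "dist (norm x *\<^sub>R v) x < min d e"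
    using rigid_dense[OF rigid assms(3), of "min d e"] d e by auto
  have "norm x *\<^sub>R v \<in> \<Omega>" using v(3) e(2) by (auto simp: dist_commute subset_iff)
  then show False using assms(4)[OF v(1,2)] d(2)[of "norm x *\<^sub>R v"] v(3) by simp
qed

text \<open>The bound on \<open>arc\<close> is discharged by \<open>arc_less_tau\<close>, whose
  proof requires the gradient at \<open>0\<close> to vanish; until then only a neighbourhood of
  \<open>0\<close> is available.\<close>

lemma h_ray:
  assumes "norm v = 1" "rigid_dir v" "0 \<le> t" "t *\<^sub>R v \<in> \<Omega>" "ereal (arc v t) < tau \<kappa>"
  shows "(h (t *\<^sub>R v))\<^sup>2 = (h 0 + D v 0 * t)\<^sup>2 + \<kappa> * t\<^sup>2 / (h 0)\<^sup>2"
proof -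
  interpret W: warped_ray "ray v" "\<lambda>t. h (t *\<^sub>R v)" "\<lambda>t. D v (t *\<^sub>R v)" "\<lambda>t. D2 v v (t *\<^sub>R v)" \<kappa> "CARD('n) - 1"
    by (rule warped_ray[OF assms(1)])
  have "W.rigid" using assms(2) by (simp only: rigid_dir_def)
  moreover have "t \<in> ray v" using assms by (simp add: ray_def)
  ultimately show ?thesis using W.rigid_H[of t] assms(5) unfolding s_eq_arc[OF assms(1)] by simp
qed

lemma isCont_h: "x \<in> \<Omega> \<Longrightarrow> isCont h x"
  using continuous_h open_\<Omega> continuous_on_eq_continuous_at by blast

lemma isCont_D0: "isCont (\<lambda>z. D z 0) x"
  using linear_D[OF zero_\<Omega>] by (simp add: linear_continuous_at linear_conv_bounded_linear)

text \<open>Near \<open>0\<close> the parameter \<open>arc\<close> is below \<open>tau\<close>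
  uniformly in the direction, because \<open>1 / h^2\<close> is bounded on a compact ball.\<close>

lemma h_near_zero:
  obtains \<epsilon> where "0 < \<epsilon>" "ball 0 \<epsilon> \<subseteq> \<Omega>"
    "\<And>x. x \<in> ball 0 \<epsilon> \<Longrightarrow> (h x)\<^sup>2 = (h 0 + D x 0)\<^sup>2 + \<kappa> * (norm x)\<^sup>2 / (h 0)\<^sup>2"
proof -
  obtain e1 where e1: "0 < e1" "cball 0 e1 \<subseteq> \<Omega>" using open_\<Omega> zero_\<Omega> open_contains_cball by blast
  have "\<forall>x\<in>cball 0 e1. h x \<noteq> 0" using e1(2) h_pos by (metis less_irrefl subsetD)
  then have c: "continuous_on (cball 0 e1) (\<lambda>x. 1 / (h x)\<^sup>2)"
    by (intro continuous_intros continuous_on_subset[OF continuous_h e1(2)]) auto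
  then have "bounded ((\<lambda>x. 1 / (h x)\<^sup>2) ` cball 0 e1)"
    by (intro compact_imp_bounded compact_continuous_image) auto
  then obtain B where B: "0 < B" "\<And>x. x \<in> cball 0 e1 \<Longrightarrow> 1 / (h x)\<^sup>2 \<le> B"
    unfolding bounded_pos by (auto simp: abs_le_iff)
  obtain r0 where r0: "0 < r0" "ereal r0 < tau \<kappa>" using tau_pos by blast
  \<comment> \<open>Times below \<open>r0 / B\<close> give \<open>arc\<close> below
    \<open>r0\<close>, because the integrand is at most \<open>B\<close>.\<close>
  define \<epsilon> where "\<epsilon> = min e1 (r0 / B)"
  have \<epsilon>: "0 < \<epsilon>" "\<epsilon> \<le> e1" "\<epsilon> \<le> r0 / B" using e1 r0 B by (auto simp: \<epsilon>_def)
  have sub: "ball 0 \<epsilon> \<subseteq> \<Omega>" using e1(2) \<epsilon> by (auto simp: subset_iff)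
  have small: "ereal (arc v t) < tau \<kappa>" if v: "norm v = 1" and t: "0 \<le> t" "t < \<epsilon>" for v t
  proof -
    have in1: "\<xi> *\<^sub>R v \<in> cball 0 e1" if "\<xi> \<in> {0..t}" for \<xi> using that v t \<epsilon> by simp
    have "continuous_on {0..t} (\<lambda>\<xi>. 1 / (h (\<xi> *\<^sub>R v))\<^sup>2)"
      by (rule continuous_on_compose2[OF c]) (use in1 in \<open>auto intro!: continuous_intros\<close>)
    then have "arc v t \<le> integral {0..t} (\<lambda>_. B)"
      unfolding arc_def using B(2) in1
      by (intro integral_le integrable_continuous_interval) auto
    also have "\<dots> = t * B" using t by simp
    also have "\<dots> < \<epsilon> * B" using t B(1) by simp
    also have "\<dots> \<le> r0" using \<epsilon>(3) B(1) by (simp add: field_simps)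
    finally show ?thesis using r0(2) by (simp add: order.strict_trans[of _ "ereal r0"])
  qed
  show ?thesis
  proof (rule that[OF \<epsilon>(1) sub])
    fix x :: "real^'n" assume x: "x \<in> ball 0 \<epsilon>"
    show "(h x)\<^sup>2 = (h 0 + D x 0)\<^sup>2 + \<kappa> * (norm x)\<^sup>2 / (h 0)\<^sup>2"
    proof (cases "x = 0")
      case True
      then show ?thesis using linear_0[OF linear_D[OF zero_\<Omega>]] by simp
    next
      case False
      define P where "P z = (h z)\<^sup>2 - ((h 0 + D z 0)\<^sup>2 + \<kappa> * (norm z)\<^sup>2 / (h 0)\<^sup>2)" for z
      have "P x = 0"
      proof (rule dense_zero[OF _ _ False])
        show "isCont P x" unfolding P_def using x sub h0 isCont_h isCont_D0
          by (intro continuous_intros) auto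
        fix v assume v: "norm v = 1" "rigid_dir v" "norm x *\<^sub>R v \<in> \<Omega>"
        have "D (norm x *\<^sub>R v) 0 = D v 0 * norm x"
          using linear_cmul[OF linear_D[OF zero_\<Omega>], of "norm x" v] by (simp add: mult_ac)
        then show "P (norm x *\<^sub>R v) = 0"
          using h_ray[OF v(1,2) _ v(3) small[OF v(1)]] x v(1) by (simp add: P_def)
      qed (use x sub in auto)
      then show ?thesis by (simp add: P_def)
    qed
  qed
qed

section \<open>Vanishing of the gradient at the base point\<close>

text \<open>Let \<open>b\<close> be the gradient at \<open>0\<close> and \<open>u\<close> orthogonal
  to it. The local formula determines the second derivative along \<open>u\<close> at
  \<open>e b\<close>, and the Hessian bound there says
  \<open>\<kappa> (h 0)^2 \<le> \<kappa> (h (e b))^2\<close>. So \<open>e = 0\<close> is a local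
  minimum of the right-hand side, whose derivative at \<open>0\<close> is
  \<open>2 \<kappa> h(0) |b|^2\<close>.\<close>

lemma grad_zero_curved:
  assumes "\<kappa> \<noteq> 0"
  shows "D v 0 = 0"
proof -
  obtain \<epsilon> where \<epsilon>: "0 < \<epsilon>" "ball 0 \<epsilon> \<subseteq> \<Omega>"
    "\<And>x. x \<in> ball 0 \<epsilon> \<Longrightarrow> (h x)\<^sup>2 = (h 0 + D x 0)\<^sup>2 + \<kappa> * (norm x)\<^sup>2 / (h 0)\<^sup>2"
    using h_near_zero by blast
  define b where "b = adjoint (\<lambda>v. D v 0) 1"
  have b: "D x 0 = x \<bullet> b" for x
    using adjoint_works[OF linear_D[OF zero_\<Omega>], of x 1] by (simp add: b_def)
  \<comment> \<open>The dimension bound enters here: a nonzero vector orthogonal to the gradient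
    exists.\<close>
  obtain u where u: "u \<noteq> 0" "orthogonal b u"
    using orthogonal_to_vector_exists[of b] n2 by auto
  define N where "N = b \<bullet> b"
  have ge: "\<kappa> * (h 0)\<^sup>2 \<le> \<kappa> * (h (e *\<^sub>R b))\<^sup>2" if e: "e *\<^sub>R b \<in> ball 0 \<epsilon>" for e
  proof -
    define C where "C = \<kappa> * (norm u)\<^sup>2 / (h 0)\<^sup>2"
    define y where "y t = h (e *\<^sub>R b + t *\<^sub>R u)" for t
    have "open ((\<lambda>t. e *\<^sub>R b + t *\<^sub>R u) -` ball 0 \<epsilon>)" by (intro open_vimage open_ball continuous_intros)
    moreover have "0 \<in> (\<lambda>t. e *\<^sub>R b + t *\<^sub>R u) -` ball 0 \<epsilon>" using e by simp
    ultimately obtain d where d: "0 < d" "ball 0 d \<subseteq> (\<lambda>t. e *\<^sub>R b + t *\<^sub>R u) -` ball 0 \<epsilon>"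
      using open_contains_ball by metis
    have inb: "e *\<^sub>R b + t *\<^sub>R u \<in> ball 0 \<epsilon>" if "t \<in> {-d<..<d}" for t
      using d(2) that by (auto simp: subset_iff dist_real_def)
    have in\<Omega>: "e *\<^sub>R b + t *\<^sub>R u \<in> \<Omega>" if "t \<in> {-d<..<d}" for t using inb[OF that] \<epsilon>(2) by auto
    have ypos: "0 < y t" if "t \<in> {-d<..<d}" for t using h_pos[OF in\<Omega>[OF that]] by (simp add: y_def)
    have Dy: "(y has_real_derivative D u (e *\<^sub>R b + t *\<^sub>R u)) (at t)" if "t \<in> {-d<..<d}" for t
      unfolding y_def by (rule h_line_deriv[OF in\<Omega>[OF that]])
    \<comment> \<open>Moving along \<open>u\<close> leaves the linear term unchanged, so
      \<open>h^2\<close> is \<open>C t^2\<close> plus a constant; differentiating twice at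
      \<open>t = 0\<close> gives \<open>h D2 h = C\<close>.\<close>
    have ysq: "(y t)\<^sup>2 = (h 0 + e * N)\<^sup>2 + \<kappa> * e\<^sup>2 * N / (h 0)\<^sup>2 + C * t\<^sup>2" if "t \<in> {-d<..<d}" for t
    proof -
      have "D (e *\<^sub>R b + t *\<^sub>R u) 0 = e * N"
        using u(2) by (simp add: b N_def inner_add_left inner_add_right orthogonal_def inner_commute)
      moreover have "(norm (e *\<^sub>R b + t *\<^sub>R u))\<^sup>2 = e\<^sup>2 * N + t\<^sup>2 * (norm u)\<^sup>2"
        unfolding power2_norm_eq_inner N_def using u(2)
        by (simp add: inner_add_left inner_add_right orthogonal_def inner_commute power2_eq_square)
      ultimately show ?thesis using \<epsilon>(3)[OF inb[OF that]]
        by (simp add: y_def C_def algebra_simps add_divide_distrib)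
    qed
    have yy': "y t * D u (e *\<^sub>R b + t *\<^sub>R u) = C * t" if t: "t \<in> {-d<..<d}" for t
    proof -
      have "2 * y t * D u (e *\<^sub>R b + t *\<^sub>R u) = C * (2 * t)"
      proof (rule DERIV_eq_on_interval[where f = "\<lambda>t. (y t)\<^sup>2"
            and g = "\<lambda>t. (h 0 + e * N)\<^sup>2 + \<kappa> * e\<^sup>2 * N / (h 0)\<^sup>2 + C * t\<^sup>2", OF _ t])
        show "((\<lambda>t. (y t)\<^sup>2) has_real_derivative 2 * y t * D u (e *\<^sub>R b + t *\<^sub>R u)) (at t)"
          by (auto intro!: derivative_eq_intros Dy[OF t])
        show "((\<lambda>t. (h 0 + e * N)\<^sup>2 + \<kappa> * e\<^sup>2 * N / (h 0)\<^sup>2 + C * t\<^sup>2) has_real_derivative C * (2 * t)) (at t)"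
          by (auto intro!: derivative_eq_intros)
      qed (erule ysq)
      then show ?thesis by simp
    qed
    have z: "(0::real) \<in> {-d<..<d}" using d(1) by simp
    have y0: "0 < y 0" and D0: "D u (e *\<^sub>R b) = 0" using ypos[OF z] yy'[OF z] by auto
    have "D u (e *\<^sub>R b + 0 *\<^sub>R u) * D u (e *\<^sub>R b + 0 *\<^sub>R u) + D2 u u (e *\<^sub>R b + 0 *\<^sub>R u) * y 0 = C"
    proof (rule DERIV_eq_on_interval[where f = "\<lambda>t. y t * D u (e *\<^sub>R b + t *\<^sub>R u)" and g = "\<lambda>t. C * t", OF _ z])
      show "((\<lambda>t. y t * D u (e *\<^sub>R b + t *\<^sub>R u)) has_real_derivative
          D u (e *\<^sub>R b + 0 *\<^sub>R u) * D u (e *\<^sub>R b + 0 *\<^sub>R u) + D2 u u (e *\<^sub>R b + 0 *\<^sub>R u) * y 0) (at 0)"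
        by (rule DERIV_mult[OF Dy[OF z] D_line_deriv[OF in\<Omega>[OF z]]])
      show "((\<lambda>t. C * t) has_real_derivative C) (at 0)" by (auto intro!: derivative_eq_intros)
    qed (erule yy')
    then have "D2 u u (e *\<^sub>R b) * y 0 = C" using D0 by simp
    moreover have "\<kappa> * (norm u)\<^sup>2 / y 0 ^ 3 \<le> D2 u u (e *\<^sub>R b)"
      using hess[of "e *\<^sub>R b" u] in\<Omega>[OF z] by (simp add: y_def)
    ultimately have "\<kappa> * (norm u)\<^sup>2 / y 0 ^ 3 * y 0 \<le> C"
      using y0 by (metis mult_right_mono less_imp_le)
    then have "\<kappa> / (y 0)\<^sup>2 * (norm u)\<^sup>2 \<le> \<kappa> / (h 0)\<^sup>2 * (norm u)\<^sup>2"
      using y0 by (simp add: C_def power3_eq_cube power2_eq_square)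
    then have "\<kappa> / (y 0)\<^sup>2 \<le> \<kappa> / (h 0)\<^sup>2"
      by (rule mult_right_le_imp_le) (use u(1) in simp)
    then show ?thesis using y0 h0 by (simp add: y_def divide_simps)
  qed
  define \<psi> where "\<psi> e = \<kappa> * ((h 0 + e * N)\<^sup>2 + \<kappa> * (e\<^sup>2 * N) / (h 0)\<^sup>2)" for e
  \<comment> \<open>The summand \<open>1\<close> keeps the quotient meaningful while
    \<open>b = 0\<close> is still possible.\<close>
  define d where "d = \<epsilon> / (norm b + 1)"
  have d: "0 < d" using \<epsilon>(1) by (simp add: d_def add_nonneg_pos)
  have "\<psi> 0 \<le> \<psi> e" if e: "\<bar>e\<bar> < d" for e
  proof -
    have "\<bar>e\<bar> * norm b \<le> \<bar>e\<bar> * (norm b + 1)" by (simp add: mult_left_mono)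
    also have "\<dots> < \<epsilon>" using e by (simp add: d_def pos_less_divide_eq add_nonneg_pos)
    finally have eb: "e *\<^sub>R b \<in> ball 0 \<epsilon>" by simp
    have "(h (e *\<^sub>R b))\<^sup>2 = (h 0 + e * N)\<^sup>2 + \<kappa> * (e\<^sup>2 * N) / (h 0)\<^sup>2"
      using \<epsilon>(3)[OF eb] by (simp add: b N_def power_mult_distrib power2_norm_eq_inner)
    then show ?thesis using ge[OF eb] by (simp add: \<psi>_def)
  qed
  moreover have "(\<psi> has_real_derivative \<kappa> * (2 * h 0 * N)) (at 0)"
    unfolding \<psi>_def using h0 by (auto intro!: derivative_eq_intros)
  ultimately have "\<kappa> * (2 * h 0 * N) = 0"
    using d by (intro DERIV_local_min[of \<psi> _ 0 d]) auto
  then have "b = 0" using assms h0 by (simp add: N_def)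
  then show ?thesis by (simp add: b)
qed

text \<open>On a rigid ray with slope \<open>b > 0\<close> the function \<open>h\<close> is affine,
  so \<open>arc\<close> stays strictly below \<open>1 / (h 0 * b)\<close>, yet rigidity makes it
  attain every positive value. Rigid directions are only dense, so \<open>y\<close> is first moved
  to one where the slope is still positive.\<close>

lemma grad_nonpos_flat:
  assumes "\<kappa> = 0"
  shows "D y 0 \<le> 0"
proof (rule ccontr)
  assume "\<not> D y 0 \<le> 0"
  then have y: "0 < D y 0" "y \<noteq> 0" using linear_0[OF linear_D[OF zero_\<Omega>]] by auto
  have "\<forall>\<^sub>F z in at y. 0 < D z 0"
    using isCont_D0[of y] y(1) unfolding isCont_def by (rule order_tendstoD(1))
  then obtain d where d0: "0 < d" "\<And>z. z \<noteq> y \<Longrightarrow> dist z y < d \<Longrightarrow> 0 < D z 0"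
    unfolding eventually_at by blast
  then have d: "0 < d" "\<And>z. dist z y < d \<Longrightarrow> 0 < D z 0"
    using y(1) by metis+
  obtain v where v: "norm v = 1" "rigid_dir v" "dist (norm y *\<^sub>R v) y < d"
    using rigid_dense[OF rigid y(2) d(1)] by blast
  define b where "b = D v 0"
  have b: "0 < b" using d(2)[OF v(3)] linear_cmul[OF linear_D[OF zero_\<Omega>], of "norm y" v] y(2)
    by (simp add: b_def zero_less_mult_iff)
  interpret W: warped_ray "ray v" "\<lambda>t. h (t *\<^sub>R v)" "\<lambda>t. D v (t *\<^sub>R v)" "\<lambda>t. D2 v v (t *\<^sub>R v)" \<kappa> "CARD('n) - 1"
    by (rule warped_ray[OF v(1)])
  have "W.rigid" using v(2) by (simp only: rigid_dir_def)
  then have "\<exists>t\<in>ray v. W.s t = 1 / (h 0 * b)"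
    \<comment> \<open>The total \<open>arc\<close> that an infinite ray with slope \<open>b\<close>
      would have.\<close>
    using W.rigid_reached[of "1 / (h 0 * b)"] h0 b assms by (simp add: tau_def)
  then obtain t where t: "0 \<le> t" "t *\<^sub>R v \<in> \<Omega>" "arc v t = 1 / (h 0 * b)"
    unfolding s_eq_arc[OF v(1)] by (auto simp: ray_def)
  have h_eq: "h (\<xi> *\<^sub>R v) = h 0 + b * \<xi>" if "\<xi> \<in> {0..t}" for \<xi>
  proof -
    have \<xi>: "0 \<le> \<xi>" "\<xi> *\<^sub>R v \<in> \<Omega>" using that ray_down[OF t(2)] by auto
    have "ereal (arc v \<xi>) < tau \<kappa>" using assms by (simp add: tau_def)
    from h_ray[OF v(1,2) \<xi> this] have "(h (\<xi> *\<^sub>R v))\<^sup>2 = (h 0 + b * \<xi>)\<^sup>2"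
      unfolding b_def assms by simp
    then show ?thesis
      by (rule power2_eq_imp_eq) (use h_pos[OF \<xi>(2)] h0 b \<xi>(1) in simp_all)
  qed
  have "((\<lambda>\<xi>. 1 / (h (\<xi> *\<^sub>R v))\<^sup>2) has_integral - 1 / (b * (h 0 + b * t)) - - 1 / (b * (h 0 + b * 0))) {0..t}"
  proof (rule fundamental_theorem_of_calculus[OF t(1)])
    fix \<xi> assume \<xi>: "\<xi> \<in> {0..t}"
    have pos: "0 < h 0 + b * \<xi>" using \<xi> h0 b by (simp add: add_pos_nonneg)
    have "((\<lambda>\<xi>. - 1 / (b * (h 0 + b * \<xi>))) has_real_derivative 1 / (h (\<xi> *\<^sub>R v))\<^sup>2) (at \<xi>)"
      unfolding h_eq[OF \<xi>] using pos b
      by (auto intro!: derivative_eq_intros simp: power2_eq_square)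
    then show "((\<lambda>\<xi>. - 1 / (b * (h 0 + b * \<xi>))) has_vector_derivative 1 / (h (\<xi> *\<^sub>R v))\<^sup>2) (at \<xi> within {0..t})"
      by (auto simp: has_real_derivative_iff_has_vector_derivative[symmetric] intro: has_field_derivative_at_within)
  qed
  then have "arc v t = 1 / (h 0 * b) - 1 / (b * (h 0 + b * t))"
    unfolding arc_def by (simp add: integral_unique mult_ac)
  moreover have "0 < 1 / (b * (h 0 + b * t))" using h0 b t(1) by (simp add: add_pos_nonneg)
  ultimately show False using t(3) by linarith
qed

lemma grad_zero: "D v 0 = 0"
proof (cases "\<kappa> = 0")
  case True
  have "D (- v) 0 = - D v 0" using linear_neg[OF linear_D[OF zero_\<Omega>]] .
  then show ?thesis using grad_nonpos_flat[OF True, of v] grad_nonpos_flat[OF True, of "- v"] by simp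
qed (rule grad_zero_curved)

section \<open>The global shape of the function and its domain\<close>

lemma model_arc_mono:
  assumes "0 < (h 0)\<^sup>2 + \<kappa> * t\<^sup>2 / (h 0)\<^sup>2" "0 \<le> u" "u \<le> t"
  shows "integral {0..u} (\<lambda>\<xi>. 1 / ((h 0)\<^sup>2 + \<kappa> * \<xi>\<^sup>2 / (h 0)\<^sup>2)) \<le> integral {0..t} (\<lambda>\<xi>. 1 / ((h 0)\<^sup>2 + \<kappa> * \<xi>\<^sup>2 / (h 0)\<^sup>2))"
proof -
  have pos: "0 < (h 0)\<^sup>2 + \<kappa> * \<xi>\<^sup>2 / (h 0)\<^sup>2" if "\<xi> \<in> {0..t}" for \<xi>
    using quadratic_pos_mono[OF assms(1), of \<xi>] that h0 by simp
  have c: "continuous_on {0..t} (\<lambda>\<xi>. 1 / ((h 0)\<^sup>2 + \<kappa> * \<xi>\<^sup>2 / (h 0)\<^sup>2))"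
    using h0 pos by (intro continuous_intros) force+
  have "(\<lambda>\<xi>. 1 / ((h 0)\<^sup>2 + \<kappa> * \<xi>\<^sup>2 / (h 0)\<^sup>2)) integrable_on {0..u}"
    using assms(3) by (intro integrable_continuous_interval continuous_on_subset[OF c]) auto
  moreover have "0 \<le> 1 / ((h 0)\<^sup>2 + \<kappa> * \<xi>\<^sup>2 / (h 0)\<^sup>2)" if "\<xi> \<in> {0..t}" for \<xi>
    using pos[OF that] by simp
  ultimately show ?thesis
    using integrable_continuous_interval[OF c] assms(3) by (intro integral_subset_le) auto
qed

text \<open>At the first time \<open>a\<close> where \<open>arc\<close> equals \<open>tau\<close>,
  the formula for \<open>h\<close> holds at all earlier times. So \<open>arc v a\<close> is a model
  integral over a finite interval, and such integrals stay below \<open>tau\<close>.\<close>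

lemma arc_less_tau:
  assumes v: "norm v = 1" "rigid_dir v" and t: "0 \<le> t" "t *\<^sub>R v \<in> \<Omega>"
  shows "ereal (arc v t) < tau \<kappa>"
proof (rule ccontr)
  assume no: "\<not> ereal (arc v t) < tau \<kappa>"
  interpret W: warped_ray "ray v" "\<lambda>t. h (t *\<^sub>R v)" "\<lambda>t. D v (t *\<^sub>R v)" "\<lambda>t. D2 v v (t *\<^sub>R v)" \<kappa> "CARD('n) - 1"
    by (rule warped_ray[OF v(1)])
  note s = s_eq_arc[OF v(1)]
  obtain T where T: "tau \<kappa> = ereal T" "0 < T" "T \<le> arc v t"
    using no by (cases "\<kappa> > 0") (auto simp: tau_def)
  obtain a where a: "a \<in> ray v" "arc v a = T"
    using W.reach_IVT[of t T] T t unfolding s by (auto simp: ray_def)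
  have a': "0 \<le> a" "a *\<^sub>R v \<in> \<Omega>" using a by (auto simp: ray_def)
  have eq: "(h (\<xi> *\<^sub>R v))\<^sup>2 = (h 0)\<^sup>2 + \<kappa> * \<xi>\<^sup>2 / (h 0)\<^sup>2" if "\<xi> \<in> {0..a} - {a}" for \<xi>
  proof -
    have \<xi>: "0 \<le> \<xi>" "\<xi> *\<^sub>R v \<in> \<Omega>" "\<xi> < a" using that ray_down[OF a'(2)] by auto
    have "arc v \<xi> < T" using W.s_less[OF \<xi>(3,1) a(1)] a(2) unfolding s by simp
    then show ?thesis using h_ray[OF v \<xi>(1,2)] T(1) by (simp add: grad_zero)
  qed
  have "arc v a = integral {0..a} (\<lambda>\<xi>. 1 / ((h 0)\<^sup>2 + \<kappa> * \<xi>\<^sup>2 / (h 0)\<^sup>2))"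
    unfolding arc_def by (rule integral_spike[of "{a}"]) (use eq in auto)
  then show False using model_arc_less_tau[OF a'(1) h0, of \<kappa>] T(1) a(2) by simp
qed

lemma h_rigid_ray:
  assumes "norm v = 1" "rigid_dir v" "0 \<le> t" "t *\<^sub>R v \<in> \<Omega>"
  shows "(h (t *\<^sub>R v))\<^sup>2 = (h 0)\<^sup>2 + \<kappa> * t\<^sup>2 / (h 0)\<^sup>2"
  using h_ray[OF assms arc_less_tau[OF assms]] by (simp add: grad_zero)

text \<open>Were \<open>t v\<close> outside \<open>\<Omega>\<close>, the ray would end before
  \<open>t\<close> and its \<open>arc\<close> would be at most the model value at \<open>t\<close>.
  That value is below \<open>tau\<close>, while rigidity makes \<open>arc\<close> attain larger
  values.\<close>

lemma rigid_ray_full: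
  assumes v: "norm v = 1" "rigid_dir v" and t: "0 \<le> t" "0 < (h 0)\<^sup>2 + \<kappa> * t\<^sup>2 / (h 0)\<^sup>2"
  shows "t *\<^sub>R v \<in> \<Omega>"
proof (rule ccontr)
  assume no: "t *\<^sub>R v \<notin> \<Omega>"
  interpret W: warped_ray "ray v" "\<lambda>t. h (t *\<^sub>R v)" "\<lambda>t. D v (t *\<^sub>R v)" "\<lambda>t. D2 v v (t *\<^sub>R v)" \<kappa> "CARD('n) - 1"
    by (rule warped_ray[OF v(1)])
  define A where "A u = integral {0..u} (\<lambda>\<xi>. 1 / ((h 0)\<^sup>2 + \<kappa> * \<xi>\<^sup>2 / (h 0)\<^sup>2))" for u
  have le: "arc v u \<le> A t" if u: "0 \<le> u" "u *\<^sub>R v \<in> \<Omega>" for u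
  proof -
    have "u \<le> t" using ray_down[OF u(2) t(1)] no by force
    have "arc v u = A u"
      unfolding arc_def A_def
      by (rule integral_cong) (use h_rigid_ray[OF v] ray_down[OF u(2)] in auto)
    also have "\<dots> \<le> A t" unfolding A_def by (rule model_arc_mono[OF t(2) u(1) \<open>u \<le> t\<close>])
    finally show ?thesis .
  qed
  have "ereal (A t) < tau \<kappa>" unfolding A_def by (rule model_arc_less_tau[OF t(1) h0])
  then obtain R where R: "A t < R" "ereal R < tau \<kappa>" using W.tau_room by blast
  have "0 \<le> A t" using le[of 0] zero_\<Omega> by (simp add: arc_def)
  moreover have "W.rigid" using v(2) by (simp only: rigid_dir_def)
  ultimately obtain u where "u \<in> ray v" "arc v u = R"
    using W.rigid_reached[of R] R unfolding s_eq_arc[OF v(1)] by auto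
  then show False using le[of u] R(1) by (auto simp: ray_def)
qed

lemma h_sq:
  assumes "x \<in> \<Omega>"
  shows "(h x)\<^sup>2 = (h 0)\<^sup>2 + \<kappa> * (norm x)\<^sup>2 / (h 0)\<^sup>2"
proof (cases "x = 0")
  case False
  have "(h x)\<^sup>2 - ((h 0)\<^sup>2 + \<kappa> * (norm x)\<^sup>2 / (h 0)\<^sup>2) = 0"
  proof (rule dense_zero[OF _ assms False])
    show "isCont (\<lambda>x. (h x)\<^sup>2 - ((h 0)\<^sup>2 + \<kappa> * (norm x)\<^sup>2 / (h 0)\<^sup>2)) x"
      using isCont_h[OF assms] h0 by (intro continuous_intros) auto
  qed (use h_rigid_ray in auto)
  then show ?thesis by simp
qed simp

lemma \<Omega>_eq: "\<Omega> = {x. 0 < (h 0)\<^sup>2 + \<kappa> * (norm x)\<^sup>2 / (h 0)\<^sup>2}" (is "_ = ?S")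
proof
  show "\<Omega> \<subseteq> ?S"
  proof
    fix x assume x: "x \<in> \<Omega>"
    have "0 < (h x)\<^sup>2" using h_pos[OF x] by simp
    then show "x \<in> ?S" unfolding h_sq[OF x] by simp
  qed
  have "open ?S" using h0 by (intro open_Collect_less continuous_intros) auto
  moreover have "?S \<subseteq> closure \<Omega>"
  proof
    fix y assume y: "y \<in> ?S"
    show "y \<in> closure \<Omega>"
    proof (cases "y = 0")
      case False
      show ?thesis
        unfolding closure_approachable
      proof (intro allI impI)
        fix e :: real assume "0 < e"
        obtain v where v: "norm v = 1" "rigid_dir v" "dist (norm y *\<^sub>R v) y < e"
          using rigid_dense[OF rigid False \<open>0 < e\<close>] by blast
        have "norm y *\<^sub>R v \<in> \<Omega>" using rigid_ray_full[OF v(1,2)] y by simp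
        then show "\<exists>z\<in>\<Omega>. dist z y < e" using v(3) by blast
      qed
    qed (use zero_\<Omega> closure_subset in auto)
  qed
  \<comment> \<open>Density alone gives only the closure; since \<open>?S\<close> is open and
    \<open>\<Omega>\<close> is convex and open, passing to interiors removes it.\<close>
  ultimately have "?S \<subseteq> interior (closure \<Omega>)" by (rule interior_maximal[rotated])
  then show "?S \<subseteq> \<Omega>" using convex_interior_closure[OF convex_\<Omega>] interior_open[OF open_\<Omega>] by simp
qed

lemma model_domain_eq: "model_domain (\<kappa> / h 0 ^ 4) = \<Omega>"
proof (cases "\<kappa> \<ge> 0")
  case True
  then have "0 < (h 0)\<^sup>2 + \<kappa> * (norm x)\<^sup>2 / (h 0)\<^sup>2" for x :: "real^'n"
    using h0 by (intro add_pos_nonneg) auto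
  then show ?thesis using True h0 unfolding \<Omega>_eq by (simp add: model_domain_def)
next
  case False
  define c where "c = - (\<kappa> / h 0 ^ 4)"
  have c: "0 < c" using False h0 by (simp add: c_def divide_neg_pos)
  have "norm x < 1 / sqrt c \<longleftrightarrow> 0 < (h 0)\<^sup>2 + \<kappa> * (norm x)\<^sup>2 / (h 0)\<^sup>2" for x :: "real^'n"
  proof -
    have "(h 0)\<^sup>2 + \<kappa> * (norm x)\<^sup>2 / (h 0)\<^sup>2 = (h 0)\<^sup>2 * (1 - c * (norm x)\<^sup>2)"
      using h0 by (simp add: c_def field_simps power2_eq_square power4_eq_xxxx)
    then have "0 < (h 0)\<^sup>2 + \<kappa> * (norm x)\<^sup>2 / (h 0)\<^sup>2 \<longleftrightarrow> c * (norm x)\<^sup>2 < 1"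
      using h0 by (simp add: zero_less_mult_iff)
    also have "\<dots> \<longleftrightarrow> sqrt (c * (norm x)\<^sup>2) < sqrt 1" by (simp only: real_sqrt_less_iff)
    also have "\<dots> \<longleftrightarrow> norm x < 1 / sqrt c"
      using c by (simp add: real_sqrt_mult field_simps)
    finally show ?thesis by simp
  qed
  moreover have "model_domain (\<kappa> / h 0 ^ 4) = {x :: real^'n. norm x < 1 / sqrt c}"
    using False c by (simp add: model_domain_def c_def)
  ultimately show ?thesis using \<Omega>_eq by simp
qed

lemma h_eq:
  assumes "x \<in> \<Omega>"
  shows "h x = h 0 * sqrt (1 + \<kappa> / h 0 ^ 4 * (norm x)\<^sup>2)"
proof -
  have "(h x)\<^sup>2 = (h 0)\<^sup>2 * (1 + \<kappa> / h 0 ^ 4 * (norm x)\<^sup>2)"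
    unfolding h_sq[OF assms] using h0 by (simp add: field_simps power2_eq_square power4_eq_xxxx)
  then have "sqrt ((h x)\<^sup>2) = sqrt ((h 0)\<^sup>2 * (1 + \<kappa> / h 0 ^ 4 * (norm x)\<^sup>2))" by simp
  then show ?thesis using h_pos[OF assms] h0 by (simp add: real_sqrt_mult)
qed

text \<open>The constant is \<open>c = h 0\<close>: dividing \<open>h_sq\<close> by
  \<open>h^2\<close> gives the equation in \<open>y0 = 1 / h\<close> and \<open>y = x / h\<close>.
  Conversely \<open>y / y0\<close> recovers the point of \<open>\<Omega>\<close>.\<close>

lemma hyperquadric: "rot_sym_hyperquadric \<kappa> M"
  unfolding rot_sym_hyperquadric_def
proof (intro exI[of _ "h 0"] conjI h0 set_eqI iffI)
  fix z assume "z \<in> M"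
  then obtain x where x: "x \<in> \<Omega>" "z = F x" by blast
  have "(h 0)\<^sup>2 * (1 / h x)\<^sup>2 + \<kappa> / (h 0)\<^sup>2 * (norm ((1 / h x) *\<^sub>R x))\<^sup>2
      = ((h 0)\<^sup>2 + \<kappa> * (norm x)\<^sup>2 / (h 0)\<^sup>2) / (h x)\<^sup>2"
    by (simp add: power_divide add_divide_distrib)
  also have "\<dots> = 1" unfolding h_sq[OF x(1), symmetric] using h_pos[OF x(1)] by simp
  finally show "z \<in> {(y0, y). 0 < y0 \<and> (h 0)\<^sup>2 * y0\<^sup>2 + \<kappa> / (h 0)\<^sup>2 * (norm y)\<^sup>2 = 1}"
    using h_pos[OF x(1)] by (simp add: x(2) F_map_def)
next
  fix z assume "z \<in> {(y0, y). 0 < y0 \<and> (h 0)\<^sup>2 * y0\<^sup>2 + \<kappa> / (h 0)\<^sup>2 * (norm (y :: real^'n))\<^sup>2 = 1}"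
  then obtain y0 y where z: "z = (y0, y)" "0 < y0" "(h 0)\<^sup>2 * y0\<^sup>2 + \<kappa> / (h 0)\<^sup>2 * (norm y)\<^sup>2 = 1"
    by auto
  define x where "x = y /\<^sub>R y0"
  have q: "(h 0)\<^sup>2 + \<kappa> * (norm x)\<^sup>2 / (h 0)\<^sup>2 = (1 / y0)\<^sup>2"
  proof -
    have nx: "norm x = norm y / y0" using z(2) by (simp add: x_def divide_inverse mult.commute)
    have "(h 0)\<^sup>2 + \<kappa> * (norm x)\<^sup>2 / (h 0)\<^sup>2 = ((h 0)\<^sup>2 * y0\<^sup>2 + \<kappa> / (h 0)\<^sup>2 * (norm y)\<^sup>2) / y0\<^sup>2"
      unfolding nx using z(2) by (simp add: power_divide add_divide_distrib)
    then show ?thesis unfolding z(3) by (simp add: power_divide)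
  qed
  then have x: "x \<in> \<Omega>" unfolding \<Omega>_eq using z(2) by simp
  have "h x = 1 / y0"
    by (rule power2_eq_imp_eq[OF h_sq[OF x, unfolded q]]) (use h_pos[OF x] z(2) in simp_all)
  then have "z = F x" using z(1,2) by (simp add: F_map_def x_def)
  then show "z \<in> M" using x by blast
qed

end

theorem theorem3p6:
  fixes \<Omega> :: "(real^'n::finite) set" and h :: "real^'n \<Rightarrow> real" and \<kappa> :: real
  assumes dim: "CARD('n) \<ge> 2"
    and domain: "open \<Omega>" "convex \<Omega>" "0 \<in> \<Omega>"
    and h_smooth: "smooth_on \<Omega> h"
    and h_pos: "\<forall>x\<in>\<Omega>. h x > 0"
    and Ric_bound: "\<forall>y\<in>F_map h ` \<Omega>. \<forall>v\<in>tangent_space (F_map h) \<Omega> y.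
          Ric1 (F_map h) \<Omega> (g_bar \<Omega> h) (f_bar \<Omega> h) y v v
            \<ge> (real CARD('n) - 1) * \<kappa> * exp (- (4 * f_bar \<Omega> h y / (real CARD('n) - 1))) * g_bar \<Omega> h y v v"
    and volume_ratio: "\<forall>r R. 0 < r \<and> r < R \<and> ereal R < tau \<kappa> \<longrightarrow>
          (let m = weighted_volume (F_map h) \<Omega>
                     (\<lambda>y. (real CARD('n) + 1) / (real CARD('n) - 1) * f_bar \<Omega> h y) (g_bar \<Omega> h);
               C = (\<lambda>\<rho>. weighted_ball (F_map h) \<Omega> (g_bar \<Omega> h) (f_bar \<Omega> h) \<rho> (F_map h 0))
           in emeasure m (C R) / emeasure m (C r)
                = ennreal (model_volume CARD('n) \<kappa> R / model_volume CARD('n) \<kappa> r))"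
  shows "rot_sym_hyperquadric \<kappa> (F_map h ` \<Omega>) \<and>
         (let \<kappa>' = \<kappa> / h 0 ^ 4
          in (\<forall>x\<in>\<Omega>. h x = h 0 * sqrt (1 + \<kappa>' * (norm x)\<^sup>2)) \<and> \<Omega> = model_domain \<kappa>')"
proof -
  interpret G: positive_graph \<Omega> h
    using domain h_smooth h_pos by unfold_locales auto
  interpret G: comparison_graph \<Omega> h \<kappa>
  proof
    fix x v assume x: "x \<in> \<Omega>"
    define N where "N = real CARD('n) - 1"
    have N: "0 < N" using dim by (simp add: N_def)
    have hx: "0 < h x" using h_pos x by simp
    have "G.dF x v \<in> tangent_space G.F \<Omega> (G.F x)" using G.tangent_space_F[OF x] by simp
    then have "N * \<kappa> * exp (- (4 * G.f (G.F x) / N)) * G.g (G.F x) (G.dF x v) (G.dF x v)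
        \<le> Ric1 G.F \<Omega> G.g G.f (G.F x) (G.dF x v) (G.dF x v)"
      using Ric_bound x unfolding N_def by blast
    also have "\<dots> = N * (G.D2 v v x / h x)" unfolding N_def by (rule G.Ric1_dF[OF x dim])
    also have "exp (- (4 * G.f (G.F x) / N)) = 1 / h x ^ 4"
    proof -
      have "4 * G.f (G.F x) / N = of_nat 4 * ln (h x)" using G.f_F[OF x] N by (simp add: N_def)
      then show ?thesis
        using hx by (simp only: exp_minus exp_of_nat_mult exp_ln inverse_eq_divide)
    qed
    finally have "N * (\<kappa> * (v \<bullet> v) / h x ^ 4) \<le> N * (G.D2 v v x / h x)"
      by (simp add: G.g_dF[OF x] mult_ac)
    then have "\<kappa> * (v \<bullet> v) / h x ^ 4 \<le> G.D2 v v x / h x"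
      using N by (rule mult_left_le_imp_le)
    \<comment> \<open>The factor \<open>1 / h\<close> in \<open>Ric1_dF\<close> lowers the weight
      \<open>h^(-4)\<close> of the hypothesis to the \<open>h^(-3)\<close> of the ray
      equation.\<close>
    then have "\<kappa> * (v \<bullet> v) / h x ^ 4 * h x \<le> G.D2 v v x" using hx by (simp add: pos_le_divide_eq)
    moreover have "\<kappa> * (v \<bullet> v) / h x ^ 4 * h x = \<kappa> * (norm v)\<^sup>2 / h x ^ 3"
      using hx by (simp add: power2_norm_eq_inner power4_eq_xxxx power3_eq_cube)
    ultimately show "\<kappa> * (norm v)\<^sup>2 / h x ^ 3 \<le> G.D2 v v x" by simp
  qed (rule dim)
  interpret G: rigid_graph \<Omega> h \<kappa>
  proof
    show "AE x in lborel. x \<in> ball 0 1 \<longrightarrow> G.rigid_dir (x /\<^sub>R norm x)"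
      using volume_ratio by (intro G.AE_rigid) (simp add: Let_def G.mvol_def G.wball_def)
  qed
  show ?thesis
    using G.hyperquadric G.h_eq G.model_domain_eq by (simp add: Let_def)
qed

end
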